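(* Let $k\ge2$, $m\ge0$, $n\ge2$ and let $a_1,\dots,a_m$ be integers with $a_s>1$ for all $s$. Let $X\subset\mathbb{A}^{k+m+1}$ be the hypersurface over $\mathbb{K}$ given by $$x_1\cdots x_k\,y_1^{a_1}\cdots y_m^{a_m}=z^n+1,$$ and let $B=\mathbb{K}[X]$. Let $\delta$ be a homogeneous irreducible LND of $B$. Then $$\mathrm{Aut}(B)_\delta=(S_\delta\ltimes\mathbb{H}_\delta)\ltimes\mathcal{U}(\delta).$$
   Context: $\mathbb{K}$ is an algebraically closed field of characteristic zero. A derivation of $B$ is locally nilpotent (LND) if each element of $B$ is killed by some power of it. A nonzero LND $\delta$ is irreducible if $\delta(B)$ is not contained in any proper principal ideal of $B$. Two LNDs are equivalent ($\sim$) if their kernels coincide. Grading and quasitorus. $B$ is graded by $K=\mathbb{Z}^{k+m+1}/\langle(1,\dots,1,a_1,\dots,a_m,0),(0,\dots,0,n)\rangle$, where the generators $x_1,\dots,x_k,y_1,\dots,y_m,z$ are homogeneous of degrees the classes of the standard basis vectors. The corresponding quasitorus $\mathbb{H}=\mathrm{Hom}_\mathbb{Z}(K,\mathbb{K}^\times)$ acts on $B$ effectively by rescaling the generators; it consists of all diagonal rescalings leaving both monomials $x_1\cdots x_ky_1^{a_1}\cdots y_m^{a_m}$ and $z^n$ invariant. A derivation is homogeneous if it sends $K$-homogeneous elements to $K$-homogeneous elements. Every homogeneous irreducible LND of $B$ is, up to a nonzero scalar factor, one of $\partial_i$, $1\le i\le k$, where $\partial_i(x_i)=nz^{n-1}$,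 $\partial_i(z)=y_1^{a_1}\cdots y_m^{a_m}\prod_{j\ne i}x_j$, and $\partial_i(x_j)=\partial_i(y_s)=0$ for $j\ne i$, $1\le s\le m$. $\mathrm{Aut}(B)_\delta=\{\varphi\in\mathrm{Aut}(B):\varphi\delta=\delta\varphi\}$, $\mathbb{H}_\delta=\mathbb{H}\cap\mathrm{Aut}(B)_\delta$, and $\mathcal{U}(\delta)=\{\exp(\partial):\partial\text{ an LND of }B,\ \partial\sim\delta\text{ or }\partial=0\}$. For $\delta$ proportional to $\partial_i$, $S_\delta$ is the group of all permutations of the $k+m-1$ variables $x_j$ ($j\ne i$), $y_1,\dots,y_m$ that preserve the monomial $y_1^{a_1}\cdots y_m^{a_m}\prod_{j\ne i}x_j$; it is regarded as a subgroup of $\mathrm{Aut}(B)_\delta$ by letting it fix $x_i$ and $z$. *)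

theory Defs
  imports
    "HOL-Algebra.Algebra"
    "HOL-Computational_Algebra.Polynomial"
    "HOL-Library.Poly_Mapping"
begin

section \<open>Derivations and automorphisms of an algebra\<close>

text \<open>
  Algebras over a field are represented by records of type \<^typ>\<open>('k, 'b) module\<close> with scalars in a
  type \<^typ>\<open>'k\<close>. Self-maps of an algebra are extensional, so that equality of maps is equality on the
  carrier, as for \<^const>\<open>BijGroup\<close>.
\<close>

definition derivation :: "('k, 'b) module \<Rightarrow> ('b \<Rightarrow> 'b) \<Rightarrow> bool" where
  "derivation B D \<longleftrightarrow>
     D \<in> carrier B \<rightarrow>\<^sub>E carrier B \<and>
     (\<forall>f\<in>carrier B. \<forall>g\<in>carrier B. D (f \<oplus>\<^bsub>B\<^esub> g) = D f \<oplus>\<^bsub>B\<^esub> D g) \<and>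
     (\<forall>c. \<forall>f\<in>carrier B. D (c \<odot>\<^bsub>B\<^esub> f) = c \<odot>\<^bsub>B\<^esub> D f) \<and>
     (\<forall>f\<in>carrier B. \<forall>g\<in>carrier B. D (f \<otimes>\<^bsub>B\<^esub> g) = (D f \<otimes>\<^bsub>B\<^esub> g) \<oplus>\<^bsub>B\<^esub> (f \<otimes>\<^bsub>B\<^esub> D g))"

definition lnd :: "('k, 'b) module \<Rightarrow> ('b \<Rightarrow> 'b) \<Rightarrow> bool" where
  "lnd B D \<longleftrightarrow> derivation B D \<and> (\<forall>f\<in>carrier B. \<exists>N. (D ^^ N) f = \<zero>\<^bsub>B\<^esub>)"

definition zero_map :: "('k, 'b) module \<Rightarrow> 'b \<Rightarrow> 'b" where
  "zero_map B = (\<lambda>f\<in>carrier B. \<zero>\<^bsub>B\<^esub>)"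

definition irreducible_lnd :: "('k, 'b) module \<Rightarrow> ('b \<Rightarrow> 'b) \<Rightarrow> bool" where
  "irreducible_lnd B D \<longleftrightarrow> lnd B D \<and> D \<noteq> zero_map B \<and>
     (\<forall>I. principalideal I B \<and> D ` carrier B \<subseteq> I \<longrightarrow> I = carrier B)"

definition der_kernel :: "('k, 'b) module \<Rightarrow> ('b \<Rightarrow> 'b) \<Rightarrow> 'b set" where
  "der_kernel B D = {f \<in> carrier B. D f = \<zero>\<^bsub>B\<^esub>}"

definition equivalent_lnds :: "('k, 'b) module \<Rightarrow> ('b \<Rightarrow> 'b) \<Rightarrow> ('b \<Rightarrow> 'b) \<Rightarrow> bool" where
  "equivalent_lnds B D E \<longleftrightarrow> lnd B D \<and> lnd B E \<and> der_kernel B D = der_kernel B E"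

text \<open>
  Only the nonzero terms of the exponential series are summed; for a locally nilpotent derivation
  there are finitely many of them.
\<close>

definition lnd_exp :: "('k::field_char_0, 'b) module \<Rightarrow> ('b \<Rightarrow> 'b) \<Rightarrow> 'b \<Rightarrow> 'b" where
  "lnd_exp B D = (\<lambda>f\<in>carrier B.
     \<Oplus>\<^bsub>B\<^esub> j\<in>{j. (D ^^ j) f \<noteq> \<zero>\<^bsub>B\<^esub>}. inverse (fact j) \<odot>\<^bsub>B\<^esub> (D ^^ j) f)"

definition alg_aut :: "('k, 'b) module \<Rightarrow> ('b \<Rightarrow> 'b) set" where
  "alg_aut B = {\<phi> \<in> ring_iso B B. \<phi> \<in> extensional (carrier B) \<and>
     (\<forall>c. \<forall>f\<in>carrier B. \<phi> (c \<odot>\<^bsub>B\<^esub> f) = c \<odot>\<^bsub>B\<^esub> \<phi> f)}"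

definition aut_centralizer :: "('k, 'b) module \<Rightarrow> ('b \<Rightarrow> 'b) \<Rightarrow> ('b \<Rightarrow> 'b) set" where
  "aut_centralizer B D = {\<phi> \<in> alg_aut B. \<forall>f\<in>carrier B. \<phi> (D f) = D (\<phi> f)}"

definition aut_centralizer_group :: "('k, 'b) module \<Rightarrow> ('b \<Rightarrow> 'b) \<Rightarrow> ('b \<Rightarrow> 'b) monoid" where
  "aut_centralizer_group B D = (BijGroup (carrier B))\<lparr>carrier := aut_centralizer B D\<rparr>"

definition unipotent_aut ::
    "('k::field_char_0, 'b) module \<Rightarrow> ('b \<Rightarrow> 'b) \<Rightarrow> ('b \<Rightarrow> 'b) set" where
  "unipotent_aut B D =
     {lnd_exp B E | E. lnd B E \<and> (equivalent_lnds B E D \<or> E = zero_map B)}"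

text \<open>The group \<open>G\<close> is the (internal) semidirect product of \<open>Q\<close> and the normal subgroup \<open>N\<close>.\<close>

definition internal_semidirect :: "('g, 'r) monoid_scheme \<Rightarrow> 'g set \<Rightarrow> 'g set \<Rightarrow> bool" where
  "internal_semidirect G Q N \<longleftrightarrow>
     group G \<and> subgroup Q G \<and> N \<lhd> G \<and> Q \<inter> N = {\<one>\<^bsub>G\<^esub>} \<and> Q <#>\<^bsub>G\<^esub> N = carrier G"


section \<open>The hypersurface and its coordinate ring\<close>

datatype coord = VX nat | VY nat | VZ

definition coords :: "nat \<Rightarrow> nat \<Rightarrow> coord set" where
  "coords k m = VX ` {1..k} \<union> VY ` {1..m} \<union> {VZ}"

definition hypersurface ::
    "nat \<Rightarrow> nat \<Rightarrow> nat \<Rightarrow> (nat \<Rightarrow> nat) \<Rightarrow> (coord \<Rightarrow> 'k::field) set" where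
  "hypersurface k m n a = {p \<in> coords k m \<rightarrow>\<^sub>E UNIV.
     (\<Prod>i=1..k. p (VX i)) * (\<Prod>s=1..m. p (VY s) ^ a s) = p VZ ^ n + 1}"

text \<open>
  A polynomial is given by a finite set \<open>E\<close> of exponents and a coefficient function \<open>c\<close>.
\<close>

definition poly_value ::
    "coord set \<Rightarrow> (coord \<Rightarrow> nat) set \<Rightarrow> ((coord \<Rightarrow> nat) \<Rightarrow> 'k::field) \<Rightarrow> (coord \<Rightarrow> 'k) \<Rightarrow> 'k" where
  "poly_value V E c p = (\<Sum>e\<in>E. c e * (\<Prod>v\<in>V. p v ^ e v))"

definition coord_ring ::
    "nat \<Rightarrow> nat \<Rightarrow> nat \<Rightarrow> (nat \<Rightarrow> nat) \<Rightarrow> ('k::field, (coord \<Rightarrow> 'k) \<Rightarrow> 'k) module" where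
  "coord_ring k m n a = (let P = hypersurface k m n a in
     \<lparr>carrier = {(\<lambda>p\<in>P. poly_value (coords k m) E c p) | E c. finite E},
      monoid.mult = \<lambda>f g. \<lambda>p\<in>P. f p * g p,
      one = \<lambda>p\<in>P. 1,
      ring.zero = \<lambda>p\<in>P. 0,
      ring.add = \<lambda>f g. \<lambda>p\<in>P. f p + g p,
      module.smult = \<lambda>c f. \<lambda>p\<in>P. c * f p\<rparr>)"

definition gen ::
    "nat \<Rightarrow> nat \<Rightarrow> nat \<Rightarrow> (nat \<Rightarrow> nat) \<Rightarrow> coord \<Rightarrow> (coord \<Rightarrow> 'k::field) \<Rightarrow> 'k" where
  "gen k m n a v = (\<lambda>p\<in>hypersurface k m n a. p v)"


section \<open>The grading and the quasitorus\<close>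

fun xy_exponent :: "(nat \<Rightarrow> nat) \<Rightarrow> coord \<Rightarrow> nat" where
  "xy_exponent a (VX i) = 1"
| "xy_exponent a (VY s) = a s"
| "xy_exponent a VZ = 0"

definition z_exponent :: "nat \<Rightarrow> coord \<Rightarrow> nat" where
  "z_exponent n v = (if v = VZ then n else 0)"

definition exponent_vector :: "coord set \<Rightarrow> (coord \<Rightarrow> nat) \<Rightarrow> (coord \<Rightarrow>\<^sub>0 int)" where
  "exponent_vector V e = (\<Sum>v\<in>V. frag_cmul (int (e v)) (frag_of v))"

definition relation_lattice ::
    "nat \<Rightarrow> nat \<Rightarrow> nat \<Rightarrow> (nat \<Rightarrow> nat) \<Rightarrow> (coord \<Rightarrow>\<^sub>0 int) set" where
  "relation_lattice k m n a = generate (free_Abelian_group (coords k m))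
     {exponent_vector (coords k m) (xy_exponent a), exponent_vector (coords k m) (z_exponent n)}"

definition degree_group ::
    "nat \<Rightarrow> nat \<Rightarrow> nat \<Rightarrow> (nat \<Rightarrow> nat) \<Rightarrow> (coord \<Rightarrow>\<^sub>0 int) set monoid" where
  "degree_group k m n a = free_Abelian_group (coords k m) Mod relation_lattice k m n a"

definition degree_class ::
    "nat \<Rightarrow> nat \<Rightarrow> nat \<Rightarrow> (nat \<Rightarrow> nat) \<Rightarrow> (coord \<Rightarrow>\<^sub>0 int) \<Rightarrow> (coord \<Rightarrow>\<^sub>0 int) set" where
  "degree_class k m n a u = relation_lattice k m n a #>\<^bsub>free_Abelian_group (coords k m)\<^esub> u"

definition graded_piece ::
    "nat \<Rightarrow> nat \<Rightarrow> nat \<Rightarrow> (nat \<Rightarrow> nat) \<Rightarrow> (coord \<Rightarrow>\<^sub>0 int) set \<Rightarrow> ((coord \<Rightarrow> 'k::field) \<Rightarrow> 'k) set" where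
  "graded_piece k m n a w =
     {(\<lambda>p\<in>hypersurface k m n a. poly_value (coords k m) E c p) | E c. finite E \<and>
        (\<forall>e\<in>E. degree_class k m n a (exponent_vector (coords k m) e) = w)}"

definition homogeneous ::
    "nat \<Rightarrow> nat \<Rightarrow> nat \<Rightarrow> (nat \<Rightarrow> nat) \<Rightarrow> ((coord \<Rightarrow> 'k::field) \<Rightarrow> 'k) \<Rightarrow> bool" where
  "homogeneous k m n a f \<longleftrightarrow>
     (\<exists>w\<in>carrier (degree_group k m n a). f \<in> graded_piece k m n a w)"

definition homogeneous_derivation ::
    "nat \<Rightarrow> nat \<Rightarrow> nat \<Rightarrow> (nat \<Rightarrow> nat) \<Rightarrow>
     (((coord \<Rightarrow> 'k::field) \<Rightarrow> 'k) \<Rightarrow> ((coord \<Rightarrow> 'k) \<Rightarrow> 'k)) \<Rightarrow> bool" where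
  "homogeneous_derivation k m n a D \<longleftrightarrow> derivation (coord_ring k m n a) D \<and>
     (\<forall>f. homogeneous k m n a f \<longrightarrow> homogeneous k m n a (D f))"

definition nonzero_scalars :: "'k::field monoid" where
  "nonzero_scalars = \<lparr>carrier = {c. c \<noteq> 0}, monoid.mult = (*), one = 1\<rparr>"

text \<open>
  The image in the automorphism group of the group of characters of the degree group; the action is
  effective, so this is a faithful copy of the quasitorus.
\<close>

definition quasitorus ::
    "nat \<Rightarrow> nat \<Rightarrow> nat \<Rightarrow> (nat \<Rightarrow> nat) \<Rightarrow>
     (((coord \<Rightarrow> 'k::field) \<Rightarrow> 'k) \<Rightarrow> ((coord \<Rightarrow> 'k) \<Rightarrow> 'k)) set" where
  "quasitorus k m n a = {\<phi> \<in> alg_aut (coord_ring k m n a).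
     \<exists>\<chi>\<in>hom (degree_group k m n a) (nonzero_scalars :: 'k monoid). \<forall>v\<in>coords k m.
       \<phi> (gen k m n a v) =
         \<chi> (degree_class k m n a (frag_of v)) \<odot>\<^bsub>coord_ring k m n a\<^esub> gen k m n a v}"

definition quasitorus_centralizer ::
    "nat \<Rightarrow> nat \<Rightarrow> nat \<Rightarrow> (nat \<Rightarrow> nat) \<Rightarrow>
     (((coord \<Rightarrow> 'k::field) \<Rightarrow> 'k) \<Rightarrow> ((coord \<Rightarrow> 'k) \<Rightarrow> 'k)) \<Rightarrow>
     (((coord \<Rightarrow> 'k) \<Rightarrow> 'k) \<Rightarrow> ((coord \<Rightarrow> 'k) \<Rightarrow> 'k)) set" where
  "quasitorus_centralizer k m n a D =
     quasitorus k m n a \<inter> aut_centralizer (coord_ring k m n a) D"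


section \<open>The derivations $\partial_i$ and the permutation group\<close>

text \<open>
  A derivation is determined by its values on the generators, so for each \<open>i\<close> at most one map
  satisfies the following predicate.
\<close>

definition is_partial ::
    "nat \<Rightarrow> nat \<Rightarrow> nat \<Rightarrow> (nat \<Rightarrow> nat) \<Rightarrow> nat \<Rightarrow>
     (((coord \<Rightarrow> 'k::field) \<Rightarrow> 'k) \<Rightarrow> ((coord \<Rightarrow> 'k) \<Rightarrow> 'k)) \<Rightarrow> bool" where
  "is_partial k m n a i D \<longleftrightarrow> (let B = coord_ring k m n a; g = gen k m n a in
     derivation B D \<and>
     D (g (VX i)) = of_nat n \<odot>\<^bsub>B\<^esub> (g VZ [^]\<^bsub>B\<^esub> (n - 1)) \<and>
     D (g VZ) = (\<Otimes>\<^bsub>B\<^esub> s\<in>{1..m}. g (VY s) [^]\<^bsub>B\<^esub> a s) \<otimes>\<^bsub>B\<^esub> (\<Otimes>\<^bsub>B\<^esub> j\<in>{1..k} - {i}. g (VX j)) \<and>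
     (\<forall>j\<in>{1..k} - {i}. D (g (VX j)) = \<zero>\<^bsub>B\<^esub>) \<and>
     (\<forall>s\<in>{1..m}. D (g (VY s)) = \<zero>\<^bsub>B\<^esub>))"

definition proportional_to_partial ::
    "nat \<Rightarrow> nat \<Rightarrow> nat \<Rightarrow> (nat \<Rightarrow> nat) \<Rightarrow> nat \<Rightarrow>
     (((coord \<Rightarrow> 'k::field) \<Rightarrow> 'k) \<Rightarrow> ((coord \<Rightarrow> 'k) \<Rightarrow> 'k)) \<Rightarrow> bool" where
  "proportional_to_partial k m n a i D \<longleftrightarrow> (\<exists>c D'. c \<noteq> 0 \<and> is_partial k m n a i D' \<and>
     D = (\<lambda>f\<in>carrier (coord_ring k m n a). c \<odot>\<^bsub>coord_ring k m n a\<^esub> D' f))"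

text \<open>
  A permutation \<open>\<sigma>\<close> of the variables preserves a monomial iff it preserves the exponents occurring in
  it. The index \<open>i\<close> is determined by the derivation.
\<close>

definition permutation_aut ::
    "nat \<Rightarrow> nat \<Rightarrow> nat \<Rightarrow> (nat \<Rightarrow> nat) \<Rightarrow>
     (((coord \<Rightarrow> 'k::field) \<Rightarrow> 'k) \<Rightarrow> ((coord \<Rightarrow> 'k) \<Rightarrow> 'k)) \<Rightarrow>
     (((coord \<Rightarrow> 'k) \<Rightarrow> 'k) \<Rightarrow> ((coord \<Rightarrow> 'k) \<Rightarrow> 'k)) set" where
  "permutation_aut k m n a D = {\<phi> \<in> alg_aut (coord_ring k m n a).
     \<exists>i\<in>{1..k}. proportional_to_partial k m n a i D \<and>
       (\<exists>\<sigma>. \<sigma> permutes (coords k m - {VX i, VZ}) \<and>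
          (\<forall>v\<in>coords k m - {VX i, VZ}. xy_exponent a (\<sigma> v) = xy_exponent a v) \<and>
          (\<forall>v\<in>coords k m. \<phi> (gen k m n a v) = gen k m n a (\<sigma> v)))}"

end

theory Submission
  imports Defs
begin

text \<open>
  Two arguments carry the proof.

  The first one identifies \<open>\<delta>\<close>. If a homogeneous locally nilpotent derivation moved two of the
  variables \<open>x\<^sub>j\<close>, \<open>y\<^sub>s\<close>, say \<open>u\<close> with exponent \<open>\<alpha>\<close> and \<open>v\<close> with exponent \<open>\<beta>\<close>, consider the integer
  grading in which \<open>u\<close> has weight \<open>\<beta>\<close>, \<open>v\<close> has weight \<open>-\<alpha>\<close> and the other generators have weight
  \<open>0\<close>. The kernel is factorially closed and contains neither \<open>u\<close> nor \<open>v\<close>, so that its homogeneous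
  elements have weight \<open>0\<close>. Applying \<open>\<delta>\<close> repeatedly leads from \<open>u\<close> and from \<open>v\<close> into the kernel, hence
  the weight of \<open>\<delta>\<close> would be both negative and positive. So \<open>\<delta>\<close> moves exactly one variable besides \<open>z\<close>.
  Differentiating the equation of the hypersurface and comparing degrees shows that this variable has
  exponent \<open>1\<close>, that it is some \<open>x\<^sub>i\<close>, and that \<open>\<delta>\<close> is the standard derivation \<open>\<partial>\<^sub>i\<close> times a kernel
  element, which irreducibility turns into a nonzero constant (\<open>homogeneous_irreducible_lnd\<close>).

  The second one computes the centralizer. Let \<open>W\<close> consist of the \<open>x\<^sub>j\<close> with \<open>j \<noteq> i\<close> and of the \<open>y\<^sub>s\<close>, and
  let \<open>M\<close> be the monomial in \<open>W\<close> with \<open>x\<^sub>i M = z\<^sup>n + 1\<close>. The elements \<open>x\<^sub>i\<^sup>l z\<^sup>j\<close>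
  with \<open>j < n\<close> form a basis of the ring over the polynomials in \<open>W\<close>. The derivation \<open>\<delta>\<close> has degree
  \<open>ln + j\<close> on such an element, so the expansion of an element displays its degree; in particular
  the kernel of \<open>\<delta>\<close> is the polynomial ring in \<open>W\<close>, and an element killed by \<open>\<delta>\<^sup>2\<close> is affine in \<open>z\<close>.
  An automorphism \<open>\<phi>\<close> commuting with \<open>\<delta>\<close> preserves the kernels of \<open>\<delta>\<close> and \<open>\<delta>\<^sup>2\<close> and therefore sends \<open>z\<close> to
  \<open>\<beta>z + b\<^sub>0\<close> and \<open>M\<close> to \<open>\<beta>M\<close> with \<open>\<beta>\<close> a unit, that is, a constant. Expanding
  \<open>\<phi>(x\<^sub>i) \<phi>(M) = \<phi>(z)\<^sup>n + 1\<close> in the basis gives \<open>\<beta>\<^sup>n = 1\<close> and \<open>b\<^sub>0 = hM\<close> (\<open>centralizer_z\<close>).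
  The term \<open>hM\<close> is removed by an exponential \<open>exp(F\<delta>)\<close> with \<open>F\<close> in the kernel, and these exponentials
  are exactly the members of the unipotent group. On the variables of \<open>W\<close>, the equation \<open>\<phi>(M) = \<beta>M\<close> makes
  every \<open>\<phi>(w)\<close> a divisor of a monomial, hence a monomial, and invertibility makes it a multiple
  of a variable (\<open>centralizer_permutation\<close>). What remains is a permutation of \<open>W\<close> preserving exponents
  followed by a rescaling of the generators, that is, an element of the quasitorus.
\<close>


section \<open>Algebras of functions\<close>

text \<open>
  The elements are functions on \<open>\<V>\<close> with values in the field, so that identities between them
  can be checked pointwise by field arithmetic.
\<close>

locale function_algebra =
  fixes B :: "('k::field_char_0, 'p \<Rightarrow> 'k) module" (structure) and \<V> :: "'p set"
  assumes carrier_extensional: "f \<in> carrier B \<Longrightarrow> f \<in> extensional \<V>"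
    and mult_eq: "monoid.mult B = (\<lambda>f g. \<lambda>p\<in>\<V>. f p * g p)"
    and add_eq: "ring.add B = (\<lambda>f g. \<lambda>p\<in>\<V>. f p + g p)"
    and smult_eq: "module.smult B = (\<lambda>c f. \<lambda>p\<in>\<V>. c * f p)"
    and one_eq: "one B = (\<lambda>p\<in>\<V>. 1)"
    and zero_eq: "ring.zero B = (\<lambda>p\<in>\<V>. 0)"
    and mult_mem: "f \<in> carrier B \<Longrightarrow> g \<in> carrier B \<Longrightarrow> (\<lambda>p\<in>\<V>. f p * g p) \<in> carrier B"
    and add_mem: "f \<in> carrier B \<Longrightarrow> g \<in> carrier B \<Longrightarrow> (\<lambda>p\<in>\<V>. f p + g p) \<in> carrier B"
    and const_mem: "(\<lambda>p\<in>\<V>. c) \<in> carrier B"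
begin

lemma eval_mult [simp]: "p \<in> \<V> \<Longrightarrow> (f \<otimes> g) p = f p * g p"
  and eval_add [simp]: "p \<in> \<V> \<Longrightarrow> (f \<oplus> g) p = f p + g p"
  and eval_smult [simp]: "p \<in> \<V> \<Longrightarrow> (c \<odot> f) p = c * f p"
  and eval_one [simp]: "p \<in> \<V> \<Longrightarrow> \<one> p = 1"
  and eval_zero [simp]: "p \<in> \<V> \<Longrightarrow> \<zero> p = 0"
  by (simp_all add: mult_eq add_eq smult_eq one_eq zero_eq)

lemma elem_eqI:
  assumes "f \<in> carrier B" "g \<in> carrier B" "\<And>p. p \<in> \<V> \<Longrightarrow> f p = g p"
  shows "f = g"
  using assms by (intro extensionalityI[OF carrier_extensional carrier_extensional])

lemma one_mem [simp]: "\<one> \<in> carrier B" and zero_mem [simp]: "\<zero> \<in> carrier B"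
  by (simp_all add: one_eq zero_eq const_mem)

lemma mult_mem' [simp]: "f \<in> carrier B \<Longrightarrow> g \<in> carrier B \<Longrightarrow> f \<otimes> g \<in> carrier B"
  and add_mem' [simp]: "f \<in> carrier B \<Longrightarrow> g \<in> carrier B \<Longrightarrow> f \<oplus> g \<in> carrier B"
  by (simp_all add: mult_eq add_eq mult_mem add_mem)

lemma smult_mem [simp]: "f \<in> carrier B \<Longrightarrow> c \<odot> f \<in> carrier B"
proof -
  assume f: "f \<in> carrier B"
  have "c \<odot> f = (\<lambda>p\<in>\<V>. (\<lambda>p\<in>\<V>. c) p * f p)" by (auto simp: smult_eq restrict_def)
  then show ?thesis using mult_mem[OF const_mem f] by simp
qed

lemma add_zero [simp]: "f \<in> carrier B \<Longrightarrow> f \<oplus> \<zero> = f" "f \<in> carrier B \<Longrightarrow> \<zero> \<oplus> f = f"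
  by (auto intro: elem_eqI)

lemma mult_zero [simp]: "f \<in> carrier B \<Longrightarrow> f \<otimes> \<zero> = \<zero>" "f \<in> carrier B \<Longrightarrow> \<zero> \<otimes> f = \<zero>"
  by (auto intro: elem_eqI)

lemma nonzeroE:
  assumes "f \<in> carrier B" "f \<noteq> \<zero>"
  obtains p where "p \<in> \<V>" "f p \<noteq> 0"
  using assms elem_eqI[OF assms(1) zero_mem] by fastforce

lemma cring_B: "cring B"
proof (rule cringI)
  show "abelian_group B"
  proof (rule abelian_groupI)
    fix f assume f: "f \<in> carrier B"
    have "(- 1) \<odot> f \<oplus> f = \<zero>" by (rule elem_eqI) (use f in auto)
    then show "\<exists>y\<in>carrier B. y \<oplus> f = \<zero>" using f smult_mem by blast
  qed (auto intro!: elem_eqI)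
  show "comm_monoid B"
    by (rule comm_monoidI) (auto intro!: elem_eqI)
  show "\<And>x y z. \<lbrakk>x \<in> carrier B; y \<in> carrier B; z \<in> carrier B\<rbrakk>
           \<Longrightarrow> (x \<oplus> y) \<otimes> z = x \<otimes> z \<oplus> y \<otimes> z"
    by (rule elem_eqI) (auto simp: algebra_simps)
qed

lemma eval_pow [simp]: "p \<in> \<V> \<Longrightarrow> (f [^] (j::nat)) p = f p ^ j"
  by (induction j) (auto simp: nat_pow_def mult.commute)

lemma pow_mem [simp]: "f \<in> carrier B \<Longrightarrow> f [^] (j::nat) \<in> carrier B"
  by (induction j) (auto simp: nat_pow_def)

lemma pow_Suc': "f [^] Suc j = f [^] j \<otimes> f" and pow_0': "f [^] (0::nat) = \<one>"
  by (simp_all add: nat_pow_def)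

lemma eval_finsum:
  assumes "finite J" "\<And>j. j \<in> J \<Longrightarrow> F j \<in> carrier B" "p \<in> \<V>"
  shows "(\<Oplus>j\<in>J. F j) p = (\<Sum>j\<in>J. F j p)"
  using assms
proof (induction J rule: finite_induct)
  case (insert x J)
  interpret cring B by (rule cring_B)
  have "(\<Oplus>j\<in>insert x J. F j) = F x \<oplus> (\<Oplus>j\<in>J. F j)" using insert by (intro finsum_insert) auto
  then show ?case using insert by simp
next
  case empty
  interpret cring B by (rule cring_B)
  show ?case using empty by simp
qed

lemma finsum_mem:
  "(\<And>j. j \<in> J \<Longrightarrow> F j \<in> carrier B) \<Longrightarrow> (\<Oplus>j\<in>J. F j) \<in> carrier B"
  and finprod_mem:
  "(\<And>j. j \<in> J \<Longrightarrow> F j \<in> carrier B) \<Longrightarrow> (\<Otimes>j\<in>J. F j) \<in> carrier B"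
proof -
  interpret cring B by (rule cring_B)
  show "(\<And>j. j \<in> J \<Longrightarrow> F j \<in> carrier B) \<Longrightarrow> (\<Oplus>j\<in>J. F j) \<in> carrier B"
    and "(\<And>j. j \<in> J \<Longrightarrow> F j \<in> carrier B) \<Longrightarrow> (\<Otimes>j\<in>J. F j) \<in> carrier B"
    by (auto intro: finsum_closed finprod_closed)
qed

lemma eval_finprod:
  assumes "finite J" "\<And>j. j \<in> J \<Longrightarrow> F j \<in> carrier B" "p \<in> \<V>"
  shows "(\<Otimes>j\<in>J. F j) p = (\<Prod>j\<in>J. F j p)"
  using assms
proof (induction J rule: finite_induct)
  case (insert x J)
  interpret cring B by (rule cring_B)
  have "(\<Otimes>j\<in>insert x J. F j) = F x \<otimes> (\<Otimes>j\<in>J. F j)" using insert by (intro finprod_insert) auto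
  then show ?case using insert by simp
next
  case empty
  interpret cring B by (rule cring_B)
  show ?case using empty by simp
qed


section \<open>Locally nilpotent derivations\<close>

lemma derivation_mem [simp]: "derivation B D \<Longrightarrow> f \<in> carrier B \<Longrightarrow> D f \<in> carrier B"
  by (auto simp: derivation_def)

lemma derivation_funpow_mem [simp]:
  "derivation B D \<Longrightarrow> f \<in> carrier B \<Longrightarrow> (D ^^ j) f \<in> carrier B"
  by (induction j) auto

lemma derivation_add:
  "derivation B D \<Longrightarrow> f \<in> carrier B \<Longrightarrow> g \<in> carrier B \<Longrightarrow> D (f \<oplus> g) = D f \<oplus> D g"
  and derivation_mult:
  "derivation B D \<Longrightarrow> f \<in> carrier B \<Longrightarrow> g \<in> carrier B \<Longrightarrow> D (f \<otimes> g) = D f \<otimes> g \<oplus> f \<otimes> D g"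
  and derivation_smult:
  "derivation B D \<Longrightarrow> f \<in> carrier B \<Longrightarrow> D (c \<odot> f) = c \<odot> D f"
  by (auto simp: derivation_def)

lemma derivation_zero [simp]: "derivation B D \<Longrightarrow> D \<zero> = \<zero>"
  using derivation_smult[of D \<zero> 0] by (metis (no_types, lifting) derivation_mem elem_eqI eval_smult
      eval_zero mult_zero_left smult_mem zero_mem)

lemma derivation_const: assumes D: "derivation B D" shows "D (\<lambda>p\<in>\<V>. c) = \<zero>"
proof -
  have 1: "D \<one> = \<zero>"
  proof (rule elem_eqI)
    fix p assume p: "p \<in> \<V>"
    have "\<one> \<otimes> \<one> = \<one>" by (rule elem_eqI) auto
    then have "D \<one> p = D (\<one> \<otimes> \<one>) p" by simp
    also have "\<dots> = D \<one> p + D \<one> p" using derivation_mult[OF D, of \<one> \<one>] p by simp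
    finally show "D \<one> p = \<zero> p" using p by simp
  qed (use D in auto)
  have "(\<lambda>p\<in>\<V>. c) = c \<odot> \<one>" by (rule elem_eqI) (auto simp: const_mem)
  then have "D (\<lambda>p\<in>\<V>. c) = c \<odot> \<zero>" using derivation_smult[OF D one_mem] 1 by simp
  also have "\<dots> = \<zero>" by (rule elem_eqI) auto
  finally show ?thesis .
qed

lemma derivation_one [simp]: "derivation B D \<Longrightarrow> D \<one> = \<zero>"
  using derivation_const[of D 1] by (metis one_eq)

lemma derivation_pow:
  assumes D: "derivation B D" and f: "f \<in> carrier B" and p: "p \<in> \<V>"
  shows "D (f [^] (j::nat)) p = of_nat j * f p ^ (j - 1) * D f p"
proof (induction j)
  case 0
  then show ?case using D p by (simp add: pow_0')
next
  case (Suc j)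
  have "D (f [^] Suc j) p = D (f [^] j) p * f p + f p ^ j * D f p"
    using derivation_mult[OF D pow_mem[OF f, of j] f] p by (simp add: pow_Suc')
  then show ?case using Suc by (cases j) (auto simp: algebra_simps)
qed

lemma derivation_iter_add:
  assumes "derivation B D" "f \<in> carrier B" "g \<in> carrier B"
  shows "(D ^^ j) (f \<oplus> g) = (D ^^ j) f \<oplus> (D ^^ j) g"
  by (induction j) (use assms in \<open>auto simp: derivation_add\<close>)

lemma derivation_iter_smult:
  assumes "derivation B D" "f \<in> carrier B"
  shows "(D ^^ j) (c \<odot> f) = c \<odot> (D ^^ j) f"
  by (induction j) (use assms in \<open>auto simp: derivation_smult\<close>)

lemma derivation_iter_zero [simp]: "derivation B D \<Longrightarrow> (D ^^ j) \<zero> = \<zero>"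
  by (induction j) auto

lemma derivation_iter_zero_mono:
  assumes "derivation B D" "(D ^^ i) f = \<zero>" "i \<le> j"
  shows "(D ^^ j) f = \<zero>"
proof -
  have "(D ^^ j) f = (D ^^ (j - i)) ((D ^^ i) f)"
    using assms(3) by (metis comp_apply funpow_add le_add_diff_inverse2)
  then show ?thesis using assms by simp
qed

lemma lnd_derivation: "lnd B D \<Longrightarrow> derivation B D"
  by (simp add: lnd_def)

text \<open>
  The value at \<open>p\<close> of \<open>exp(tD)(f)\<close>, as a polynomial in the time \<open>t\<close>. The Leibniz rule for
  iterated derivations becomes multiplicativity of this polynomial, which avoids binomial sums.
\<close>

definition flow :: "(('p \<Rightarrow> 'k) \<Rightarrow> 'p \<Rightarrow> 'k) \<Rightarrow> ('p \<Rightarrow> 'k) \<Rightarrow> 'p \<Rightarrow> 'k poly" where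
  "flow D f p = Abs_poly (\<lambda>j. (D ^^ j) f p / fact j)"

lemma coeff_flow:
  assumes D: "lnd B D" and f: "f \<in> carrier B" and p: "p \<in> \<V>"
  shows "coeff (flow D f p) j = (D ^^ j) f p / fact j"
proof -
  obtain N where N: "(D ^^ N) f = \<zero>" using D f by (auto simp: lnd_def)
  have "(D ^^ j) f p / fact j = 0" if "j > N" for j
    using derivation_iter_zero_mono[OF lnd_derivation[OF D] N, of j] that p by simp
  then have "\<forall>\<^sub>\<infinity>j. (D ^^ j) f p / fact j = 0" by (auto simp: MOST_nat)
  then show ?thesis unfolding flow_def by (simp add: Abs_poly_inverse)
qed

lemma pderiv_flow:
  assumes D: "lnd B D" and f: "f \<in> carrier B" and p: "p \<in> \<V>"
  shows "pderiv (flow D f p) = flow D (D f) p"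
proof (rule poly_eqI)
  fix j
  have "(of_nat (Suc j) :: 'k) \<noteq> 0" by (simp del: of_nat_Suc)
  then show "coeff (pderiv (flow D f p)) j = coeff (flow D (D f) p) j"
    using lnd_derivation[OF D] f p
    by (simp add: coeff_pderiv coeff_flow[OF D] funpow_swap1 del: of_nat_Suc)
qed

lemma flow_add:
  assumes D: "lnd B D" and f: "f \<in> carrier B" and g: "g \<in> carrier B" and p: "p \<in> \<V>"
  shows "flow D (f \<oplus> g) p = flow D f p + flow D g p"
  using lnd_derivation[OF D] f g p
  by (intro poly_eqI) (simp add: coeff_flow[OF D] derivation_iter_add add_divide_distrib)

lemma flow_smult:
  assumes D: "lnd B D" and f: "f \<in> carrier B" and p: "p \<in> \<V>"
  shows "flow D (c \<odot> f) p = smult c (flow D f p)"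
  using lnd_derivation[OF D] f p
  by (intro poly_eqI) (simp add: coeff_flow[OF D] derivation_iter_smult)

lemma flow_const:
  assumes D: "lnd B D" and f: "f \<in> carrier B" and Df: "D f = \<zero>" and p: "p \<in> \<V>"
  shows "flow D f p = [:f p:]"
proof (rule poly_eqI)
  fix j
  have "(D ^^ Suc j) f = \<zero>" for j
    using derivation_iter_zero_mono[OF lnd_derivation[OF D], of 1 f "Suc j"] Df by simp
  then show "coeff (flow D f p) j = coeff [:f p:] j"
    by (cases j) (use f p in \<open>auto simp: coeff_flow[OF D]\<close>)
qed

text \<open>
  By induction on the index of the coefficient, for all \<open>f\<close> and \<open>g\<close> at once: both sides have the
  same constant term, and their derivatives agree up to the index by the Leibniz rule for \<open>D\<close>.
\<close>

lemma flow_mult: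
  assumes D: "lnd B D" and f: "f \<in> carrier B" and g: "g \<in> carrier B" and p: "p \<in> \<V>"
  shows "flow D (f \<otimes> g) p = flow D f p * flow D g p"
proof (rule poly_eqI)
  note der = lnd_derivation[OF D]
  fix N
  show "coeff (flow D (f \<otimes> g) p) N = coeff (flow D f p * flow D g p) N"
    using f g
  proof (induction N arbitrary: f g)
    case 0
    then show ?case using p by (simp add: coeff_flow[OF D] coeff_mult)
  next
    case (Suc N)
    have "of_nat (Suc N) * coeff (flow D (f \<otimes> g) p) (Suc N)
        = coeff (flow D (D f \<otimes> g \<oplus> f \<otimes> D g) p) N"
      using coeff_pderiv[of "flow D (f \<otimes> g) p" N] pderiv_flow[OF D _ p, of "f \<otimes> g"] Suc.prems
        derivation_mult[OF der] by simp
    also have "\<dots> = coeff (flow D (D f) p * flow D g p + flow D f p * flow D (D g) p) N"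
      using Suc der p by (simp add: flow_add[OF D])
    also have "\<dots> = coeff (pderiv (flow D f p * flow D g p)) N"
      using Suc.prems pderiv_flow[OF D _ p] by (simp add: pderiv_mult add.commute mult.commute)
    also have "\<dots> = of_nat (Suc N) * coeff (flow D f p * flow D g p) (Suc N)"
      by (simp add: coeff_pderiv)
    finally show ?case by (simp del: of_nat_Suc)
  qed
qed

lemma eval_lnd_exp:
  assumes D: "lnd B D" and f: "f \<in> carrier B" and p: "p \<in> \<V>"
  shows "lnd_exp B D f p = poly (flow D f p) 1"
proof -
  let ?J = "{j. (D ^^ j) f \<noteq> \<zero>}"
  obtain N where N: "(D ^^ N) f = \<zero>" using D f by (auto simp: lnd_def)
  have JN: "?J \<subseteq> {..N}"
  proof
    fix j assume "j \<in> ?J"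
    then show "j \<in> {..N}" using derivation_iter_zero_mono[OF lnd_derivation[OF D] N, of j]
      by (cases "j \<le> N") auto
  qed
  then have fin: "finite ?J" using finite_subset by blast
  have "lnd_exp B D f p = (\<Sum>j\<in>?J. (D ^^ j) f p / fact j)"
    unfolding lnd_exp_def using f p lnd_derivation[OF D] fin
    by (simp add: eval_finsum field_simps)
  also have "\<dots> = (\<Sum>j\<in>?J. coeff (flow D f p) j)" using f p by (simp add: coeff_flow[OF D])
  also have "\<dots> = (\<Sum>j\<le>N. coeff (flow D f p) j)"
    by (rule sum.mono_neutral_left) (use JN f p in \<open>auto simp: coeff_flow[OF D]\<close>)
  also have "\<dots> = (\<Sum>j\<le>degree (flow D f p). coeff (flow D f p) j)"
  proof (rule sum.mono_neutral_right)
    show "{..degree (flow D f p)} \<subseteq> {..N}"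
    proof -
      have "degree (flow D f p) \<le> N"
        by (rule degree_le) (use derivation_iter_zero_mono[OF lnd_derivation[OF D] N] f p in
            \<open>auto simp: coeff_flow[OF D]\<close>)
      then show ?thesis by auto
    qed
  qed (auto simp: coeff_eq_0)
  also have "\<dots> = poly (flow D f p) 1" by (simp add: poly_altdef)
  finally show ?thesis .
qed

end

text \<open>
  Kept apart from \<^const>\<open>alg_aut\<close>, because exponentials are seen to be multiplicative before they
  are seen to be bijective.
\<close>

definition alg_end :: "('k::field_char_0, 'b) module \<Rightarrow> ('b \<Rightarrow> 'b) \<Rightarrow> bool" where
  "alg_end B \<phi> \<longleftrightarrow> \<phi> \<in> carrier B \<rightarrow>\<^sub>E carrier B \<and> \<phi> \<one>\<^bsub>B\<^esub> = \<one>\<^bsub>B\<^esub> \<and>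
     (\<forall>f\<in>carrier B. \<forall>g\<in>carrier B. \<phi> (f \<oplus>\<^bsub>B\<^esub> g) = \<phi> f \<oplus>\<^bsub>B\<^esub> \<phi> g) \<and>
     (\<forall>f\<in>carrier B. \<forall>g\<in>carrier B. \<phi> (f \<otimes>\<^bsub>B\<^esub> g) = \<phi> f \<otimes>\<^bsub>B\<^esub> \<phi> g) \<and>
     (\<forall>c. \<forall>f\<in>carrier B. \<phi> (c \<odot>\<^bsub>B\<^esub> f) = c \<odot>\<^bsub>B\<^esub> \<phi> f)"

lemma alg_aut_iff:
  "\<phi> \<in> alg_aut B \<longleftrightarrow> alg_end B \<phi> \<and> bij_betw \<phi> (carrier B) (carrier B)"
  unfolding alg_aut_def alg_end_def ring_iso_def ring_hom_def
  by (auto simp: PiE_iff extensional_funcset_def)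

lemma alg_end_closed [simp]: "alg_end B \<phi> \<Longrightarrow> f \<in> carrier B \<Longrightarrow> \<phi> f \<in> carrier B"
  by (auto simp: alg_end_def)

lemma alg_end_compose:
  assumes "alg_end B \<phi>" "alg_end B \<psi>" "\<one>\<^bsub>B\<^esub> \<in> carrier B"
    "\<And>f g. f \<in> carrier B \<Longrightarrow> g \<in> carrier B \<Longrightarrow> f \<oplus>\<^bsub>B\<^esub> g \<in> carrier B"
    "\<And>f g. f \<in> carrier B \<Longrightarrow> g \<in> carrier B \<Longrightarrow> f \<otimes>\<^bsub>B\<^esub> g \<in> carrier B"
    "\<And>c f. f \<in> carrier B \<Longrightarrow> c \<odot>\<^bsub>B\<^esub> f \<in> carrier B"
  shows "alg_end B (compose (carrier B) \<phi> \<psi>)"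
  using assms unfolding alg_end_def compose_def by (auto simp: PiE_iff)

context function_algebra
begin

lemma alg_end_lnd_exp:
  assumes D: "lnd B D"
    and mem: "\<And>f. f \<in> carrier B \<Longrightarrow> lnd_exp B D f \<in> carrier B"
  shows "alg_end B (lnd_exp B D)"
  unfolding alg_end_def
proof (intro conjI ballI allI)
  note der = lnd_derivation[OF D]
  show "lnd_exp B D \<in> carrier B \<rightarrow>\<^sub>E carrier B" using mem by (auto simp: lnd_exp_def)
  show "lnd_exp B D \<one> = \<one>"
    by (rule elem_eqI) (use der in \<open>auto simp: mem eval_lnd_exp[OF D] flow_const[OF D]\<close>)
  fix f assume f: "f \<in> carrier B"
  show "lnd_exp B D (c \<odot> f) = c \<odot> lnd_exp B D f" for c
    by (rule elem_eqI) (use f in \<open>auto simp: mem eval_lnd_exp[OF D] flow_smult[OF D]\<close>)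
  fix g assume g: "g \<in> carrier B"
  show "lnd_exp B D (f \<oplus> g) = lnd_exp B D f \<oplus> lnd_exp B D g"
    by (rule elem_eqI) (use f g in \<open>auto simp: mem eval_lnd_exp[OF D] flow_add[OF D]\<close>)
  show "lnd_exp B D (f \<otimes> g) = lnd_exp B D f \<otimes> lnd_exp B D g"
    by (rule elem_eqI) (use f g in \<open>auto simp: mem eval_lnd_exp[OF D] flow_mult[OF D]\<close>)
qed

lemma lnd_exp_mem:
  assumes D: "lnd B D" and f: "f \<in> carrier B"
  shows "lnd_exp B D f \<in> carrier B"
  using f derivation_funpow_mem[OF lnd_derivation[OF D] f] by (simp add: lnd_exp_def finsum_mem)

text \<open>
  The degree function of a locally nilpotent derivation, as a relation, so that the zero element
  simply has no degree.
\<close>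

definition lnd_degree :: "(('p \<Rightarrow> 'k) \<Rightarrow> 'p \<Rightarrow> 'k) \<Rightarrow> ('p \<Rightarrow> 'k) \<Rightarrow> nat \<Rightarrow> bool" where
  "lnd_degree D f d \<longleftrightarrow> (D ^^ d) f \<noteq> \<zero> \<and> (D ^^ Suc d) f = \<zero>"

lemma lnd_degree_exists:
  assumes D: "lnd B D" and f: "f \<in> carrier B" "f \<noteq> \<zero>"
  shows "\<exists>d. lnd_degree D f d"
proof -
  define N where "N = (LEAST N. (D ^^ N) f = \<zero>)"
  have ex: "\<exists>N. (D ^^ N) f = \<zero>" using D f by (auto simp: lnd_def)
  then have N: "(D ^^ N) f = \<zero>" unfolding N_def by (rule LeastI_ex)
  with f have "N \<noteq> 0" by (metis funpow_0)
  then obtain d where d: "N = Suc d" using not0_implies_Suc by blast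
  then have "(D ^^ d) f \<noteq> \<zero>" using not_less_Least[of d "\<lambda>N. (D ^^ N) f = \<zero>"] N_def by auto
  then show ?thesis using N d by (auto simp: lnd_degree_def)
qed

lemma lnd_degree_unique:
  assumes D: "lnd B D" and "lnd_degree D f d" "lnd_degree D f e"
  shows "d = e"
  using assms derivation_iter_zero_mono[OF lnd_derivation[OF D], of "Suc d" f e]
    derivation_iter_zero_mono[OF lnd_derivation[OF D], of "Suc e" f d]
  unfolding lnd_degree_def by (metis linorder_neqE_nat Suc_leI)

lemma lnd_degree_nonzero: "lnd B D \<Longrightarrow> lnd_degree D f d \<Longrightarrow> f \<noteq> \<zero>"
  using derivation_iter_zero[OF lnd_derivation] by (auto simp: lnd_degree_def)

lemma lnd_degree_derivation:
  assumes "lnd_degree D f (Suc d)" shows "lnd_degree D (D f) d"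
  using assms by (simp add: lnd_degree_def funpow_swap1)

lemma lnd_degree_0_iff: "lnd_degree D f 0 \<longleftrightarrow> f \<noteq> \<zero> \<and> D f = \<zero>"
  by (simp add: lnd_degree_def)

lemma lnd_degree_add_lower:
  assumes D: "lnd B D" and "f \<in> carrier B" "g \<in> carrier B"
    and "lnd_degree D f d" "(D ^^ d) g = \<zero>"
  shows "lnd_degree D (f \<oplus> g) d"
proof -
  note der = lnd_derivation[OF D]
  have "(D ^^ Suc d) g = \<zero>" by (rule derivation_iter_zero_mono[OF der assms(5)]) simp
  then show ?thesis using assms derivation_iter_add[OF der, of f g] derivation_funpow_mem[OF der, of f d]
    by (simp add: lnd_degree_def del: funpow.simps)
qed

end

locale function_domain = function_algebra +
  assumes no_zero_divisors:
    "f \<in> carrier B \<Longrightarrow> g \<in> carrier B \<Longrightarrow> f \<otimes> g = \<zero> \<Longrightarrow> f = \<zero> \<or> g = \<zero>"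
begin

lemma mult_cancel:
  assumes "f \<in> carrier B" "g \<in> carrier B" "h \<in> carrier B" "h \<noteq> \<zero>"
    and "\<And>p. p \<in> \<V> \<Longrightarrow> h p * f p = h p * g p"
  shows "f = g"
proof -
  have "h \<otimes> (f \<oplus> (- 1) \<odot> g) = \<zero>"
    by (rule elem_eqI) (use assms in \<open>auto simp: algebra_simps\<close>)
  then have "f \<oplus> (- 1) \<odot> g = \<zero>"
    using no_zero_divisors[of h "f \<oplus> (- 1) \<odot> g"] assms(1-4) by auto
  then have "f p = g p" if "p \<in> \<V>" for p
    using that eval_add[OF that, of f "(- 1) \<odot> g"] by simp
  then show ?thesis using assms by (auto intro: elem_eqI)
qed

lemma common_nonzero:
  assumes "f \<in> carrier B" "g \<in> carrier B" "f \<noteq> \<zero>" "g \<noteq> \<zero>"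
  obtains p where "p \<in> \<V>" "f p \<noteq> 0" "g p \<noteq> 0"
proof -
  have "f \<otimes> g \<noteq> \<zero>" using no_zero_divisors assms by blast
  with assms(1,2) obtain p where "p \<in> \<V>" "(f \<otimes> g) p \<noteq> 0" using nonzeroE[OF mult_mem'] by blast
  then show thesis using that by simp
qed

text \<open>Leading coefficients of the flows multiply, and do not vanish in a domain.\<close>

lemma lnd_degree_mult:
  assumes D: "lnd B D" and f: "f \<in> carrier B" and g: "g \<in> carrier B"
    and d: "lnd_degree D f d" and e: "lnd_degree D g e"
  shows "lnd_degree D (f \<otimes> g) (d + e)"
proof -
  note der = lnd_derivation[OF D]
  have vanish: "coeff (flow D h p) j = 0" if "lnd_degree D h k" "h \<in> carrier B" "j > k" "p \<in> \<V>" for h k j p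
    using that derivation_iter_zero_mono[OF der, of "Suc k" h j] by (simp add: coeff_flow[OF D] lnd_degree_def del: funpow.simps)
  have prod: "coeff (flow D (f \<otimes> g) p) (d + e) = coeff (flow D f p) d * coeff (flow D g p) e"
    if p: "p \<in> \<V>" for p
  proof -
    have "coeff (flow D (f \<otimes> g) p) (d + e)
        = (\<Sum>i\<le>d + e. coeff (flow D f p) i * coeff (flow D g p) (d + e - i))"
      by (simp add: flow_mult[OF D f g p] coeff_mult)
    also have "\<dots> = (\<Sum>i\<in>{d}. coeff (flow D f p) i * coeff (flow D g p) (d + e - i))"
    proof (rule sum.mono_neutral_right)
      show "\<forall>i\<in>{..d + e} - {d}. coeff (flow D f p) i * coeff (flow D g p) (d + e - i) = 0"
      proof
        fix i assume "i \<in> {..d + e} - {d}"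
        then consider "i > d" | "d + e - i > e" by force
        then show "coeff (flow D f p) i * coeff (flow D g p) (d + e - i) = 0"
          by cases (use vanish d e f g p in auto)
      qed
    qed auto
    finally show ?thesis by simp
  qed
  have zero: "coeff (flow D (f \<otimes> g) p) (Suc (d + e)) = 0" if p: "p \<in> \<V>" for p
  proof -
    have "degree (flow D f p) \<le> d" "degree (flow D g p) \<le> e"
      using vanish d e f g p by (auto intro: degree_le)
    then have "degree (flow D f p * flow D g p) < Suc (d + e)"
      using degree_mult_le[of "flow D f p" "flow D g p"] by simp
    then show ?thesis by (simp add: flow_mult[OF D f g p] coeff_eq_0)
  qed
  obtain p where p: "p \<in> \<V>" "(D ^^ d) f p \<noteq> 0" "(D ^^ e) g p \<noteq> 0"
    using common_nonzero[of "(D ^^ d) f" "(D ^^ e) g"] d e f g der by (auto simp: lnd_degree_def)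
  have "coeff (flow D (f \<otimes> g) p) (d + e) \<noteq> 0"
    unfolding prod[OF p(1)] coeff_flow[OF D f p(1)] coeff_flow[OF D g p(1)] using p by simp
  then have "(D ^^ (d + e)) (f \<otimes> g) p \<noteq> 0"
    using coeff_flow[OF D mult_mem'[OF f g] p(1), of "d + e"] by auto
  then have 1: "(D ^^ (d + e)) (f \<otimes> g) \<noteq> \<zero>" using p by auto
  have "(D ^^ Suc (d + e)) (f \<otimes> g) = \<zero>"
  proof (rule elem_eqI)
    show "(D ^^ Suc (d + e)) (f \<otimes> g) \<in> carrier B"
      by (intro derivation_funpow_mem[OF der] mult_mem' f g)
    fix p assume "p \<in> \<V>"
    then show "(D ^^ Suc (d + e)) (f \<otimes> g) p = \<zero> p"
      using zero coeff_flow[OF D mult_mem'[OF f g], of p "Suc (d + e)"] fact_nonzero[of "Suc (d + e)"]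
      by (simp del: funpow.simps fact_Suc)
  qed simp
  with 1 show ?thesis by (simp add: lnd_degree_def del: funpow.simps)
qed

lemma lnd_degree_pow:
  assumes D: "lnd B D" and f: "f \<in> carrier B" and d: "lnd_degree D f d"
  shows "lnd_degree D (f [^] (j::nat)) (j * d)"
proof (induction j)
  case 0
  obtain p where "p \<in> \<V>" using nonzeroE[OF f lnd_degree_nonzero[OF D d]] by blast
  then have "\<one> \<noteq> \<zero>" by (metis eval_one eval_zero zero_neq_one)
  then show ?case using lnd_derivation[OF D]
    by (simp add: lnd_degree_0_iff pow_0')
next
  case (Suc j)
  then show ?case using lnd_degree_mult[OF D _ f Suc.IH d] f by (simp add: add.commute pow_Suc')
qed

text \<open>
  Degrees add up under multiplication, and the nonzero kernel elements are those of degree \<open>0\<close>.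
\<close>

lemma kernel_factor:
  assumes D: "lnd B D" and f: "f \<in> carrier B" and g: "g \<in> carrier B"
    and "D (f \<otimes> g) = \<zero>" "f \<otimes> g \<noteq> \<zero>"
  shows "D f = \<zero>"
proof -
  have nz: "f \<noteq> \<zero>" "g \<noteq> \<zero>" using assms by auto
  obtain d where d: "lnd_degree D f d" using lnd_degree_exists[OF D f] nz by blast
  obtain e where e: "lnd_degree D g e" using lnd_degree_exists[OF D g] nz by blast
  have "lnd_degree D (f \<otimes> g) 0" using assms by (simp add: lnd_degree_0_iff)
  then have "d + e = 0" using lnd_degree_unique[OF D lnd_degree_mult[OF D f g d e]] by blast
  then show ?thesis using d by (simp add: lnd_degree_0_iff)
qed

end


section \<open>Polynomial functions\<close>

text \<open>
  The functions \<^const>\<open>poly_value\<close> in a form suited to induction.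
\<close>

inductive_set polyfun :: "'v set \<Rightarrow> (('v \<Rightarrow> 'k::field) \<Rightarrow> 'k) set" for V :: "'v set" where
  polyfun_const: "(\<lambda>p. c) \<in> polyfun V"
| polyfun_var: "v \<in> V \<Longrightarrow> (\<lambda>p. p v) \<in> polyfun V"
| polyfun_add: "F \<in> polyfun V \<Longrightarrow> G \<in> polyfun V \<Longrightarrow> (\<lambda>p. F p + G p) \<in> polyfun V"
| polyfun_mult: "F \<in> polyfun V \<Longrightarrow> G \<in> polyfun V \<Longrightarrow> (\<lambda>p. F p * G p) \<in> polyfun V"

lemma polyfun_pow: "F \<in> polyfun V \<Longrightarrow> (\<lambda>p. F p ^ j) \<in> polyfun V"
  by (induction j) (auto intro: polyfun_const[of 1] polyfun_mult)

lemma polyfun_prod: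
  "(\<And>j. j \<in> J \<Longrightarrow> F j \<in> polyfun V) \<Longrightarrow> (\<lambda>p. \<Prod>j\<in>J. F j p) \<in> polyfun V"
proof (induction J rule: infinite_finite_induct)
  case (insert x J)
  then show ?case using polyfun_mult[of "F x" V "\<lambda>p. \<Prod>j\<in>J. F j p"] by simp
qed (simp_all add: polyfun_const)

lemma polyfun_sum:
  "(\<And>j. j \<in> J \<Longrightarrow> F j \<in> polyfun V) \<Longrightarrow> (\<lambda>p. \<Sum>j\<in>J. F j p) \<in> polyfun V"
proof (induction J rule: infinite_finite_induct)
  case (insert x J)
  then show ?case using polyfun_add[of "F x" V "\<lambda>p. \<Sum>j\<in>J. F j p"] by simp
qed (simp_all add: polyfun_const)

lemma polyfun_scale: "F \<in> polyfun V \<Longrightarrow> (\<lambda>p. c * F p) \<in> polyfun V"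
  by (rule polyfun_mult[OF polyfun_const])

lemma polyfun_diff:
  assumes "F \<in> polyfun V" "G \<in> polyfun V" shows "(\<lambda>p. F p - G p) \<in> polyfun V"
  using polyfun_add[OF assms(1) polyfun_scale[OF assms(2), of "- 1"]] by simp

lemma polyfun_mono: "F \<in> polyfun V \<Longrightarrow> V \<subseteq> V' \<Longrightarrow> F \<in> polyfun V'"
  by (induction rule: polyfun.induct) (auto intro: polyfun.intros)

lemma polyfun_cong:
  "F \<in> polyfun V \<Longrightarrow> (\<And>v. v \<in> V \<Longrightarrow> p v = q v) \<Longrightarrow> F p = F q"
  by (induction rule: polyfun.induct) auto

lemma polyfun_subst:
  "F \<in> polyfun V \<Longrightarrow> (\<And>v. v \<in> V \<Longrightarrow> (\<lambda>p. s p v) \<in> polyfun V') \<Longrightarrow> (\<lambda>p. F (s p)) \<in> polyfun V'"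
  by (induction rule: polyfun.induct) (auto intro: polyfun.intros)

text \<open>
  Along a line a polynomial function is a univariate polynomial; this reduces questions about
  zeros and units of polynomial functions to one variable.
\<close>

lemma polyfun_line:
  assumes "F \<in> polyfun V"
  shows "\<exists>P. \<forall>t. F (\<lambda>v. p v + t * (q v - p v)) = poly P t"
  using assms
proof (induction rule: polyfun.induct)
  case (polyfun_const c)
  show ?case by (rule exI[of _ "[:c:]"]) simp
next
  case (polyfun_var v)
  show ?case by (rule exI[of _ "[:p v, q v - p v:]"]) simp
next
  case (polyfun_add F G)
  then show ?case by (metis poly_add)
next
  case (polyfun_mult F G)
  then show ?case by (metis poly_mult)
qed

lemma poly_nonzero_point:
  fixes P :: "'k::field_char_0 poly"
  assumes "P \<noteq> 0" shows "\<exists>t. poly P t \<noteq> 0"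
  using poly_roots_finite[OF assms] infinite_UNIV_char_0[where 'a='k]
  by (metis (mono_tags, lifting) UNIV_eq_I mem_Collect_eq)

lemma polyfun_common_nonzero:
  fixes F G :: "('v \<Rightarrow> 'k::field_char_0) \<Rightarrow> 'k"
  assumes F: "F \<in> polyfun V" and G: "G \<in> polyfun V'" and "F p \<noteq> 0" "G q \<noteq> 0"
  obtains r where "F r \<noteq> 0" "G r \<noteq> 0"
proof -
  let ?l = "\<lambda>t v. p v + t * (q v - p v)"
  obtain P where P: "\<And>t. F (?l t) = poly P t" using polyfun_line[OF F] by blast
  obtain Q where Q: "\<And>t. G (?l t) = poly Q t" using polyfun_line[OF G] by blast
  have "poly P 0 \<noteq> 0" using assms(3) P[of 0] by simp
  moreover have "poly Q 1 \<noteq> 0" using assms(4) Q[of 1] by simp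
  ultimately have "P * Q \<noteq> 0" by auto
  then obtain t where "poly (P * Q) t \<noteq> 0" using poly_nonzero_point by blast
  then show thesis using that[of "?l t"] P Q by simp
qed

lemma polyfun_mult_eq_0:
  fixes F G :: "('v \<Rightarrow> 'k::field_char_0) \<Rightarrow> 'k"
  assumes "F \<in> polyfun V" "G \<in> polyfun V'" "\<And>p. F p * G p = 0"
  shows "(\<forall>p. F p = 0) \<or> (\<forall>p. G p = 0)"
  using assms by (metis mult_eq_0_iff polyfun_common_nonzero)

lemma polyfun_unit_const:
  fixes F G :: "('v \<Rightarrow> 'k::field_char_0) \<Rightarrow> 'k"
  assumes F: "F \<in> polyfun V" and G: "G \<in> polyfun V'" and FG: "\<And>p. F p * G p = c" and c: "c \<noteq> 0"
  obtains b where "b \<noteq> 0" "\<And>p. F p = b"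
proof
  fix p :: "'v \<Rightarrow> 'k"
  let ?l = "\<lambda>t v. (0::'k) + t * (p v - 0)"
  obtain P where P: "\<And>t. F (?l t) = poly P t" using polyfun_line[OF F, of "\<lambda>_. 0"] by blast
  obtain Q where Q: "\<And>t. G (?l t) = poly Q t" using polyfun_line[OF G, of "\<lambda>_. 0"] by blast
  have "poly (P * Q) t = poly [:c:] t" for t
    using FG[of "?l t"] P[of t] Q[of t] by simp
  then have PQ: "P * Q = [:c:]" using poly_eq_poly_eq_iff by blast
  then have "degree (P * Q) = 0" "P \<noteq> 0" "Q \<noteq> 0" using c by auto
  then have "degree P = 0" by (simp add: degree_mult_eq)
  then obtain b where "P = [:b:]" using degree_eq_zeroE by blast
  then show "F p = F (\<lambda>_. 0)" using P[of 0] P[of 1] by simp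
next
  show "F (\<lambda>_. 0) \<noteq> 0" using FG[of "\<lambda>_. 0"] c by auto
qed

lemma polyfun_var_zero:
  assumes "F \<in> polyfun V" shows "(\<lambda>p. F (p(w := 0))) \<in> polyfun V"
proof (rule polyfun_subst[OF assms])
  fix v assume "v \<in> V"
  then show "(\<lambda>p. (p(w := 0)) v) \<in> polyfun V"
    by (cases "v = w") (auto intro: polyfun.intros)
qed

text \<open>
  The remainder of \<open>F\<close> on division by \<open>w\<close> is its value at \<open>w = 0\<close>, so that divisibility by \<open>w\<close> can be
  tested there.
\<close>

lemma polyfun_split_var:
  assumes "F \<in> polyfun V"
  shows "\<exists>G\<in>polyfun V. \<forall>p. F p = F (p(w := 0)) + p w * G p"
  using assms
proof (induction rule: polyfun.induct)
  case (polyfun_const c)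
  show ?case by (rule bexI[of _ "\<lambda>_. 0"]) (auto intro: polyfun.intros)
next
  case (polyfun_var v)
  show ?case by (rule bexI[of _ "\<lambda>_. if v = w then 1 else 0"]) (auto intro: polyfun.intros)
next
  case (polyfun_add F1 F2)
  then obtain G1 G2 where G: "G1 \<in> polyfun V" "G2 \<in> polyfun V"
    "\<And>p. F1 p = F1 (p(w := 0)) + p w * G1 p" "\<And>p. F2 p = F2 (p(w := 0)) + p w * G2 p" by blast
  show ?case
  proof (rule bexI[of _ "\<lambda>p. G1 p + G2 p"], intro allI)
    fix p
    show "F1 p + F2 p = F1 (p(w := 0)) + F2 (p(w := 0)) + p w * (G1 p + G2 p)"
      using G(3)[of p] G(4)[of p] by (simp add: algebra_simps)
  qed (intro polyfun.intros G)
next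
  case (polyfun_mult F1 F2)
  then obtain G1 G2 where G: "G1 \<in> polyfun V" "G2 \<in> polyfun V"
    "\<And>p. F1 p = F1 (p(w := 0)) + p w * G1 p" "\<And>p. F2 p = F2 (p(w := 0)) + p w * G2 p" by blast
  note sub = polyfun_var_zero[OF polyfun_mult(1), of w]
  show ?case
  proof (rule bexI[of _ "\<lambda>p. F1 (p(w := 0)) * G2 p + G1 p * F2 p"], intro allI)
    fix p
    have "F1 p * F2 p = F1 (p(w := 0)) * F2 p + p w * (G1 p * F2 p)"
      using G(3)[of p] by (simp add: algebra_simps)
    also have "F1 (p(w := 0)) * F2 p = F1 (p(w := 0)) * F2 (p(w := 0)) + p w * (F1 (p(w := 0)) * G2 p)"
      using G(4)[of p] by (simp add: algebra_simps)
    finally show "F1 p * F2 p = F1 (p(w := 0)) * F2 (p(w := 0))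
        + p w * (F1 (p(w := 0)) * G2 p + G1 p * F2 p)" by (simp add: algebra_simps)
  qed (intro polyfun.intros G sub polyfun_mult)
qed

lemma polyfun_dvd_var:
  assumes F: "F \<in> polyfun V" and "\<And>p. F (p(w := 0)) = 0"
  obtains G where "G \<in> polyfun V" "\<And>p. F p = p w * G p"
  using polyfun_split_var[OF F, of w] assms(2) by auto

definition monomial :: "'v set \<Rightarrow> ('v \<Rightarrow> nat) \<Rightarrow> ('v \<Rightarrow> 'k::field) \<Rightarrow> 'k" where
  "monomial V e p = (\<Prod>v\<in>V. p v ^ e v)"

lemma polyfun_monomial: "V \<subseteq> V' \<Longrightarrow> monomial V e \<in> polyfun V'"
  unfolding monomial_def[abs_def] by (intro polyfun_prod polyfun_pow polyfun_var) auto

lemma monomial_Suc: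
  assumes "finite V" "w \<in> V"
  shows "monomial V (e(w := Suc (e w))) p = p w * monomial V e p"
proof -
  have "(\<Prod>v\<in>V. p v ^ (e(w := Suc (e w))) v)
      = p w ^ Suc (e w) * (\<Prod>v\<in>V - {w}. p v ^ (e(w := Suc (e w))) v)"
    using prod.remove[OF assms, of "\<lambda>v. p v ^ (e(w := Suc (e w))) v"] by simp
  also have "(\<Prod>v\<in>V - {w}. p v ^ (e(w := Suc (e w))) v) = (\<Prod>v\<in>V - {w}. p v ^ e v)"
    by (rule prod.cong) auto
  finally show ?thesis unfolding monomial_def using prod.remove[OF assms, of "\<lambda>v. p v ^ e v"] by simp
qed

lemma monomial_diagonal:
  "finite V \<Longrightarrow> monomial V e (\<lambda>_. t) = t ^ (\<Sum>v\<in>V. e v)"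
  by (simp add: monomial_def power_sum)

text \<open>
  Divisors of monomials are monomials, by induction on the degree: if \<open>w\<close> divides \<open>FG\<close> then one
  of the factors vanishes at \<open>w = 0\<close>, and \<open>w\<close> can be split off it.
\<close>

lemma polyfun_dvd_monomial:
  fixes F G :: "('v \<Rightarrow> 'k::field_char_0) \<Rightarrow> 'k"
  assumes fin: "finite V" and "F \<in> polyfun V" "G \<in> polyfun V"
    and "b \<noteq> 0" "\<And>p. F p * G p = b * monomial V e p"
  shows "\<exists>c e'. c \<noteq> 0 \<and> (\<forall>p. F p = c * monomial V e' p)"
  using assms(2-5)
proof (induction "\<Sum>v\<in>V. e v" arbitrary: e F G)
  case 0
  then have e: "e v = 0" if "v \<in> V" for v using fin that by simp
  then have "monomial V e p = 1" for p :: "'v \<Rightarrow> 'k" by (simp add: monomial_def)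
  then obtain c where "c \<noteq> 0" "\<And>p. F p = c"
    using polyfun_unit_const[OF 0(2,3), of b] 0(4,5) by auto
  then show ?case by (intro exI[of _ c] exI[of _ "\<lambda>_. 0"]) (simp add: monomial_def)
next
  case (Suc s)
  have "(\<Sum>v\<in>V. e v) \<noteq> 0" using Suc(2) by simp
  then obtain w where w: "w \<in> V" "e w \<noteq> 0" using fin by auto
  define e1 where "e1 = e(w := e w - 1)"
  have e: "e = e1(w := Suc (e1 w))" using w by (auto simp: e1_def)
  have "(\<Sum>v\<in>V. e v) = Suc (\<Sum>v\<in>V. e1 v)"
  proof -
    have "(\<Sum>v\<in>V - {w}. e1 v) = (\<Sum>v\<in>V - {w}. e v)" by (rule sum.cong) (auto simp: e1_def)
    then show ?thesis using sum.remove[OF fin w(1), of e] sum.remove[OF fin w(1), of e1] w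
      by (simp add: e1_def)
  qed
  then have s: "s = (\<Sum>v\<in>V. e1 v)" using Suc(2) by simp
  have mono: "monomial V e p = p w * monomial V e1 p" for p :: "'v \<Rightarrow> 'k"
    using monomial_Suc[OF fin w(1), of e1 p] unfolding e[symmetric] .
  note sub = polyfun_var_zero[of _ V w]
  have cancel: "\<forall>p. H p * H' p = b * monomial V e1 p"
    if "H \<in> polyfun V" "H' \<in> polyfun V" "\<And>p. p w * (H p * H' p) = p w * (b * monomial V e1 p)"
    for H H' :: "('v \<Rightarrow> 'k) \<Rightarrow> 'k"
  proof -
    have "(\<lambda>p. H p * H' p - b * monomial V e1 p) \<in> polyfun V"
      by (intro polyfun_diff polyfun_mult polyfun_scale that polyfun_monomial subset_refl)
    from polyfun_mult_eq_0[OF polyfun_var[OF w(1)] this]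
    have "(\<forall>p::'v \<Rightarrow> 'k. p w = 0) \<or> (\<forall>p. H p * H' p - b * monomial V e1 p = 0)"
      using that(3) by (simp add: right_diff_distrib)
    then show ?thesis
    proof
      assume "\<forall>p::'v \<Rightarrow> 'k. p w = 0"
      from spec[OF this, of "\<lambda>_. 1"] show ?thesis by simp
    qed simp
  qed
  have "F (p(w := 0)) * G (p(w := 0)) = 0" for p
    using Suc(6)[of "p(w := 0)"] mono[of "p(w := 0)"] by auto
  then consider "\<forall>p. F (p(w := 0)) = 0" | "\<forall>p. G (p(w := 0)) = 0"
    using polyfun_mult_eq_0[OF sub[OF Suc(3)] sub[OF Suc(4)]] by blast
  then show ?case
  proof cases
    case 1
    then obtain F1 where F1: "F1 \<in> polyfun V" "\<And>p. F p = p w * F1 p"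
      using polyfun_dvd_var[OF Suc(3)] by blast
    have "p w * (F1 p * G p) = p w * (b * monomial V e1 p)" for p
      using Suc(6)[of p] unfolding F1(2)[of p] mono[of p] by (simp only: ac_simps)
    from cancel[OF F1(1) Suc(4) this]
    have "\<And>p. F1 p * G p = b * monomial V e1 p" by blast
    then obtain c e' where c: "c \<noteq> 0" "\<And>p. F1 p = c * monomial V e' p"
      using Suc(1)[OF s F1(1) Suc(4,5)] by blast
    then have "F p = c * monomial V (e'(w := Suc (e' w))) p" for p
      unfolding F1(2) monomial_Suc[OF fin w(1)] c(2) by (simp only: ac_simps)
    then show ?thesis using c(1) by blast
  next
    case 2
    then obtain G1 where G1: "G1 \<in> polyfun V" "\<And>p. G p = p w * G1 p"
      using polyfun_dvd_var[OF Suc(4)] by blast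
    have "p w * (F p * G1 p) = p w * (b * monomial V e1 p)" for p
      using Suc(6)[of p] unfolding G1(2)[of p] mono[of p] by (simp only: ac_simps)
    from cancel[OF Suc(3) G1(1) this]
    have "\<And>p. F p * G1 p = b * monomial V e1 p" by blast
    then show ?thesis using Suc(1)[OF s Suc(3) G1(1) Suc(5)] by blast
  qed
qed

lemma poly_value_polyfun: "poly_value V E c \<in> polyfun V"
  unfolding poly_value_def[abs_def]
  by (intro polyfun_sum polyfun_mult polyfun_const polyfun_prod polyfun_pow polyfun_var)

lemma polyfun_poly_value:
  fixes F :: "(coord \<Rightarrow> 'k::field) \<Rightarrow> 'k"
  assumes V: "finite V" and "F \<in> polyfun V"
  shows "\<exists>E c. finite E \<and> F = poly_value V E c"
  using assms(2)
proof (induction rule: polyfun.induct)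
  case (polyfun_const c)
  show ?case
    by (rule exI[of _ "{\<lambda>_. 0}"], rule exI[of _ "\<lambda>_. c"]) (auto simp: poly_value_def)
next
  case (polyfun_var v)
  have "(\<Prod>u\<in>V. p u ^ (if u = v then 1 else 0)) = p v" for p :: "coord \<Rightarrow> 'k"
  proof -
    have "(\<Prod>u\<in>V. p u ^ (if u = v then 1 else 0)) = (\<Prod>u\<in>V. if u = v then p u else 1)"
      by (rule prod.cong) auto
    then show ?thesis using V polyfun_var by simp
  qed
  then show ?case
    by (intro exI[of _ "{\<lambda>u. if u = v then 1 else 0}"] exI[of _ "\<lambda>_. 1"]) (auto simp: poly_value_def)
next
  case (polyfun_add F G)
  then obtain E c E' c' where F: "finite E" "F = poly_value V E c"
    and G: "finite E'" "G = poly_value V E' c'" by blast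
  define c'' where "c'' e = (if e \<in> E then c e else 0) + (if e \<in> E' then c' e else 0)" for e
  have "F p + G p = poly_value V (E \<union> E') c'' p" for p
  proof -
    let ?m = "\<lambda>e. \<Prod>v\<in>V. p v ^ e v"
    have "F p = (\<Sum>e\<in>E \<union> E'. (if e \<in> E then c e else 0) * ?m e)"
      unfolding F(2) poly_value_def by (rule sum.mono_neutral_cong_left) (use F G in auto)
    moreover have "G p = (\<Sum>e\<in>E \<union> E'. (if e \<in> E' then c' e else 0) * ?m e)"
      unfolding G(2) poly_value_def by (rule sum.mono_neutral_cong_left) (use F G in auto)
    ultimately show ?thesis
      by (simp add: poly_value_def c''_def sum.distrib[symmetric] algebra_simps)
  qed
  then show ?case using F(1) G(1) by (intro exI[of _ "E \<union> E'"] exI[of _ c'']) auto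
next
  case (polyfun_mult F G)
  then obtain E c E' c' where F: "finite E" "F = poly_value V E c"
    and G: "finite E'" "G = poly_value V E' c'" by blast
  let ?s = "\<lambda>(e, e') v. e v + e' v :: nat"
  define c'' where "c'' e = (\<Sum>x | x \<in> E \<times> E' \<and> ?s x = e. c (fst x) * c' (snd x))" for e
  have "F p * G p = poly_value V (?s ` (E \<times> E')) c'' p" for p
  proof -
    let ?m = "\<lambda>e. \<Prod>v\<in>V. p v ^ e v"
    have m: "?m (?s x) = ?m (fst x) * ?m (snd x)" for x
      by (cases x) (simp add: power_add prod.distrib)
    have "F p * G p = (\<Sum>x\<in>E \<times> E'. c (fst x) * c' (snd x) * ?m (?s x))"
      unfolding F(2) G(2) poly_value_def m
      unfolding sum_product sum.cartesian_product by (rule sum.cong) (auto simp: ac_simps)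
    also have "\<dots> = (\<Sum>e\<in>?s ` (E \<times> E'). \<Sum>x | x \<in> E \<times> E' \<and> ?s x = e. c (fst x) * c' (snd x) * ?m (?s x))"
      using F(1) G(1) by (intro sum.image_gen) auto
    also have "\<dots> = poly_value V (?s ` (E \<times> E')) c'' p"
      unfolding poly_value_def c''_def by (intro sum.cong refl) (auto simp: sum_distrib_right)
    finally show ?thesis .
  qed
  then show ?case using F(1) G(1) by (intro exI[of _ "?s ` (E \<times> E')"] exI[of _ c'']) auto
qed


section \<open>The coordinate ring of the hypersurface\<close>

locale hypersurface_ring =
  fixes k m n :: nat and a :: "nat \<Rightarrow> nat"
    and B :: "('k::{alg_closed_field, field_char_0}, (coord \<Rightarrow> 'k) \<Rightarrow> 'k) module" (structure)
  assumes B_def: "B = coord_ring k m n a"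
    and k_ge: "k \<ge> 2" and n_ge: "n \<ge> 2" and a_ge: "s \<in> {1..m} \<Longrightarrow> a s > 1"
begin

abbreviation \<V> :: "(coord \<Rightarrow> 'k) set" where "\<V> \<equiv> hypersurface k m n a"
abbreviation C :: "coord set" where "C \<equiv> coords k m"
abbreviation \<alpha> :: "coord \<Rightarrow> nat" where "\<alpha> \<equiv> xy_exponent a"
abbreviation g :: "coord \<Rightarrow> (coord \<Rightarrow> 'k) \<Rightarrow> 'k" where "g \<equiv> gen k m n a"

lemma finite_coords [simp]: "finite C" and VZ_coords [simp]: "VZ \<in> C"
  by (auto simp: coords_def)

lemma exponent_pos: "v \<in> C - {VZ} \<Longrightarrow> \<alpha> v \<ge> 1"
  using a_ge by (force simp: coords_def)

lemma prod_coords: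
  fixes F :: "coord \<Rightarrow> 'c::comm_monoid_mult"
  assumes "J \<subseteq> {1..k}"
  shows "(\<Prod>v\<in>VX ` J \<union> VY ` {1..m}. F v) = (\<Prod>i\<in>J. F (VX i)) * (\<Prod>s=1..m. F (VY s))"
proof -
  have "finite J" using assms finite_subset by blast
  then have "(\<Prod>v\<in>VX ` J \<union> VY ` {1..m}. F v) = (\<Prod>v\<in>VX ` J. F v) * (\<Prod>v\<in>VY ` {1..m}. F v)"
    by (intro prod.union_disjoint) auto
  also have "\<dots> = (\<Prod>i\<in>J. F (VX i)) * (\<Prod>s=1..m. F (VY s))"
    by (subst (1 2) prod.reindex) (auto simp: inj_on_def)
  finally show ?thesis .
qed

lemma coords_minus_VZ: "C - {VZ} = VX ` {1..k} \<union> VY ` {1..m}"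
  by (auto simp: coords_def)

lemma hypersurface_iff:
  "p \<in> \<V> \<longleftrightarrow> p \<in> extensional C \<and> monomial (C - {VZ}) \<alpha> p = p VZ ^ n + 1"
  unfolding hypersurface_def monomial_def coords_minus_VZ prod_coords[OF subset_refl]
  by (simp add: PiE_def)

lemma carrier_eq: "carrier B = {restrict F \<V> | F. F \<in> polyfun C}"
proof -
  have "carrier B = {restrict (poly_value C E c) \<V> | E c. finite E}"
    by (auto simp: B_def coord_ring_def Let_def restrict_def)
  also have "\<dots> = {restrict F \<V> | F. F \<in> polyfun C}"
    using poly_value_polyfun polyfun_poly_value[OF finite_coords] by blast
  finally show ?thesis .
qed

lemma polyfun_mem: "F \<in> polyfun C \<Longrightarrow> (\<lambda>p\<in>\<V>. F p) \<in> carrier B"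
  by (auto simp: carrier_eq)

lemma carrierE:
  assumes "f \<in> carrier B" obtains F where "F \<in> polyfun C" "f = (\<lambda>p\<in>\<V>. F p)"
  using assms by (auto simp: carrier_eq)

sublocale function_algebra B \<V>
proof
  fix f h assume f: "f \<in> carrier B" and h: "h \<in> carrier B"
  then obtain F H where F: "F \<in> polyfun C" "f = (\<lambda>p\<in>\<V>. F p)"
    and H: "H \<in> polyfun C" "h = (\<lambda>p\<in>\<V>. H p)" by (meson carrierE)
  have "(\<lambda>p\<in>\<V>. f p * h p) = (\<lambda>p\<in>\<V>. F p * H p)" "(\<lambda>p\<in>\<V>. f p + h p) = (\<lambda>p\<in>\<V>. F p + H p)"
    by (auto simp: F H)
  then show "(\<lambda>p\<in>\<V>. f p * h p) \<in> carrier B" "(\<lambda>p\<in>\<V>. f p + h p) \<in> carrier B"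
    by (simp_all add: polyfun_mem polyfun_add polyfun_mult F H)
next
  show "(\<lambda>p\<in>\<V>. c) \<in> carrier B" for c by (rule polyfun_mem) (rule polyfun_const)
  show "f \<in> carrier B \<Longrightarrow> f \<in> extensional \<V>" for f by (auto simp: carrier_eq)
qed (simp_all add: B_def coord_ring_def Let_def)

lemma gen_mem [simp]: "v \<in> C \<Longrightarrow> g v \<in> carrier B"
  unfolding gen_def by (rule polyfun_mem) (rule polyfun_var)

lemma eval_gen [simp]: "p \<in> \<V> \<Longrightarrow> g v p = p v"
  by (simp add: gen_def)

lemma polyfun_carrier_induct [consumes 2, case_names const gen add mult]:
  assumes F: "F \<in> polyfun V" and V: "V \<subseteq> C"
    and const: "\<And>c. Q (\<lambda>p\<in>\<V>. c)" and gen: "\<And>v. v \<in> V \<Longrightarrow> Q (g v)"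
    and add: "\<And>f h. f \<in> carrier B \<Longrightarrow> h \<in> carrier B \<Longrightarrow> Q f \<Longrightarrow> Q h \<Longrightarrow> Q (f \<oplus> h)"
    and mult: "\<And>f h. f \<in> carrier B \<Longrightarrow> h \<in> carrier B \<Longrightarrow> Q f \<Longrightarrow> Q h \<Longrightarrow> Q (f \<otimes> h)"
  shows "Q (\<lambda>p\<in>\<V>. F p)"
  using F
proof (induction rule: polyfun.induct)
  case (polyfun_const c)
  show ?case by (rule const)
next
  case (polyfun_var v)
  show ?case using gen[OF polyfun_var] unfolding gen_def .
next
  case (polyfun_add F H)
  have "F \<in> polyfun C" "H \<in> polyfun C" using polyfun_add polyfun_mono[OF _ V] by auto
  note mem = this[THEN polyfun_mem]
  have "(\<lambda>p\<in>\<V>. F p + H p) = (\<lambda>p\<in>\<V>. F p) \<oplus> (\<lambda>p\<in>\<V>. H p)" by (auto simp: add_eq)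
  then show ?case using add[OF mem polyfun_add(3,4)] by argo
next
  case (polyfun_mult F H)
  have "F \<in> polyfun C" "H \<in> polyfun C" using polyfun_mult polyfun_mono[OF _ V] by auto
  note mem = this[THEN polyfun_mem]
  have "(\<lambda>p\<in>\<V>. F p * H p) = (\<lambda>p\<in>\<V>. F p) \<otimes> (\<lambda>p\<in>\<V>. H p)" by (auto simp: mult_eq)
  then show ?case using mult[OF mem polyfun_mult(3,4)] by argo
qed

lemma carrier_induct [consumes 1, case_names const gen add mult]:
  assumes "f \<in> carrier B"
    and "\<And>c. Q (\<lambda>p\<in>\<V>. c)" "\<And>v. v \<in> C \<Longrightarrow> Q (g v)"
    and "\<And>f h. f \<in> carrier B \<Longrightarrow> h \<in> carrier B \<Longrightarrow> Q f \<Longrightarrow> Q h \<Longrightarrow> Q (f \<oplus> h)"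
    and "\<And>f h. f \<in> carrier B \<Longrightarrow> h \<in> carrier B \<Longrightarrow> Q f \<Longrightarrow> Q h \<Longrightarrow> Q (f \<otimes> h)"
  shows "Q f"
proof -
  obtain F where F: "F \<in> polyfun C" "f = (\<lambda>p\<in>\<V>. F p)" using assms(1) by (rule carrierE)
  show ?thesis unfolding F(2)
    by (rule polyfun_carrier_induct[OF F(1) subset_refl]) (fact assms)+
qed

end

text \<open>
  Where \<open>M\<close>, the cofactor of \<open>x\<^sub>i\<close> in the equation, does not vanish, \<open>x\<^sub>i = (z\<^sup>n + 1) / M\<close>. So the variables
  of \<open>W\<close> and \<open>z\<close> are coordinates on this open part of the hypersurface.
\<close>

locale chart = hypersurface_ring k m n a B
  for k m n :: nat and a :: "nat \<Rightarrow> nat"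
    and B :: "('k::{alg_closed_field, field_char_0}, (coord \<Rightarrow> 'k) \<Rightarrow> 'k) module" (structure) +
  fixes i :: nat
  assumes i_mem: "i \<in> {1..k}"
begin

abbreviation W :: "coord set" where "W \<equiv> C - {VX i, VZ}"
abbreviation M :: "(coord \<Rightarrow> 'k) \<Rightarrow> 'k" where "M \<equiv> monomial W \<alpha>"

lemma VX_i_coords [simp]: "VX i \<in> C"
  using i_mem by (auto simp: coords_def)

lemma W_subset: "W \<subseteq> C" by auto

lemma M_polyfun: "M \<in> polyfun W" by (rule polyfun_monomial) simp

lemma polyfun_W_C: "F \<in> polyfun W \<Longrightarrow> F \<in> polyfun C"
  using polyfun_mono[OF _ W_subset] .

lemma monomial_split: "monomial (C - {VZ}) \<alpha> p = p (VX i) * M p" for p :: "coord \<Rightarrow> 'k"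
proof -
  have "C - {VZ} - {VX i} = W" by auto
  then show ?thesis unfolding monomial_def
    using prod.remove[of "C - {VZ}" "VX i" "\<lambda>v. p v ^ \<alpha> v"] by simp
qed

lemma on_hypersurface: "p \<in> \<V> \<Longrightarrow> p (VX i) * M p = p VZ ^ n + 1"
  by (simp add: hypersurface_iff monomial_split)

definition chart_point :: "(coord \<Rightarrow> 'k) \<Rightarrow> 'k \<Rightarrow> coord \<Rightarrow> 'k" where
  "chart_point w t = (\<lambda>v\<in>C. if v = VZ then t else if v = VX i then (t ^ n + 1) / M w else w v)"

lemma chart_point_W: "F \<in> polyfun W \<Longrightarrow> F (chart_point w t) = F w"
  by (erule polyfun_cong) (auto simp: chart_point_def)

lemma chart_point_simps [simp]:
  "chart_point w t VZ = t" "chart_point w t (VX i) = (t ^ n + 1) / M w"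
  by (simp_all add: chart_point_def)

lemma chart_point_mem: "M w \<noteq> 0 \<Longrightarrow> chart_point w t \<in> \<V>"
  using chart_point_W[OF M_polyfun, of w t]
  by (simp add: hypersurface_iff monomial_split) (simp add: chart_point_def)

text \<open>
  A basis over the polynomials in \<open>W\<close>: the elements \<open>x\<^sub>i\<^sup>l z\<^sup>j\<close> with \<open>j < n\<close>, numbered by \<open>N = ln + j\<close>, which
  is the degree in \<open>z\<close> after the substitution \<open>x\<^sub>i = (z\<^sup>n + 1) / M\<close>.
\<close>

definition basis :: "nat \<Rightarrow> (coord \<Rightarrow> 'k) \<Rightarrow> 'k" where
  "basis N p = p (VX i) ^ (N div n) * p VZ ^ (N mod n)"

definition expansion :: "(nat \<Rightarrow> (coord \<Rightarrow> 'k) \<Rightarrow> 'k) \<Rightarrow> nat \<Rightarrow> ((coord \<Rightarrow> 'k) \<Rightarrow> 'k) \<Rightarrow> bool" where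
  "expansion b L F \<longleftrightarrow> (\<forall>N. b N \<in> polyfun W) \<and> (\<forall>p\<in>\<V>. F p = (\<Sum>N<L. b N p * basis N p))"

abbreviation expandable :: "((coord \<Rightarrow> 'k) \<Rightarrow> 'k) \<Rightarrow> bool" where
  "expandable F \<equiv> \<exists>b L. expansion b L F"

lemma expandable_add:
  assumes "expandable F" "expandable H" shows "expandable (\<lambda>p. F p + H p)"
proof -
  obtain b L b' L' where b: "expansion b L F" and b': "expansion b' L' H" using assms by blast
  define b'' where "b'' N = (\<lambda>p. (if N < L then b N p else 0) + (if N < L' then b' N p else 0))" for N
  have "b'' N \<in> polyfun W" for N
    using b b' unfolding b''_def expansion_def
    by (intro polyfun_add; cases "N < L"; cases "N < L'") (auto intro: polyfun_const)
  moreover have "F p + H p = (\<Sum>N<max L L'. b'' N p * basis N p)" if p: "p \<in> \<V>" for p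
  proof -
    have "F p = (\<Sum>N<max L L'. (if N < L then b N p else 0) * basis N p)"
      unfolding b[unfolded expansion_def, THEN conjunct2, rule_format, OF p]
      by (rule sum.mono_neutral_cong_left) auto
    moreover have "H p = (\<Sum>N<max L L'. (if N < L' then b' N p else 0) * basis N p)"
      unfolding b'[unfolded expansion_def, THEN conjunct2, rule_format, OF p]
      by (rule sum.mono_neutral_cong_left) auto
    ultimately show ?thesis by (simp only: b''_def sum.distrib[symmetric] distrib_right)
  qed
  ultimately show ?thesis unfolding expansion_def by blast
qed

lemma expandable_cong: "expandable F \<Longrightarrow> (\<And>p. p \<in> \<V> \<Longrightarrow> F p = H p) \<Longrightarrow> expandable H"
  unfolding expansion_def by auto

lemma expandable_sum:
  "(\<And>j. j \<in> J \<Longrightarrow> expandable (F j)) \<Longrightarrow> expandable (\<lambda>p. \<Sum>j\<in>J. F j p)"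
proof (induction J rule: infinite_finite_induct)
  case (insert x J)
  then show ?case using expandable_add[of "F x" "\<lambda>p. \<Sum>j\<in>J. F j p"] by simp
qed (auto simp: expansion_def intro!: exI[of _ 0] exI[of _ "\<lambda>_ _. 0"] polyfun_const)

lemma expandable_basis:
  assumes "F \<in> polyfun W" shows "expandable (\<lambda>p. F p * basis N p)"
proof -
  define b where "b N' = (if N' = N then F else (\<lambda>_. 0))" for N'
  have "(\<Sum>N'<Suc N. b N' p * basis N' p) = F p * basis N p" for p
  proof -
    have "(\<Sum>N'<Suc N. b N' p * basis N' p) = (\<Sum>N'\<in>{N}. b N' p * basis N' p)"
      by (rule sum.mono_neutral_right) (auto simp: b_def)
    then show ?thesis by (simp add: b_def)
  qed
  moreover have "b N' \<in> polyfun W" for N' using assms by (auto simp: b_def intro: polyfun_const)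
  ultimately have "expansion b (Suc N) (\<lambda>p. F p * basis N p)"
    unfolding expansion_def by (simp del: sum.lessThan_Suc)
  then show ?thesis by blast
qed

lemma basis_mult_x: "p (VX i) * basis N p = basis (N + n) p" for p :: "coord \<Rightarrow> 'k"
  using n_ge by (simp add: basis_def)

lemma basis_mult_z:
  fixes p :: "coord \<Rightarrow> 'k"
  assumes p: "p \<in> \<V>"
  shows "p VZ * basis N p
    = (if Suc (N mod n) < n then basis (Suc N) p else M p * basis (Suc N) p - basis (Suc N - n) p)"
proof (cases "Suc (N mod n) < n")
  case True
  then have "Suc N div n = N div n" "Suc N mod n = Suc (N mod n)"
    using n_ge by (auto simp: mod_Suc div_Suc)
  then show ?thesis using True by (simp add: basis_def)
next
  case False
  then have eq: "Suc (N mod n) = n" using n_ge by (metis Suc_lessI mod_less_divisor not_less_eq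
        less_le_trans zero_less_numeral)
  have "Suc N = n * (N div n) + Suc (N mod n)" by simp
  then have S: "Suc N = n * Suc (N div n)" unfolding eq by simp
  have 1: "basis (Suc N) p = p (VX i) ^ Suc (N div n)" unfolding S basis_def using n_ge by simp
  have "Suc N - n = n * (N div n)" using S by simp
  then have 2: "basis (Suc N - n) p = p (VX i) ^ (N div n)" unfolding basis_def using n_ge by simp
  have "p VZ * basis N p = p (VX i) ^ (N div n) * p VZ ^ Suc (N mod n)" by (simp add: basis_def)
  also have "\<dots> = p (VX i) ^ (N div n) * (p (VX i) * M p - 1)" using eq on_hypersurface[OF p] by simp
  finally show ?thesis using False 1 2 by (simp add: algebra_simps)
qed

text \<open>
  With \<open>H\<close> arbitrary, a product of two factors is dealt with by multiplying twice, so only the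
  multiplication by a single variable needs a computation. Multiplying by \<open>z\<close> uses \<open>z\<^sup>n = x\<^sub>i M - 1\<close>.
\<close>

lemma expandable_mult:
  assumes "F \<in> polyfun C" "expandable H" shows "expandable (\<lambda>p. F p * H p)"
  using assms
proof (induction F arbitrary: H rule: polyfun.induct)
  case (polyfun_const c)
  then obtain b L where b: "expansion b L H" by blast
  then have "expansion (\<lambda>N p. c * b N p) L (\<lambda>p. c * H p)"
    by (auto simp: expansion_def sum_distrib_left ac_simps intro: polyfun_scale)
  then show ?case by blast
next
  case (polyfun_var v)
  then obtain b L where b: "expansion b L H" by blast
  then have H: "p v * H p = (\<Sum>N<L. b N p * (p v * basis N p))" if "p \<in> \<V>" for p
    using that by (auto simp: expansion_def sum_distrib_left ac_simps)
  have bW: "b N \<in> polyfun W" for N using b by (auto simp: expansion_def)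
  consider "v = VX i" | "v = VZ" | "v \<in> W" using polyfun_var by blast
  then show ?case
  proof cases
    case 1
    show ?thesis
    proof (rule expandable_cong[OF expandable_sum])
      show "expandable (\<lambda>p. b N p * basis (N + n) p)" for N using expandable_basis[OF bW] .
    qed (use H 1 in \<open>simp add: basis_mult_x\<close>)
  next
    case 2
    show ?thesis
    proof (rule expandable_cong[OF expandable_sum])
      show "expandable (\<lambda>p. b N p * (if Suc (N mod n) < n then basis (Suc N) p
          else M p * basis (Suc N) p - basis (Suc N - n) p))" for N
      proof (cases "Suc (N mod n) < n")
        case True
        then show ?thesis using expandable_basis[OF bW] by simp
      next
        case False
        have "expandable (\<lambda>p. (b N p * M p) * basis (Suc N) p + ((- 1) * b N p) * basis (Suc N - n) p)"
          by (intro expandable_add expandable_basis polyfun_mult polyfun_scale bW M_polyfun)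
        then show ?thesis using False by (simp add: algebra_simps)
      qed
    qed (use H 2 in \<open>simp add: basis_mult_z\<close>)
  next
    case 3
    have "expansion (\<lambda>N p. p v * b N p) L (\<lambda>p. p v * H p)"
      using H bW 3 by (auto simp: expansion_def ac_simps intro: polyfun_mult polyfun.polyfun_var)
    then show ?thesis by blast
  qed
next
  case (polyfun_add F1 F2)
  have "expandable (\<lambda>p. F1 p * H p + F2 p * H p)"
    by (intro expandable_add polyfun_add)
  then show ?case by (simp only: distrib_right)
next
  case (polyfun_mult F1 F2)
  then have "expandable (\<lambda>p. F1 p * (F2 p * H p))" by blast
  then show ?case by (simp only: mult.assoc)
qed

lemma expansion_exists: assumes "f \<in> carrier B" shows "expandable f"
proof -
  obtain F where F: "F \<in> polyfun C" "f = (\<lambda>p\<in>\<V>. F p)" using assms by (rule carrierE)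
  have "expandable (\<lambda>p. 1 * basis 0 p)" by (rule expandable_basis) (rule polyfun_const)
  then have "expandable (\<lambda>p. F p * (1 * basis 0 p))" by (rule expandable_mult[OF F(1)])
  then show ?thesis by (rule expandable_cong) (simp add: F basis_def)
qed

text \<open>
  In the chart, for fixed values of the variables in \<open>W\<close>, the basis element with index \<open>N\<close> is a
  polynomial of degree \<open>N\<close> in \<open>z\<close>, so leading terms cannot cancel.
\<close>

lemma expansion_poly:
  assumes b: "expansion b (Suc L) F" and w: "M w \<noteq> 0" "b L w \<noteq> 0"
  obtains P :: "'k poly" where "P \<noteq> 0" "\<And>t. F (chart_point w t) = poly P t"
proof -
  define R :: "'k poly" where "R = monom 1 n + 1"
  define Q :: "nat \<Rightarrow> 'k poly" where "Q N = smult (b N w / M w ^ (N div n)) (R ^ (N div n) * monom 1 (N mod n))" for N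
  have R: "degree R = n" "lead_coeff R = 1"
    using n_ge by (auto simp: R_def degree_add_eq_left degree_monom_eq)
  then have R0: "R \<noteq> 0" by auto
  have degR: "degree (R ^ (N div n) * monom 1 (N mod n)) = N" for N
    using R R0 by (simp add: degree_mult_eq degree_power_eq degree_monom_eq)
  have QL: "coeff (Q N) L = 0" if "N < L" for N
    using that degR by (simp add: Q_def coeff_eq_0)
  have "coeff (Q L) L = b L w / M w ^ (L div n) * lead_coeff (R ^ (L div n) * monom 1 (L mod n))"
    using degR by (simp add: Q_def)
  also have "\<dots> = b L w / M w ^ (L div n)"
    by (simp only: lead_coeff_mult lead_coeff_power R(2) lead_coeff_monom) simp
  finally have "coeff (Q L) L \<noteq> 0" using w by simp
  then have "coeff (\<Sum>N<Suc L. Q N) L \<noteq> 0" using QL by (simp add: coeff_sum)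
  moreover have "F (chart_point w t) = poly (\<Sum>N<Suc L. Q N) t" for t
  proof -
    have "F (chart_point w t) = (\<Sum>N<Suc L. b N (chart_point w t) * basis N (chart_point w t))"
      using b chart_point_mem[OF w(1), of t] by (auto simp: expansion_def simp del: sum.lessThan_Suc)
    also have "\<dots> = (\<Sum>N<Suc L. poly (Q N) t)"
    proof (rule sum.cong)
      fix N
      have "b N (chart_point w t) = b N w" using b chart_point_W by (auto simp: expansion_def)
      then show "b N (chart_point w t) * basis N (chart_point w t) = poly (Q N) t"
        by (simp add: basis_def Q_def R_def poly_monom power_divide)
    qed simp
    finally show ?thesis by (simp add: poly_sum)
  qed
  ultimately show thesis using that[of "\<Sum>N<Suc L. Q N"] by (metis coeff_0)
qed

text \<open>
  Dropping the vanishing coefficients at the end makes a leading coefficient available.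
\<close>

lemma expansion_truncate:
  assumes b: "expansion b L F" and "N < L" "b N q \<noteq> 0"
  obtains L' where "L' < L" "N \<le> L'" "\<exists>q. b L' q \<noteq> 0" "expansion b (Suc L') F"
proof -
  define S where "S = {N. N < L \<and> (\<exists>q. b N q \<noteq> 0)}"
  have S: "finite S" "N \<in> S" using assms by (auto simp: S_def)
  then have max: "Max S \<in> S" using Max_in by blast
  have "(\<Sum>N<L. b N p * basis N p) = (\<Sum>N<Suc (Max S). b N p * basis N p)" for p
  proof (rule sum.mono_neutral_right)
    show "\<forall>i\<in>{..<L} - {..<Suc (Max S)}. b i p * basis i p = 0"
    proof
      fix j assume j: "j \<in> {..<L} - {..<Suc (Max S)}"
      then have "j \<notin> S" using Max_ge[OF S(1), of j] by auto
      then show "b j p * basis j p = 0" using j by (auto simp: S_def)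
    qed
  qed (use max in \<open>auto simp: S_def\<close>)
  then have "expansion b (Suc (Max S)) F" using b by (simp add: expansion_def)
  then show thesis using that[of "Max S"] max S Max_ge[OF S] by (auto simp: S_def)
qed

lemma expansion_nonzeroE:
  assumes "f \<in> carrier B" "f \<noteq> \<zero>"
  obtains b L where "expansion b (Suc L) f" "\<exists>q. b L q \<noteq> 0"
proof -
  obtain b L where b: "expansion b L f" using expansion_exists[OF assms(1)] by blast
  have "\<exists>N<L. \<exists>q. b N q \<noteq> 0"
  proof (rule ccontr)
    assume "\<not> ?thesis"
    then have "f p = 0" if "p \<in> \<V>" for p using b that by (simp add: expansion_def)
    then have "f = \<zero>" using assms(1) by (intro elem_eqI) auto
    then show False using assms by simp
  qed
  then show thesis using expansion_truncate[OF b] that by metis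
qed

lemma nonzero_in_chart:
  assumes "F \<in> polyfun W" "F q \<noteq> 0"
  obtains w where "F w \<noteq> 0" "M w \<noteq> 0"
proof -
  have "M (\<lambda>_. 1 :: 'k) \<noteq> 0" by (simp add: monomial_def)
  then show thesis
    using polyfun_common_nonzero[where F = F and G = M and p = q, OF assms(1) M_polyfun assms(2)] that
    by blast
qed

lemma expansion_unique:
  assumes b: "expansion b L F" and 0: "\<And>p. p \<in> \<V> \<Longrightarrow> F p = 0" and "N < L"
  shows "b N q = 0"
proof (rule ccontr)
  assume "b N q \<noteq> 0"
  then obtain L' q' where L: "b L' q' \<noteq> 0" "expansion b (Suc L') F"
    using expansion_truncate[OF b \<open>N < L\<close>] by metis
  have "b L' \<in> polyfun W" using b by (auto simp: expansion_def)
  then obtain w where w: "b L' w \<noteq> 0" "M w \<noteq> 0" using nonzero_in_chart L(1) by blast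
  obtain P where P: "P \<noteq> 0" "\<And>t. F (chart_point w t) = poly P t"
    using expansion_poly[OF L(2) w(2,1)] by metis
  obtain t where "poly P t \<noteq> 0" using poly_nonzero_point[OF P(1)] by blast
  then show False using P(2) 0[OF chart_point_mem[OF w(2)]] by metis
qed

text \<open>
  Fix values of \<open>W\<close> at which \<open>M\<close> and both leading coefficients are nonzero. There the two elements
  become nonzero polynomials in \<open>z\<close>, whose product has a nonroot.
\<close>

lemma chart_no_zero_divisors:
  assumes f: "f \<in> carrier B" "f \<noteq> \<zero>" and h: "h \<in> carrier B" "h \<noteq> \<zero>"
  shows "f \<otimes> h \<noteq> \<zero>"
proof -
  obtain b L q where b: "expansion b (Suc L) f" "b L q \<noteq> 0" using expansion_nonzeroE[OF f] by metis
  obtain b' L' q' where b': "expansion b' (Suc L') h" "b' L' q' \<noteq> 0" using expansion_nonzeroE[OF h] by metis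
  have pf: "b L \<in> polyfun W" "b' L' \<in> polyfun W" using b b' by (auto simp: expansion_def)
  obtain r where r: "b L r \<noteq> 0" "b' L' r \<noteq> 0"
    using polyfun_common_nonzero[where F = "b L" and G = "b' L'" and p = q and q = q', OF pf b(2) b'(2)]
    by blast
  have "b L r * b' L' r \<noteq> 0" using r by simp
  then obtain w where w: "b L w * b' L' w \<noteq> 0" "M w \<noteq> 0"
    using nonzero_in_chart[OF polyfun_mult[OF pf]] by blast
  obtain P where P: "P \<noteq> 0" "\<And>t. f (chart_point w t) = poly P t"
    using expansion_poly[OF b(1) w(2)] w(1) by (metis mult_eq_0_iff)
  obtain Q where Q: "Q \<noteq> 0" "\<And>t. h (chart_point w t) = poly Q t"
    using expansion_poly[OF b'(1) w(2)] w(1) by (metis mult_eq_0_iff)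
  have "P * Q \<noteq> 0" using P Q by simp
  then obtain t where "poly (P * Q) t \<noteq> 0" using poly_nonzero_point by blast
  then have "(f \<otimes> h) (chart_point w t) \<noteq> 0" using P Q chart_point_mem[OF w(2)] by simp
  then show ?thesis using eval_zero[OF chart_point_mem[OF w(2)]] by metis
qed

end

sublocale hypersurface_ring \<subseteq> function_domain B \<V>
proof
  interpret chart k m n a B 1
    by unfold_locales (use k_ge in auto)
  show "f = \<zero> \<or> h = \<zero>" if "f \<in> carrier B" "h \<in> carrier B" "f \<otimes> h = \<zero>" for f h
    using chart_no_zero_divisors that by blast
qed


section \<open>Endomorphisms and derivations of the coordinate ring\<close>

context hypersurface_ring
begin

lemma alg_end_add:
  "alg_end B \<phi> \<Longrightarrow> f \<in> carrier B \<Longrightarrow> h \<in> carrier B \<Longrightarrow> \<phi> (f \<oplus> h) = \<phi> f \<oplus> \<phi> h"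
  and alg_end_mult:
  "alg_end B \<phi> \<Longrightarrow> f \<in> carrier B \<Longrightarrow> h \<in> carrier B \<Longrightarrow> \<phi> (f \<otimes> h) = \<phi> f \<otimes> \<phi> h"
  and alg_end_smult:
  "alg_end B \<phi> \<Longrightarrow> f \<in> carrier B \<Longrightarrow> \<phi> (c \<odot> f) = c \<odot> \<phi> f"
  and alg_end_one: "alg_end B \<phi> \<Longrightarrow> \<phi> \<one> = \<one>"
  by (auto simp: alg_end_def)

lemma alg_end_const: assumes "alg_end B \<phi>" shows "\<phi> (\<lambda>p\<in>\<V>. c) = (\<lambda>p\<in>\<V>. c)"
proof -
  have "(\<lambda>p\<in>\<V>. c) = c \<odot> \<one>" by (rule elem_eqI) (auto simp: const_mem)
  moreover have "\<phi> (c \<odot> \<one>) = c \<odot> \<one>"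
    using assms by (simp add: alg_end_smult alg_end_one)
  ultimately show ?thesis by argo
qed

lemma alg_end_eval:
  assumes \<phi>: "alg_end B \<phi>" and F: "F \<in> polyfun C" and p: "p \<in> \<V>"
  shows "\<phi> (\<lambda>p\<in>\<V>. F p) p = F (\<lambda>v. \<phi> (g v) p)"
  using F
proof (induction rule: polyfun.induct)
  case (polyfun_const c)
  show ?case unfolding alg_end_const[OF \<phi>] using p by simp
next
  case (polyfun_var v)
  then show ?case by (simp add: gen_def)
next
  case (polyfun_add F H)
  have "(\<lambda>p\<in>\<V>. F p + H p) = (\<lambda>p\<in>\<V>. F p) \<oplus> (\<lambda>p\<in>\<V>. H p)" by (auto simp: add_eq)
  moreover have "\<phi> ((\<lambda>p\<in>\<V>. F p) \<oplus> (\<lambda>p\<in>\<V>. H p)) = \<phi> (\<lambda>p\<in>\<V>. F p) \<oplus> \<phi> (\<lambda>p\<in>\<V>. H p)"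
    by (intro alg_end_add \<phi> polyfun_mem polyfun_add)
  ultimately show ?case by (simp only: polyfun_add(3,4) eval_add[OF p])
next
  case (polyfun_mult F H)
  have "(\<lambda>p\<in>\<V>. F p * H p) = (\<lambda>p\<in>\<V>. F p) \<otimes> (\<lambda>p\<in>\<V>. H p)" by (auto simp: mult_eq)
  moreover have "\<phi> ((\<lambda>p\<in>\<V>. F p) \<otimes> (\<lambda>p\<in>\<V>. H p)) = \<phi> (\<lambda>p\<in>\<V>. F p) \<otimes> \<phi> (\<lambda>p\<in>\<V>. H p)"
    by (intro alg_end_mult \<phi> polyfun_mem polyfun_mult)
  ultimately show ?case by (simp only: polyfun_mult(3,4) eval_mult[OF p])
qed

lemma alg_end_eqI:
  assumes \<phi>: "alg_end B \<phi>" and \<psi>: "alg_end B \<psi>" and eq: "\<And>v. v \<in> C \<Longrightarrow> \<phi> (g v) = \<psi> (g v)"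
  shows "\<phi> = \<psi>"
proof (rule extensionalityI[of _ "carrier B"])
  show "\<phi> \<in> extensional (carrier B)" "\<psi> \<in> extensional (carrier B)"
    using \<phi> \<psi> by (auto simp: alg_end_def PiE_def)
  fix f assume f: "f \<in> carrier B"
  then obtain F where F: "F \<in> polyfun C" "f = (\<lambda>p\<in>\<V>. F p)" by (rule carrierE)
  show "\<phi> f = \<psi> f"
  proof (rule elem_eqI)
    fix p assume p: "p \<in> \<V>"
    have "F (\<lambda>v. \<phi> (g v) p) = F (\<lambda>v. \<psi> (g v) p)"
      by (rule polyfun_cong[OF F(1)]) (simp add: eq)
    then show "\<phi> f p = \<psi> f p"
      unfolding F(2) alg_end_eval[OF \<phi> F(1) p] alg_end_eval[OF \<psi> F(1) p] .
  qed (use f \<phi> \<psi> in auto)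
qed

lemma alg_end_pow:
  assumes "alg_end B \<phi>" "f \<in> carrier B" shows "\<phi> (f [^] (j::nat)) = \<phi> f [^] j"
  by (induction j) (use assms in \<open>auto simp: pow_0' pow_Suc' alg_end_def\<close>)

lemma derivation_scaled:
  assumes D: "derivation B D" and D': "derivation B D'"
    and gens: "\<And>v p. v \<in> C \<Longrightarrow> p \<in> \<V> \<Longrightarrow> D' (g v) p = h p * D (g v) p"
    and f: "f \<in> carrier B" and p: "p \<in> \<V>"
  shows "D' f p = h p * D f p"
  using f
proof (induction rule: carrier_induct)
  case (const c)
  show ?case unfolding derivation_const[OF D] derivation_const[OF D'] using p by simp
next
  case (gen v)
  then show ?case using gens p by blast
next
  case (add f1 f2)
  then show ?case using p
    by (simp add: derivation_add[OF D] derivation_add[OF D'] algebra_simps)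
next
  case (mult f1 f2)
  then show ?case using p
    by (simp add: derivation_mult[OF D] derivation_mult[OF D'] algebra_simps)
qed

text \<open>
  The endomorphism allows for derivations that kill the images of the variables rather than the
  variables themselves; the case of the identity is \<open>derivation_kills_polyfun\<close>.
\<close>

lemma derivation_kills_image:
  assumes D: "derivation B D" and \<phi>: "alg_end B \<phi>" and F: "F \<in> polyfun V" and V: "V \<subseteq> C"
    and kill: "\<And>v. v \<in> V \<Longrightarrow> D (\<phi> (g v)) = \<zero>"
  shows "D (\<phi> (\<lambda>p\<in>\<V>. F p)) = \<zero>"
  using F V
proof (induction rule: polyfun_carrier_induct)
  case (const c)
  show ?case unfolding alg_end_const[OF \<phi>] by (rule derivation_const[OF D])
next
  case (add f h)
  then have "D (\<phi> (f \<oplus> h)) = D (\<phi> f) \<oplus> D (\<phi> h)"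
    using \<phi> derivation_add[OF D, of "\<phi> f" "\<phi> h"] by (simp add: alg_end_add)
  then show ?case using add by simp
next
  case (mult f h)
  then have "D (\<phi> (f \<otimes> h)) = D (\<phi> f) \<otimes> \<phi> h \<oplus> \<phi> f \<otimes> D (\<phi> h)"
    using \<phi> derivation_mult[OF D, of "\<phi> f" "\<phi> h"] by (simp add: alg_end_mult)
  then show ?case using mult \<phi> by simp
qed (use kill in blast)

lemma alg_end_id: "alg_end B (\<lambda>f\<in>carrier B. f)"
  by (auto simp: alg_end_def)

lemma derivation_kills_polyfun:
  assumes D: "derivation B D" and F: "F \<in> polyfun V" and V: "V \<subseteq> C"
    and kill: "\<And>v. v \<in> V \<Longrightarrow> D (g v) = \<zero>"
  shows "D (\<lambda>p\<in>\<V>. F p) = \<zero>"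
proof -
  have "(\<lambda>p\<in>\<V>. F p) \<in> carrier B" by (rule polyfun_mem[OF polyfun_mono[OF F V]])
  moreover have "D ((\<lambda>f\<in>carrier B. f) (\<lambda>p\<in>\<V>. F p)) = \<zero>"
    by (rule derivation_kills_image[OF D alg_end_id F V]) (use kill V in auto)
  ultimately show ?thesis by (simp only: restrict_apply')
qed

definition cofactor :: "coord \<Rightarrow> (coord \<Rightarrow> 'k) \<Rightarrow> 'k" where
  "cofactor u = monomial (C - {u, VZ}) \<alpha>"

lemma cofactor_polyfun: "cofactor u \<in> polyfun (C - {u, VZ})"
  unfolding cofactor_def by (rule polyfun_monomial) simp

lemma on_hypersurface_cofactor:
  assumes "u \<in> C - {VZ}" "p \<in> \<V>"
  shows "p u ^ \<alpha> u * cofactor u p = p VZ ^ n + 1"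
proof -
  have "C - {VZ} - {u} = C - {u, VZ}" by auto
  then have "monomial (C - {VZ}) \<alpha> p = p u ^ \<alpha> u * cofactor u p"
    unfolding monomial_def cofactor_def
    using prod.remove[of "C - {VZ}" u "\<lambda>v. p v ^ \<alpha> v"] assms(1) by simp
  then show ?thesis using assms(2) by (simp add: hypersurface_iff)
qed

lemma nonzero_at:
  assumes "f \<in> carrier B" "p \<in> \<V>" "f p \<noteq> 0" shows "f \<noteq> \<zero>"
  using assms by auto

text \<open>
  The point with \<open>z = 1\<close>, one \<open>x\<close> equal to \<open>2\<close> and all other coordinates equal to \<open>1\<close> witnesses that
  products of generators are nonzero.
\<close>

lemma generic_point:
  obtains p where "p \<in> \<V>" "\<And>v. v \<in> C \<Longrightarrow> p v \<noteq> 0"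
proof -
  interpret chart k m n a B k
    by unfold_locales (use k_ge in auto)
  have nz: "(1 ^ n + 1 :: 'k) \<noteq> 0" by simp
  have M1: "M (\<lambda>_. 1) = 1" by (simp add: monomial_def)
  then have "chart_point (\<lambda>_. 1) 1 \<in> \<V>" by (intro chart_point_mem) simp
  moreover have "chart_point (\<lambda>_. 1) 1 v \<noteq> 0" if "v \<in> C" for v
    using that nz M1 by (auto simp: chart_point_def)
  ultimately show thesis using that by blast
qed

lemma gen_nonzero: assumes "v \<in> C" shows "g v \<noteq> \<zero>"
proof -
  obtain p where "p \<in> \<V>" "p v \<noteq> 0" using generic_point assms by metis
  then show ?thesis using nonzero_at[OF gen_mem[OF assms]] by simp
qed

lemma cofactor_mem: "(\<lambda>p\<in>\<V>. cofactor u p) \<in> carrier B"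
  by (rule polyfun_mem[OF polyfun_mono[OF cofactor_polyfun]]) auto

lemma gen_pow_cofactor_nonzero:
  assumes "u \<in> C" shows "g u [^] (j::nat) \<otimes> (\<lambda>p\<in>\<V>. cofactor u p) \<noteq> \<zero>"
proof -
  obtain p where p: "p \<in> \<V>" "\<And>v. v \<in> C \<Longrightarrow> p v \<noteq> 0" using generic_point by blast
  then have "cofactor u p \<noteq> 0" by (simp add: cofactor_def monomial_def)
  then show ?thesis
    using nonzero_at[OF mult_mem'[OF pow_mem[OF gen_mem[OF assms]] cofactor_mem] p(1)] p assms by simp
qed

text \<open>
  Modulo \<open>u\<^sup>e N\<close>, where \<open>N\<close> is the cofactor of \<open>u\<close> and \<open>e\<close> its exponent, \<open>z\<close> is invertible because
  \<open>z\<^sup>n = -1\<close>. Hence differentiating the equation of the hypersurface shows that \<open>u\<^sup>e\<^sup>-\<^sup>1 N\<close> divides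
  \<open>D(z)\<close>.
\<close>

lemma derivation_two_variables:
  assumes D: "derivation B D" and u: "u \<in> C - {VZ}"
    and kill: "\<And>v. v \<in> C - {u, VZ} \<Longrightarrow> D (g v) = \<zero>"
  obtains h where "h \<in> carrier B"
    "\<And>p. p \<in> \<V> \<Longrightarrow> D (g VZ) p = p u ^ (\<alpha> u - 1) * cofactor u p * h p"
    "\<And>p. p \<in> \<V> \<Longrightarrow> of_nat (\<alpha> u) * D (g u) p = of_nat n * p VZ ^ (n - 1) * h p"
proof -
  let ?N = "\<lambda>p\<in>\<V>. cofactor u p"
  let ?e = "\<alpha> u"
  \<comment> \<open>The factor \<open>h\<close> comes from \<open>D(z) = u\<^sup>e N D(z) - z z\<^sup>n\<^sup>-\<^sup>1 D(z)\<close>, whose last factor is replaced by means of the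
     derivative of the equation, \<open>e u\<^sup>e\<^sup>-\<^sup>1 N D(u) = n z\<^sup>n\<^sup>-\<^sup>1 D(z)\<close>.\<close>
  define h where "h = g u \<otimes> D (g VZ) \<oplus> (- (of_nat ?e / of_nat n)) \<odot> (g VZ \<otimes> D (g u))"
  have uC: "u \<in> C" using u by simp
  have e: "?e \<ge> 1" using exponent_pos u by simp
  note Nmem = cofactor_mem[of u]
  have N0: "D ?N = \<zero>"
    by (rule derivation_kills_polyfun[OF D cofactor_polyfun]) (use kill in auto)
  have mem: "D (g u) \<in> carrier B" "D (g VZ) \<in> carrier B" using D uC by auto
  then have h: "h \<in> carrier B" using uC by (simp add: h_def)
  have n0: "(of_nat n :: 'k) \<noteq> 0" using n_ge by simp
  have rel: "g u [^] ?e \<otimes> ?N = g VZ [^] n \<oplus> \<one>"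
    by (rule elem_eqI) (use uC Nmem on_hypersurface_cofactor[OF u] in auto)
  have der: "of_nat ?e * p u ^ (?e - 1) * cofactor u p * D (g u) p = of_nat n * p VZ ^ (n - 1) * D (g VZ) p"
    if p: "p \<in> \<V>" for p
  proof -
    have "D (g u [^] ?e \<otimes> ?N) p = D (g u [^] ?e) p * cofactor u p"
      using derivation_mult[OF D, of "g u [^] ?e" ?N] N0 uC Nmem p by simp
    moreover have "D (g VZ [^] n \<oplus> \<one>) p = D (g VZ [^] n) p"
      using derivation_add[OF D, of "g VZ [^] n" \<one>] D p by simp
    ultimately show ?thesis
      using rel derivation_pow[OF D gen_mem[OF uC] p] derivation_pow[OF D gen_mem[OF VZ_coords] p] p
      by (simp add: algebra_simps)
  qed
  have Dz: "D (g VZ) p = p u ^ (?e - 1) * cofactor u p * h p" if p: "p \<in> \<V>" for p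
  proof -
    have ue: "p u ^ ?e = p u ^ (?e - 1) * p u" using e by (cases ?e) auto
    have zn: "p VZ ^ n = p VZ * p VZ ^ (n - 1)" using n_ge by (cases n) auto
    have "D (g VZ) p = (p u ^ ?e * cofactor u p - p VZ ^ n) * D (g VZ) p"
      using on_hypersurface_cofactor[OF u p] by simp
    also have "\<dots> = p u ^ (?e - 1) * cofactor u p * (p u * D (g VZ) p)
        - p VZ / of_nat n * (of_nat n * p VZ ^ (n - 1) * D (g VZ) p)"
      using n0 by (simp add: ue zn algebra_simps)
    also have "\<dots> = p u ^ (?e - 1) * cofactor u p * h p"
      unfolding der[OF p, symmetric] using p by (simp add: h_def algebra_simps)
    finally show ?thesis .
  qed
  have "(of_nat ?e) \<odot> D (g u) = (of_nat n) \<odot> (g VZ [^] (n - 1) \<otimes> h)"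
  proof (rule mult_cancel[of _ _ "g u [^] (?e - 1) \<otimes> ?N"])
    show "g u [^] (?e - 1) \<otimes> ?N \<noteq> \<zero>" by (rule gen_pow_cofactor_nonzero[OF uC])
  next
    fix p assume p: "p \<in> \<V>"
    show "(g u [^] (?e - 1) \<otimes> ?N) p * (of_nat ?e \<odot> D (g u)) p
        = (g u [^] (?e - 1) \<otimes> ?N) p * (of_nat n \<odot> (g VZ [^] (n - 1) \<otimes> h)) p"
      using der[OF p] Dz[OF p] p uC by (simp add: algebra_simps)
  qed (use mem h uC Nmem in auto)
  then have "of_nat ?e * D (g u) p = of_nat n * p VZ ^ (n - 1) * h p" if "p \<in> \<V>" for p
    using that eval_smult[OF that] by (metis (no_types, lifting) eval_gen eval_mult eval_pow mult.assoc)
  then show thesis using that h Dz by blast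
qed

end

context chart
begin

lemma cofactor_x: "cofactor (VX i) = M"
  by (simp add: cofactor_def)

abbreviation \<iota> :: "((coord \<Rightarrow> 'k) \<Rightarrow> 'k) \<Rightarrow> (coord \<Rightarrow> 'k) \<Rightarrow> 'k" where
  "\<iota> F \<equiv> \<lambda>p\<in>\<V>. F p"

lemma iota_mem [simp]: "F \<in> polyfun W \<Longrightarrow> \<iota> F \<in> carrier B"
  by (intro polyfun_mem polyfun_W_C)

lemma iota_M_mem [simp]: "\<iota> M \<in> carrier B"
  by (rule iota_mem[OF M_polyfun])

text \<open>
  The difference of \<open>F\<close> and \<open>H\<close> is its own expansion, concentrated in index \<open>0\<close>, and expansions are
  unique.
\<close>

lemma iota_eqD:
  assumes F: "F \<in> polyfun W" and H: "H \<in> polyfun W" and eq: "\<And>p. p \<in> \<V> \<Longrightarrow> F p = H p"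
  shows "F q = H q"
proof -
  have "expansion (\<lambda>N p. F p - H p) 1 (\<lambda>p. F p - H p)"
    using polyfun_diff[OF F H] by (simp add: expansion_def basis_def)
  then have "F q - H q = 0"
    by (rule expansion_unique) (use eq in auto)
  then show ?thesis by simp
qed

lemma iota_nonzero:
  assumes F: "F \<in> polyfun W" and q: "F q \<noteq> 0"
  shows "\<iota> F \<noteq> \<zero>"
proof
  assume 0: "\<iota> F = \<zero>"
  have "F p = 0" if "p \<in> \<V>" for p using fun_cong[OF 0, of p] that by simp
  then show False using iota_eqD[OF F polyfun_const[of 0], of q] q by simp
qed

lemma iota_M_nonzero: "\<iota> M \<noteq> \<zero>"
  by (rule iota_nonzero[OF M_polyfun, of "\<lambda>_. 1"]) (simp add: monomial_def)

text \<open>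
  The expansion of \<open>f\<close> in the basis displays the degree of \<open>f\<close> with respect to any locally nilpotent
  derivation killing \<open>W\<close>: the basis element with index \<open>N\<close> has degree \<open>N\<close> times the degree of \<open>z\<close>.
\<close>

context
  fixes D d
  assumes D: "lnd B D" and kill: "\<And>v. v \<in> W \<Longrightarrow> D (g v) = \<zero>"
    and d: "lnd_degree D (g VZ) d" and d_pos: "d > 0"
begin

lemma kills_iota: "F \<in> polyfun W \<Longrightarrow> D (\<iota> F) = \<zero>"
  by (rule derivation_kills_polyfun[OF lnd_derivation[OF D] _ W_subset kill])

lemma degree_x: "lnd_degree D (g (VX i)) (n * d)"
proof -
  note der = lnd_derivation[OF D]
  have rel: "g (VX i) \<otimes> \<iota> M = g VZ [^] n \<oplus> \<one>"
    by (rule elem_eqI) (auto simp: on_hypersurface)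
  have "(D ^^ (n * d)) \<one> = \<zero>"
    by (rule derivation_iter_zero_mono[OF der, of 1]) (use der d_pos n_ge in auto)
  then have 1: "lnd_degree D (g (VX i) \<otimes> \<iota> M) (n * d)"
    unfolding rel by (intro lnd_degree_add_lower[OF D] lnd_degree_pow[OF D] d) auto
  obtain e where e: "lnd_degree D (g (VX i)) e"
    using lnd_degree_exists[OF D] gen_nonzero by (meson VX_i_coords gen_mem)
  have M0: "lnd_degree D (\<iota> M) 0"
    using kills_iota[OF M_polyfun] iota_M_nonzero by (simp add: lnd_degree_0_iff)
  have "e + 0 = n * d"
    by (rule lnd_degree_unique[OF D lnd_degree_mult[OF D gen_mem[OF VX_i_coords] iota_M_mem e M0] 1])
  then show ?thesis using e by simp
qed

lemma degree_basis:
  assumes F: "F \<in> polyfun W" and "F q \<noteq> 0"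
  shows "lnd_degree D (\<lambda>p\<in>\<V>. F p * basis N p) (N * d)"
proof -
  have "\<iota> F \<noteq> \<zero>" by (rule iota_nonzero[where q = q, OF assms])
  then have "lnd_degree D (\<iota> F) 0" using kills_iota[OF F] by (simp add: lnd_degree_0_iff)
  then have "lnd_degree D (\<iota> F \<otimes> (g (VX i) [^] (N div n) \<otimes> g VZ [^] (N mod n)))
      (0 + (N div n * (n * d) + N mod n * d))"
    by (intro lnd_degree_mult[OF D] lnd_degree_pow[OF D] degree_x d) (use F in auto)
  moreover have "\<iota> F \<otimes> (g (VX i) [^] (N div n) \<otimes> g VZ [^] (N mod n)) = (\<lambda>p\<in>\<V>. F p * basis N p)"
    by (auto simp: mult_eq basis_def)
  moreover have "0 + (N div n * (n * d) + N mod n * d) = N * d"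
    by (metis add_0 add_mult_distrib div_mult_mod_eq mult.assoc)
  ultimately show ?thesis by simp
qed

lemma basis_polyfun: "basis N \<in> polyfun C"
  unfolding basis_def[abs_def] by (intro polyfun_mult polyfun_pow polyfun_var) auto

lemma partial_sum_killed:
  assumes b: "\<And>N. b N \<in> polyfun W"
  shows "(D ^^ (L * d)) (\<lambda>p\<in>\<V>. \<Sum>N<L. b N p * basis N p) = \<zero>"
proof (induction L)
  case 0
  have "(\<lambda>p\<in>\<V>. \<Sum>N<0. b N p * basis N p) = \<zero>" by (simp add: zero_eq)
  then show ?case by simp
next
  case (Suc L)
  note der = lnd_derivation[OF D]
  let ?S = "\<lambda>p\<in>\<V>. \<Sum>N<L. b N p * basis N p" and ?t = "\<lambda>p\<in>\<V>. b L p * basis L p"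
  have pf: "(\<lambda>p. b N p * basis N p) \<in> polyfun C" for N
    by (intro polyfun_mult polyfun_W_C b basis_polyfun)
  have mem: "?S \<in> carrier B" "?t \<in> carrier B"
    by (intro polyfun_mem polyfun_sum pf)+
  have eq: "(\<lambda>p\<in>\<V>. \<Sum>N<Suc L. b N p * basis N p) = ?S \<oplus> ?t"
    by (auto simp: add_eq)
  have S: "(D ^^ (Suc L * d)) ?S = \<zero>" by (rule derivation_iter_zero_mono[OF der Suc]) simp
  have t: "(D ^^ (Suc L * d)) ?t = \<zero>"
  proof (cases "\<exists>q. b L q \<noteq> 0")
    case True
    then have "lnd_degree D ?t (L * d)" using degree_basis[OF b] by blast
    then have "(D ^^ Suc (L * d)) ?t = \<zero>" by (simp add: lnd_degree_def)
    then show ?thesis by (rule derivation_iter_zero_mono[OF der]) (use d_pos in simp)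
  next
    case False
    then have "?t = \<zero>" by (simp add: zero_eq)
    then show ?thesis using der by simp
  qed
  show ?case unfolding eq derivation_iter_add[OF der mem] S t by simp
qed

lemma degree_expansion:
  assumes b: "expansion b (Suc L) f" and f: "f \<in> carrier B" and q: "b L q \<noteq> 0"
  shows "lnd_degree D f (L * d)"
proof -
  have bW: "b N \<in> polyfun W" for N using b by (auto simp: expansion_def)
  let ?S = "\<lambda>p\<in>\<V>. \<Sum>N<L. b N p * basis N p" and ?t = "\<lambda>p\<in>\<V>. b L p * basis L p"
  have pf: "(\<lambda>p. b N p * basis N p) \<in> polyfun C" for N
    by (intro polyfun_mult polyfun_W_C bW basis_polyfun)
  have mem: "?S \<in> carrier B" "?t \<in> carrier B"
    by (intro polyfun_mem polyfun_sum pf)+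
  have "f = ?t \<oplus> ?S"
    by (rule elem_eqI) (use b f mem in \<open>auto simp: expansion_def\<close>)
  moreover have "lnd_degree D (?t \<oplus> ?S) (L * d)"
    by (intro lnd_degree_add_lower[OF D] degree_basis[OF bW q] partial_sum_killed[OF bW] mem)
  ultimately show ?thesis by simp
qed

end

text \<open>
  A locally nilpotent derivation killing \<open>W\<close> is \<open>h\<close> times the standard one. Comparing degrees in
  \<open>D(z) = M h\<close> gives \<open>d - 1 = L d\<close>, where \<open>d\<close> is the degree of \<open>z\<close> and \<open>L d\<close> that of \<open>h\<close>, so that
  \<open>L = 0\<close> and \<open>h\<close> involves the variables of \<open>W\<close> only.
\<close>

lemma lnd_killing_W:
  assumes D: "lnd B D" and kill: "\<And>v. v \<in> W \<Longrightarrow> D (g v) = \<zero>"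
  obtains F where "F \<in> polyfun W"
    "\<And>p. p \<in> \<V> \<Longrightarrow> D (g VZ) p = M p * F p"
    "\<And>p. p \<in> \<V> \<Longrightarrow> D (g (VX i)) p = of_nat n * p VZ ^ (n - 1) * F p"
proof -
  note der = lnd_derivation[OF D]
  have u: "VX i \<in> C - {VZ}" by simp
  obtain h where h: "h \<in> carrier B"
    and Dz: "\<And>p. p \<in> \<V> \<Longrightarrow> D (g VZ) p = M p * h p"
    and Dx: "\<And>p. p \<in> \<V> \<Longrightarrow> D (g (VX i)) p = of_nat n * p VZ ^ (n - 1) * h p"
    using derivation_two_variables[OF der u kill] unfolding cofactor_x by auto
  have "\<exists>F\<in>polyfun W. \<forall>p\<in>\<V>. h p = F p"
  proof (cases "h = \<zero>")
    case True
    then show ?thesis by (intro bexI[of _ "\<lambda>_. 0"]) (auto intro: polyfun_const)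
  next
    case False
    have eq: "D (g VZ) = \<iota> M \<otimes> h" by (rule elem_eqI) (use Dz h der in auto)
    then have Dz0: "D (g VZ) \<noteq> \<zero>"
      using no_zero_divisors[OF iota_M_mem h] False iota_M_nonzero by metis
    obtain d where d: "lnd_degree D (g VZ) d"
      using lnd_degree_exists[OF D gen_mem gen_nonzero] VZ_coords by blast
    with Dz0 have "d \<noteq> 0" by (metis lnd_degree_0_iff)
    then obtain d' where d': "d = Suc d'" using not0_implies_Suc by blast
    obtain b L where b: "expansion b (Suc L) h" "\<exists>q. b L q \<noteq> 0"
      using expansion_nonzeroE[OF h False] by blast
    then have "lnd_degree D h (L * d)"
      using degree_expansion[OF D kill d _ b(1) h] d' by auto
    moreover have "lnd_degree D (\<iota> M) 0"
      using derivation_kills_polyfun[OF der M_polyfun W_subset kill] iota_M_nonzero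
      unfolding lnd_degree_0_iff by blast
    ultimately have "lnd_degree D (D (g VZ)) (0 + L * d)"
      unfolding eq by (intro lnd_degree_mult[OF D] h iota_M_mem)
    moreover have "lnd_degree D (D (g VZ)) d'" using d d' lnd_degree_derivation by simp
    ultimately have "L * d = d'" using lnd_degree_unique[OF D] by fastforce
    then have "L = 0" using d' by (cases L) auto
    then show ?thesis using b by (intro bexI[of _ "b 0"]) (auto simp: expansion_def basis_def)
  qed
  then obtain F where "F \<in> polyfun W" "\<forall>p\<in>\<V>. h p = F p" by blast
  then show thesis using that Dz Dx by simp
qed

end


section \<open>The exponentials of the replicas\<close>

context hypersurface_ring
begin

lemma alg_end_zero: "alg_end B \<phi> \<Longrightarrow> \<phi> \<zero> = \<zero>"
  unfolding zero_eq by (rule alg_end_const)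

lemma commute_on_generators:
  assumes \<phi>: "alg_end B \<phi>" and D: "derivation B D"
    and gens: "\<And>v. v \<in> C \<Longrightarrow> \<phi> (D (g v)) = D (\<phi> (g v))" and f: "f \<in> carrier B"
  shows "\<phi> (D f) = D (\<phi> f)"
  using f
proof (induction rule: carrier_induct)
  case (const c)
  show ?case unfolding alg_end_const[OF \<phi>] derivation_const[OF D] by (rule alg_end_zero[OF \<phi>])
next
  case (gen v)
  then show ?case by (rule gens)
next
  case (add f h)
  then show ?case using \<phi> D by (simp add: alg_end_add derivation_add)
next
  case (mult f h)
  then show ?case using \<phi> D by (simp add: alg_end_add alg_end_mult derivation_mult)
qed

end

context chart
begin

lemma x_relation: "g (VX i) \<otimes> \<iota> M = g VZ [^] n \<oplus> \<one>"
  by (rule elem_eqI) (auto simp: on_hypersurface)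

text \<open>
  Unless \<open>M\<close> is sent to \<open>0\<close>, this determines the value on \<open>x\<^sub>i\<close>, since the ring is a domain.
\<close>

lemma alg_end_x:
  assumes \<phi>: "alg_end B \<phi>" and p: "p \<in> \<V>"
  shows "\<phi> (g (VX i)) p * \<phi> (\<iota> M) p = \<phi> (g VZ) p ^ n + 1"
proof -
  have "\<phi> (g (VX i)) \<otimes> \<phi> (\<iota> M) = \<phi> (g VZ) [^] n \<oplus> \<one>"
    using arg_cong[OF x_relation, of \<phi>] \<phi>
    by (simp only: alg_end_mult alg_end_add alg_end_one alg_end_pow gen_mem iota_M_mem
        VX_i_coords VZ_coords pow_mem one_mem)
  from fun_cong[OF this, of p] show ?thesis using p by simp
qed

lemma alg_end_M:
  assumes \<phi>: "alg_end B \<phi>" and p: "p \<in> \<V>"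
  shows "\<phi> (\<iota> M) p = (\<Prod>v\<in>W. \<phi> (g v) p ^ \<alpha> v)"
  using alg_end_eval[OF \<phi> polyfun_W_C[OF M_polyfun] p]
  unfolding monomial_def[of W \<alpha> "\<lambda>v. \<phi> (g v) p"] .

lemma iota_image_cong:
  assumes \<phi>: "alg_end B \<phi>" and \<psi>: "alg_end B \<psi>" and F: "F \<in> polyfun W"
    and eq: "\<And>v. v \<in> W \<Longrightarrow> \<phi> (g v) = \<psi> (g v)"
  shows "\<phi> (\<iota> F) = \<psi> (\<iota> F)"
proof (rule elem_eqI)
  fix p assume p: "p \<in> \<V>"
  have "F (\<lambda>v. \<phi> (g v) p) = F (\<lambda>v. \<psi> (g v) p)"
    using F by (rule polyfun_cong) (simp add: eq)
  then show "\<phi> (\<iota> F) p = \<psi> (\<iota> F) p"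
    by (simp only: alg_end_eval[OF \<phi> polyfun_W_C[OF F] p] alg_end_eval[OF \<psi> polyfun_W_C[OF F] p])
qed (use \<phi> \<psi> F in \<open>auto intro!: alg_end_closed iota_mem\<close>)

lemma alg_end_chart_eqI:
  assumes \<phi>: "alg_end B \<phi>" and \<psi>: "alg_end B \<psi>" and M0: "\<phi> (\<iota> M) \<noteq> \<zero>"
    and W: "\<And>v. v \<in> W \<Longrightarrow> \<phi> (g v) = \<psi> (g v)" and z: "\<phi> (g VZ) = \<psi> (g VZ)"
  shows "\<phi> = \<psi>"
proof (rule alg_end_eqI[OF \<phi> \<psi>])
  have M: "\<phi> (\<iota> M) = \<psi> (\<iota> M)" by (rule iota_image_cong[OF \<phi> \<psi> M_polyfun W])
  have x: "\<phi> (g (VX i)) = \<psi> (g (VX i))"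
  proof (rule mult_cancel[of _ _ "\<phi> (\<iota> M)"])
    fix p assume p: "p \<in> \<V>"
    show "\<phi> (\<iota> M) p * \<phi> (g (VX i)) p = \<phi> (\<iota> M) p * \<psi> (g (VX i)) p"
      using alg_end_x[OF \<phi> p] alg_end_x[OF \<psi> p] z M by (simp only: mult.commute)
  qed (use \<phi> \<psi> M0 in \<open>auto intro!: alg_end_closed\<close>)
  fix v assume "v \<in> C"
  then show "\<phi> (g v) = \<psi> (g v)" using W x z by (cases "v \<in> W") auto
qed

text \<open>For the same reason, commuting with a derivation need not be checked on \<open>x\<^sub>i\<close>.\<close>

lemma commute_criterion:
  assumes \<phi>: "alg_end B \<phi>" and D: "derivation B D" and M0: "\<phi> (\<iota> M) \<noteq> \<zero>"
    and kill: "\<And>v. v \<in> W \<Longrightarrow> D (g v) = \<zero>" and kill': "\<And>v. v \<in> W \<Longrightarrow> D (\<phi> (g v)) = \<zero>"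
    and z: "\<phi> (D (g VZ)) = D (\<phi> (g VZ))" and f: "f \<in> carrier B"
  shows "\<phi> (D f) = D (\<phi> f)"
proof (rule commute_on_generators[OF \<phi> D _ f])
  note \<phi>0 = alg_end_zero[OF \<phi>]
  have DM: "D (\<iota> M) = \<zero>" by (rule derivation_kills_polyfun[OF D M_polyfun W_subset kill])
  have D\<phi>M: "D (\<phi> (\<iota> M)) = \<zero>"
    by (rule derivation_kills_image[OF D \<phi> M_polyfun W_subset]) (rule kill')
  have mem: "\<phi> (\<iota> M) \<in> carrier B" "\<phi> (g (VX i)) \<in> carrier B" "\<phi> (g VZ) \<in> carrier B"
    by (rule alg_end_closed[OF \<phi>], simp only: iota_M_mem gen_mem VX_i_coords VZ_coords)+
  have x: "\<phi> (D (g (VX i))) = D (\<phi> (g (VX i)))"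
  proof (rule mult_cancel[OF _ _ mem(1) M0])
    fix p assume p: "p \<in> \<V>"
    have "D (g (VX i)) \<otimes> \<iota> M = D (g (VX i) \<otimes> \<iota> M)"
      unfolding derivation_mult[OF D gen_mem[OF VX_i_coords] iota_M_mem] DM using D by simp
    also have "\<dots> = D (g VZ [^] n)"
      unfolding x_relation using D by (simp add: derivation_add[OF D])
    also have "\<dots> = of_nat n \<odot> (g VZ [^] (n - 1) \<otimes> D (g VZ))"
      by (rule elem_eqI) (use D in \<open>auto simp: derivation_pow\<close>)
    finally have "\<phi> (D (g (VX i)) \<otimes> \<iota> M) = \<phi> (of_nat n \<odot> (g VZ [^] (n - 1) \<otimes> D (g VZ)))" by (rule arg_cong)
    then have "\<phi> (D (g (VX i))) \<otimes> \<phi> (\<iota> M) = of_nat n \<odot> (\<phi> (g VZ) [^] (n - 1) \<otimes> D (\<phi> (g VZ)))"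
      using \<phi> D by (simp only: alg_end_mult alg_end_smult alg_end_pow z derivation_mem gen_mem iota_M_mem
          VX_i_coords VZ_coords pow_mem mult_mem')
    from fun_cong[OF this, of p]
    have 1: "\<phi> (D (g (VX i))) p * \<phi> (\<iota> M) p = of_nat n * \<phi> (g VZ) p ^ (n - 1) * D (\<phi> (g VZ)) p"
      using p by simp
    have "\<phi> (g (VX i)) \<otimes> \<phi> (\<iota> M) = \<phi> (g VZ) [^] n \<oplus> \<one>"
      by (rule elem_eqI) (use mem alg_end_x[OF \<phi>] in auto)
    then have "D (\<phi> (g (VX i)) \<otimes> \<phi> (\<iota> M)) = D (\<phi> (g VZ) [^] n \<oplus> \<one>)" by (rule arg_cong)
    then have "D (\<phi> (g (VX i))) \<otimes> \<phi> (\<iota> M) = D (\<phi> (g VZ) [^] n)"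
      unfolding derivation_mult[OF D mem(2,1)] D\<phi>M derivation_add[OF D pow_mem[OF mem(3)] one_mem]
      using D mem by simp
    from fun_cong[OF this, of p]
    have 2: "D (\<phi> (g (VX i))) p * \<phi> (\<iota> M) p = of_nat n * \<phi> (g VZ) p ^ (n - 1) * D (\<phi> (g VZ)) p"
      using p derivation_pow[OF D mem(3) p] by simp
    show "\<phi> (\<iota> M) p * \<phi> (D (g (VX i))) p = \<phi> (\<iota> M) p * D (\<phi> (g (VX i))) p"
      using 1 2 by (simp only: mult.commute)
  qed (use \<phi> D mem in auto)
  fix v assume "v \<in> C"
  then show "\<phi> (D (g v)) = D (\<phi> (g v))" using kill kill' \<phi>0 x z by (cases "v \<in> W") auto
qed

end

locale standard_lnd = chart k m n a B i
  for k m n :: nat and a :: "nat \<Rightarrow> nat"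
    and B :: "('k::{alg_closed_field, field_char_0}, (coord \<Rightarrow> 'k) \<Rightarrow> 'k) module" (structure)
    and i :: nat +
  fixes \<delta> :: "((coord \<Rightarrow> 'k) \<Rightarrow> 'k) \<Rightarrow> ((coord \<Rightarrow> 'k) \<Rightarrow> 'k)" and c :: 'k
  assumes lnd_\<delta>: "lnd B \<delta>" and c_nonzero: "c \<noteq> 0"
    and kills_W: "v \<in> W \<Longrightarrow> \<delta> (g v) = \<zero>"
    and \<delta>_z: "p \<in> \<V> \<Longrightarrow> \<delta> (g VZ) p = c * M p"
    and \<delta>_x: "p \<in> \<V> \<Longrightarrow> \<delta> (g (VX i)) p = of_nat n * c * p VZ ^ (n - 1)"
begin

lemma der_\<delta>: "derivation B \<delta>" by (rule lnd_derivation[OF lnd_\<delta>])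

lemma \<delta>_mem [simp]: "f \<in> carrier B \<Longrightarrow> \<delta> f \<in> carrier B"
  by (rule derivation_mem[OF der_\<delta>])

lemma \<delta>_iota: "F \<in> polyfun W \<Longrightarrow> \<delta> (\<iota> F) = \<zero>"
  by (rule derivation_kills_polyfun[OF der_\<delta> _ W_subset kills_W])

lemma \<delta>_z_eq: "\<delta> (g VZ) = c \<odot> \<iota> M"
  by (rule elem_eqI) (auto simp: \<delta>_z intro: smult_mem)

lemma \<delta>_\<delta>_z: "\<delta> (\<delta> (g VZ)) = \<zero>"
proof -
  have "\<delta> (c \<odot> \<iota> M) = c \<odot> \<zero>"
    unfolding derivation_smult[OF der_\<delta> iota_M_mem] \<delta>_iota[OF M_polyfun] ..
  also have "\<dots> = \<zero>" by (rule elem_eqI) auto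
  finally show ?thesis unfolding \<delta>_z_eq .
qed

lemma degree_z: "lnd_degree \<delta> (g VZ) 1"
proof -
  obtain p where p: "p \<in> \<V>" "\<And>v. v \<in> C \<Longrightarrow> p v \<noteq> 0" using generic_point by blast
  then have "M p \<noteq> 0" by (simp add: monomial_def)
  then have "\<delta> (g VZ) \<noteq> \<zero>" using nonzero_at[of "\<delta> (g VZ)" p] \<delta>_z c_nonzero p by simp
  then show ?thesis using \<delta>_\<delta>_z by (simp add: lnd_degree_def)
qed

lemma degree_expansion_\<delta>:
  assumes "expansion b (Suc L) f" "f \<in> carrier B" "b L q \<noteq> 0"
  shows "lnd_degree \<delta> f L"
  using degree_expansion[OF lnd_\<delta> kills_W degree_z _ assms] by simp

text \<open>
  The degree is the index of the leading coefficient, so \<open>\<delta>\<^sup>2 f = 0\<close> leaves the coefficients with indices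
  \<open>0\<close> and \<open>1\<close>. The basis elements with these indices are \<open>1\<close> and, as \<open>n \<ge> 2\<close>, \<open>z\<close>.
\<close>

lemma \<delta>_\<delta>_zeroE:
  assumes f: "f \<in> carrier B" and 0: "\<delta> (\<delta> f) = \<zero>"
  obtains F0 F1 where "F0 \<in> polyfun W" "F1 \<in> polyfun W" "\<And>p. p \<in> \<V> \<Longrightarrow> f p = F0 p + F1 p * p VZ"
    "\<delta> f = \<zero> \<Longrightarrow> F1 = (\<lambda>_. 0)"
proof (cases "f = \<zero>")
  case True
  then show thesis using that[of "\<lambda>_. 0" "\<lambda>_. 0"] by (auto intro: polyfun_const)
next
  case False
  obtain b L q where b: "expansion b (Suc L) f" "b L q \<noteq> 0"
    using expansion_nonzeroE[OF f False] by metis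
  have deg: "lnd_degree \<delta> f L" by (rule degree_expansion_\<delta>[where q = q, OF b(1) f b(2)])
  have bW: "b N \<in> polyfun W" for N using b by (auto simp: expansion_def)
  have "L \<le> 1"
  proof (rule ccontr)
    assume "\<not> L \<le> 1"
    then have "2 \<le> L" by simp
    moreover have "(\<delta> ^^ 2) f = \<zero>" using 0 by (simp add: numeral_2_eq_2)
    ultimately have "(\<delta> ^^ L) f = \<zero>" using derivation_iter_zero_mono[OF der_\<delta>] by blast
    then show False using deg by (simp add: lnd_degree_def)
  qed
  then consider "L = 0" | "L = 1" by linarith
  then show thesis
  proof cases
    case 1
    then show thesis using that[of "b 0" "\<lambda>_. 0"] b(1) bW
      by (auto simp: expansion_def basis_def intro: polyfun_const)
  next
    case 2
    have "\<delta> f \<noteq> \<zero>" using deg 2 by (simp add: lnd_degree_def)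
    moreover have "basis 1 p = p VZ" "basis 0 p = 1" for p :: "coord \<Rightarrow> 'k"
      using n_ge by (auto simp: basis_def)
    ultimately show thesis using that[of "b 0" "b 1"] b(1) bW 2
      by (auto simp: expansion_def)
  qed
qed

lemma kernelE:
  assumes f: "f \<in> carrier B" and 0: "\<delta> f = \<zero>"
  obtains F where "F \<in> polyfun W" "f = \<iota> F"
proof -
  have "\<delta> (\<delta> f) = \<zero>" using 0 der_\<delta> by simp
  then obtain F0 F1 where F: "F0 \<in> polyfun W" "\<And>p. p \<in> \<V> \<Longrightarrow> f p = F0 p + F1 p * p VZ"
    "F1 = (\<lambda>_. 0)" using \<delta>_\<delta>_zeroE[OF f] 0 by metis
  then have "f = \<iota> F0" by (intro elem_eqI f iota_mem) auto
  then show thesis using that F by blast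
qed

text \<open>
  The multiples of \<open>\<delta>\<close> by elements of its kernel are known as its replicas.
\<close>

definition replica :: "((coord \<Rightarrow> 'k) \<Rightarrow> 'k) \<Rightarrow> ((coord \<Rightarrow> 'k) \<Rightarrow> 'k) \<Rightarrow> ((coord \<Rightarrow> 'k) \<Rightarrow> 'k)" where
  "replica F = (\<lambda>f\<in>carrier B. \<iota> F \<otimes> \<delta> f)"

lemma eval_replica: "f \<in> carrier B \<Longrightarrow> p \<in> \<V> \<Longrightarrow> replica F f p = F p * \<delta> f p"
  by (simp add: replica_def)

lemma derivation_replica: assumes F: "F \<in> polyfun W" shows "derivation B (replica F)"
  unfolding derivation_def
proof (intro conjI ballI allI)
  note mem = iota_mem[OF F]
  have R: "replica F f \<in> carrier B" if "f \<in> carrier B" for f using that mem by (simp add: replica_def del: restrict_apply add: restrict_apply')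
  then show "replica F \<in> carrier B \<rightarrow>\<^sub>E carrier B" by (auto simp: replica_def)
  fix f assume f: "f \<in> carrier B"
  show "replica F (c \<odot> f) = c \<odot> replica F f" for c
    by (rule elem_eqI) (use R f in \<open>auto simp: eval_replica derivation_smult[OF der_\<delta>]\<close>)
  fix h assume h: "h \<in> carrier B"
  show "replica F (f \<oplus> h) = replica F f \<oplus> replica F h"
    by (rule elem_eqI) (use R f h in \<open>auto simp: eval_replica derivation_add[OF der_\<delta>] algebra_simps\<close>)
  show "replica F (f \<otimes> h) = replica F f \<otimes> h \<oplus> f \<otimes> replica F h"
    by (rule elem_eqI) (use R f h in \<open>auto simp: eval_replica derivation_mult[OF der_\<delta>] algebra_simps\<close>)
qed

lemma \<delta>_mult_kernel:
  assumes F: "F \<in> polyfun W" and f: "f \<in> carrier B"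
  shows "\<delta> (\<iota> F \<otimes> f) = \<iota> F \<otimes> \<delta> f"
  unfolding derivation_mult[OF der_\<delta> iota_mem[OF F] f] \<delta>_iota[OF F] using f F iota_mem[OF F] by simp

text \<open>
  Since \<open>\<delta>\<close> kills \<open>F\<close>, the iterates of \<open>F\<delta>\<close> are \<open>F\<^sup>j \<delta>\<^sup>j\<close>.
\<close>

lemma lnd_replica: assumes F: "F \<in> polyfun W" shows "lnd B (replica F)"
  unfolding lnd_def
proof (intro conjI ballI derivation_replica F)
  fix f assume f: "f \<in> carrier B"
  note memF = iota_mem[OF F] and memd = derivation_funpow_mem[OF der_\<delta> f]
  have iter: "(replica F ^^ j) f = \<iota> (\<lambda>p. F p ^ j) \<otimes> (\<delta> ^^ j) f" for j
  proof (induction j)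
    case 0
    have "(\<lambda>p\<in>\<V>. F p ^ 0) \<otimes> f \<in> carrier B" by (intro mult_mem' iota_mem polyfun_pow F f)
    from elem_eqI[OF f this] have "f = (\<lambda>p\<in>\<V>. F p ^ 0) \<otimes> f" by simp
    then show ?case by (simp only: funpow_0)
  next
    case (Suc j)
    note Fj = polyfun_pow[OF F, of j]
    have "(replica F ^^ Suc j) f = replica F (\<iota> (\<lambda>p. F p ^ j) \<otimes> (\<delta> ^^ j) f)"
      by (simp only: funpow.simps comp_apply Suc)
    also have "\<dots> = \<iota> F \<otimes> \<delta> (\<iota> (\<lambda>p. F p ^ j) \<otimes> (\<delta> ^^ j) f)"
      unfolding replica_def by (rule restrict_apply'[OF mult_mem'[OF iota_mem[OF Fj] memd]])
    also have "\<dots> = \<iota> F \<otimes> (\<iota> (\<lambda>p. F p ^ j) \<otimes> (\<delta> ^^ Suc j) f)"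
      unfolding \<delta>_mult_kernel[OF Fj memd] by (simp only: funpow.simps comp_apply)
    also have "\<dots> = \<iota> (\<lambda>p. F p ^ Suc j) \<otimes> (\<delta> ^^ Suc j) f"
      by (auto simp: mult_eq)
    finally show ?case .
  qed
  obtain N where N: "(\<delta> ^^ N) f = \<zero>" using lnd_\<delta> f by (auto simp: lnd_def)
  show "\<exists>N. (replica F ^^ N) f = \<zero>"
    by (rule exI[of _ N]) (unfold iter N, rule mult_zero(1)[OF iota_mem[OF polyfun_pow[OF F]]])
qed

lemma der_kernel_replica:
  assumes F: "F \<in> polyfun W" and "F q \<noteq> 0"
  shows "der_kernel B (replica F) = der_kernel B \<delta>"
proof -
  have F0: "\<iota> F \<noteq> \<zero>" by (rule iota_nonzero[where q = q, OF assms])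
  have "replica F f = \<zero> \<longleftrightarrow> \<delta> f = \<zero>" if f: "f \<in> carrier B" for f
  proof -
    have eq: "replica F f = \<iota> F \<otimes> \<delta> f" unfolding replica_def by (rule restrict_apply'[OF f])
    have "\<iota> F \<otimes> \<delta> f = \<zero> \<longleftrightarrow> \<delta> f = \<zero>"
      using no_zero_divisors[OF iota_mem[OF F] \<delta>_mem[OF f]] F0 mult_zero(1)[OF iota_mem[OF F]]
      by metis
    then show ?thesis unfolding eq .
  qed
  then show ?thesis by (auto simp: der_kernel_def)
qed

text \<open>
  A derivation equivalent to \<open>\<delta>\<close> kills \<open>W\<close> and is thus a multiple of \<open>\<delta>\<close>, by \<open>lnd_killing_W\<close>. Conversely
  \<open>F\<delta>\<close> has the same kernel as \<open>\<delta>\<close> unless \<open>F = 0\<close>, which accounts for the zero derivation.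
\<close>

lemma unipotent_aut_eq: "unipotent_aut B \<delta> = {lnd_exp B (replica F) | F. F \<in> polyfun W}"
proof (intro equalityI subsetI)
  fix \<phi> assume "\<phi> \<in> unipotent_aut B \<delta>"
  then obtain E where \<phi>: "\<phi> = lnd_exp B E" and E: "lnd B E"
    and eq: "equivalent_lnds B E \<delta> \<or> E = zero_map B" by (auto simp: unipotent_aut_def)
  have kill: "E (g v) = \<zero>" if v: "v \<in> W" for v
  proof -
    have gv: "g v \<in> carrier B" using v by simp
    have "g v \<in> der_kernel B \<delta>" using kills_W[OF v] gv by (simp add: der_kernel_def)
    then show ?thesis using eq gv by (auto simp: equivalent_lnds_def der_kernel_def zero_map_def)
  qed
  obtain F where F: "F \<in> polyfun W" "\<And>p. p \<in> \<V> \<Longrightarrow> E (g VZ) p = M p * F p"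
    "\<And>p. p \<in> \<V> \<Longrightarrow> E (g (VX i)) p = of_nat n * p VZ ^ (n - 1) * F p"
    using lnd_killing_W[OF E kill] by blast
  define F' where "F' p = inverse c * F p" for p
  have F': "F' \<in> polyfun W" unfolding F'_def[abs_def] by (rule polyfun_scale[OF F(1)])
  have gens: "E (g v) p = F' p * \<delta> (g v) p" if v: "v \<in> C" and p: "p \<in> \<V>" for v p
  proof -
    consider "v \<in> W" | "v = VX i" | "v = VZ" using v by blast
    then show ?thesis
    proof cases
      case 1
      then show ?thesis using kill kills_W p by simp
    next
      case 2
      then show ?thesis using F(3)[OF p] \<delta>_x[OF p] c_nonzero by (simp add: F'_def field_simps)
    next
      case 3
      then show ?thesis using F(2)[OF p] \<delta>_z[OF p] c_nonzero by (simp add: F'_def field_simps)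
    qed
  qed
  have "E = replica F'"
  proof (rule extensionalityI[of _ "carrier B"])
    show "E \<in> extensional (carrier B)" "replica F' \<in> extensional (carrier B)"
      using lnd_derivation[OF E] derivation_replica[OF F'] by (auto simp: derivation_def PiE_def)
    fix f assume f: "f \<in> carrier B"
    show "E f = replica F' f"
    proof (rule elem_eqI)
      show "E f \<in> carrier B" "replica F' f \<in> carrier B"
        using derivation_mem[OF lnd_derivation[OF E] f] derivation_mem[OF derivation_replica[OF F'] f] by auto
      show "E f p = replica F' f p" if "p \<in> \<V>" for p
        using derivation_scaled[OF der_\<delta> lnd_derivation[OF E] gens f that] eval_replica[OF f that] by simp
    qed
  qed
  then show "\<phi> \<in> {lnd_exp B (replica F) | F. F \<in> polyfun W}" using \<phi> F' by blast
next
  fix \<phi> assume "\<phi> \<in> {lnd_exp B (replica F) | F. F \<in> polyfun W}"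
  then obtain F where \<phi>: "\<phi> = lnd_exp B (replica F)" and F: "F \<in> polyfun W" by blast
  have "equivalent_lnds B (replica F) \<delta> \<or> replica F = zero_map B"
  proof (cases "\<exists>q. F q \<noteq> 0")
    case True
    then show ?thesis using der_kernel_replica[OF F] lnd_replica[OF F] lnd_\<delta>
      by (auto simp: equivalent_lnds_def)
  next
    case False
    have "replica F f = zero_map B f" if f: "f \<in> carrier B" for f
      by (rule elem_eqI) (use f False derivation_mem[OF derivation_replica[OF F] f] in
          \<open>auto simp: eval_replica zero_map_def\<close>)
    then have "replica F = zero_map B"
      by (intro extensionalityI[of _ "carrier B"]) (auto simp: replica_def zero_map_def)
    then show ?thesis by blast
  qed
  then show "\<phi> \<in> unipotent_aut B \<delta>" using \<phi> lnd_replica[OF F] by (auto simp: unipotent_aut_def)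
qed

abbreviation U :: "((coord \<Rightarrow> 'k) \<Rightarrow> 'k) \<Rightarrow> ((coord \<Rightarrow> 'k) \<Rightarrow> 'k) \<Rightarrow> ((coord \<Rightarrow> 'k) \<Rightarrow> 'k)" where
  "U F \<equiv> lnd_exp B (replica F)"

lemma alg_end_U: "F \<in> polyfun W \<Longrightarrow> alg_end B (U F)"
  by (rule alg_end_lnd_exp[OF lnd_replica lnd_exp_mem[OF lnd_replica]])

text \<open>
  The exponential series stops after the linear term. This covers the kernel and \<open>z\<close>, hence
  determines the exponential.
\<close>

lemma U_linear:
  assumes F: "F \<in> polyfun W" and f: "f \<in> carrier B" and 0: "\<delta> (\<delta> f) = \<zero>" and p: "p \<in> \<V>"
  shows "U F f p = f p + F p * \<delta> f p"
proof -
  note R = lnd_replica[OF F]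
  have "replica F (replica F f) = \<iota> F \<otimes> \<delta> (\<iota> F \<otimes> \<delta> f)"
    unfolding replica_def using f iota_mem[OF F]
    by (simp only: restrict_apply' mult_mem' \<delta>_mem)
  also have "\<dots> = \<iota> F \<otimes> (\<iota> F \<otimes> \<zero>)" unfolding \<delta>_mult_kernel[OF F \<delta>_mem[OF f]] 0 ..
  also have "\<dots> = \<zero>" using iota_mem[OF F] by (simp only: mult_zero zero_mem)
  finally have RR: "(replica F ^^ 2) f = \<zero>" by (simp add: numeral_2_eq_2)
  have "flow (replica F) f p = [:f p, replica F f p:]"
  proof (rule poly_eqI)
    fix j
    show "coeff (flow (replica F) f p) j = coeff [:f p, replica F f p:] j"
    proof (cases "j < 2")
      case True
      then consider "j = 0" | "j = 1" by linarith
      then show ?thesis by cases (auto simp: coeff_flow[OF R f p])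
    next
      case False
      then have "(replica F ^^ j) f = \<zero>" by (intro derivation_iter_zero_mono[OF derivation_replica[OF F] RR]) simp
      moreover obtain j' where "j = Suc (Suc j')" using False by (metis Suc_diff_Suc leI le_Suc_ex add_2_eq_Suc)
      ultimately show ?thesis using p by (simp add: coeff_flow[OF R f p] del: funpow.simps)
    qed
  qed
  then show ?thesis by (simp add: eval_lnd_exp[OF R f p] eval_replica[OF f p])
qed

lemma U_kernel:
  assumes F: "F \<in> polyfun W" and f: "f \<in> carrier B" and 0: "\<delta> f = \<zero>"
  shows "U F f = f"
proof (rule elem_eqI[OF alg_end_closed[OF alg_end_U[OF F] f] f])
  fix p assume p: "p \<in> \<V>"
  show "U F f p = f p" using U_linear[OF F f _ p] 0 der_\<delta> p by simp
qed

lemma U_z: "F \<in> polyfun W \<Longrightarrow> p \<in> \<V> \<Longrightarrow> U F (g VZ) p = p VZ + F p * (c * M p)"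
  using U_linear[OF _ gen_mem[OF VZ_coords] \<delta>_\<delta>_z] by (simp add: \<delta>_z)

lemma U_commutes:
  assumes F: "F \<in> polyfun W" and f: "f \<in> carrier B"
  shows "U F (\<delta> f) = \<delta> (U F f)"
proof (rule commute_criterion[OF alg_end_U[OF F] der_\<delta> _ kills_W _ _ f])
  note R = alg_end_U[OF F]
  show "U F (\<iota> M) \<noteq> \<zero>"
    unfolding U_kernel[OF F iota_M_mem \<delta>_iota[OF M_polyfun]] by (rule iota_M_nonzero)
  show "\<delta> (U F (g v)) = \<zero>" if "v \<in> W" for v
    using U_kernel[OF F gen_mem kills_W[OF that]] kills_W[OF that] that by simp
  have z: "U F (g VZ) = g VZ \<oplus> \<iota> F \<otimes> \<delta> (g VZ)"
    by (rule elem_eqI) (use U_z[OF F] \<delta>_z R iota_mem[OF F] in \<open>auto intro!: add_mem' mult_mem' alg_end_closed\<close>)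
  have "\<delta> (U F (g VZ)) = \<delta> (g VZ)"
    unfolding z derivation_add[OF der_\<delta> gen_mem[OF VZ_coords] mult_mem'[OF iota_mem[OF F] \<delta>_mem[OF gen_mem[OF VZ_coords]]]]
      \<delta>_mult_kernel[OF F \<delta>_mem[OF gen_mem[OF VZ_coords]]] \<delta>_\<delta>_z mult_zero(1)[OF iota_mem[OF F]]
    by simp
  then show "U F (\<delta> (g VZ)) = \<delta> (U F (g VZ))"
    using U_kernel[OF F \<delta>_mem[OF gen_mem[OF VZ_coords]] \<delta>_\<delta>_z] by simp
qed

lemma alg_end_compose': "alg_end B \<phi> \<Longrightarrow> alg_end B \<psi> \<Longrightarrow> alg_end B (compose (carrier B) \<phi> \<psi>)"
  by (rule alg_end_compose) auto

lemma U_add: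
  assumes F: "F \<in> polyfun W" and H: "H \<in> polyfun W"
  shows "compose (carrier B) (U F) (U H) = U (\<lambda>p. F p + H p)"
proof (rule alg_end_chart_eqI)
  note FH = polyfun_add[OF F H]
  show "alg_end B (compose (carrier B) (U F) (U H))" by (intro alg_end_compose' alg_end_U F H)
  show "alg_end B (U (\<lambda>p. F p + H p))" by (rule alg_end_U[OF FH])
  have ker: "compose (carrier B) (U F) (U H) f = f" if "f \<in> carrier B" "\<delta> f = \<zero>" for f
    using U_kernel[OF H that] U_kernel[OF F that] that by (simp add: compose_def)
  show "compose (carrier B) (U F) (U H) (\<iota> M) \<noteq> \<zero>"
    unfolding ker[OF iota_M_mem \<delta>_iota[OF M_polyfun]] by (rule iota_M_nonzero)
  show "compose (carrier B) (U F) (U H) (g v) = U (\<lambda>p. F p + H p) (g v)" if v: "v \<in> W" for v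
    using ker[OF gen_mem kills_W] U_kernel[OF FH gen_mem kills_W] v by simp
  show "compose (carrier B) (U F) (U H) (g VZ) = U (\<lambda>p. F p + H p) (g VZ)"
  proof (rule elem_eqI)
    fix p assume p: "p \<in> \<V>"
    let ?f = "U H (g VZ)"
    have fm: "?f \<in> carrier B" using alg_end_U[OF H] by simp
    have df: "\<delta> ?f = \<delta> (g VZ)"
      using U_commutes[OF H gen_mem[OF VZ_coords]] U_kernel[OF H \<delta>_mem[OF gen_mem[OF VZ_coords]] \<delta>_\<delta>_z] by simp
    then have "\<delta> (\<delta> ?f) = \<zero>" using \<delta>_\<delta>_z by simp
    then have "U F ?f p = ?f p + F p * \<delta> (g VZ) p" using U_linear[OF F fm _ p] df by simp
    then show "compose (carrier B) (U F) (U H) (g VZ) p = U (\<lambda>p. F p + H p) (g VZ) p"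
      using U_z[OF H p] U_z[OF FH p] \<delta>_z[OF p] by (simp add: compose_def algebra_simps)
  qed (use alg_end_U[OF F] alg_end_U[OF H] alg_end_U[OF FH] in \<open>auto simp: compose_def\<close>)
qed

lemma U_zero: "U (\<lambda>_. 0) = (\<lambda>f\<in>carrier B. f)"
proof -
  have Z: "(\<lambda>_. 0 :: 'k) \<in> polyfun W" by (rule polyfun_const)
  have 0: "replica (\<lambda>_. 0) f = \<zero>" if "f \<in> carrier B" for f
    by (rule elem_eqI)
      (use that derivation_mem[OF derivation_replica[OF Z] that] in \<open>auto simp: eval_replica\<close>)
  show ?thesis
  proof (rule extensionalityI[of _ "carrier B"])
    fix f assume f: "f \<in> carrier B"
    have "U (\<lambda>_. 0) f = f"
    proof (rule elem_eqI[OF alg_end_closed[OF alg_end_U[OF Z] f] f])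
      fix p assume p: "p \<in> \<V>"
      have "U (\<lambda>_. 0) f p = poly (flow (replica (\<lambda>_. 0)) f p) 1"
        by (rule eval_lnd_exp[OF lnd_replica[OF Z] f p])
      also have "flow (replica (\<lambda>_. 0)) f p = [:f p:]"
        by (rule flow_const[where D = "replica (\<lambda>_. 0)", OF lnd_replica[OF Z] f 0[OF f] p])
      also have "poly [:f p:] 1 = f p" by simp
      finally show "U (\<lambda>_. 0) f p = f p" .
    qed
    then show "U (\<lambda>_. 0) f = (\<lambda>f\<in>carrier B. f) f" using f by simp
  qed (auto simp: lnd_exp_def)
qed

lemma U_aut: assumes F: "F \<in> polyfun W" shows "U F \<in> alg_aut B"
proof -
  define F' where "F' p = (- 1) * F p" for p
  have F': "F' \<in> polyfun W" unfolding F'_def[abs_def] by (rule polyfun_scale[OF F])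
  have "compose (carrier B) (U F) (U F') = (\<lambda>f\<in>carrier B. f)"
    "compose (carrier B) (U F') (U F) = (\<lambda>f\<in>carrier B. f)"
    using U_add[OF F F'] U_add[OF F' F] U_zero by (simp_all add: F'_def)
  then have inv: "U F (U F' f) = f" "U F' (U F f) = f" if "f \<in> carrier B" for f
    using compose_eq[OF that, of "U F" "U F'"] compose_eq[OF that, of "U F'" "U F"] that by simp_all
  have "bij_betw (U F) (carrier B) (carrier B)"
    by (rule bij_betw_byWitness[where f' = "U F'"])
      (use inv alg_end_U[OF F] alg_end_U[OF F'] in auto)
  then show ?thesis using alg_end_U[OF F] by (simp add: alg_aut_iff)
qed

end


section \<open>Groups of automorphisms\<close>

context hypersurface_ring
begin

lemma alg_autD:
  assumes "\<phi> \<in> alg_aut B"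
  shows "alg_end B \<phi>" "bij_betw \<phi> (carrier B) (carrier B)" "\<phi> \<in> Bij (carrier B)"
  using assms by (auto simp: alg_aut_iff Bij_def alg_end_def PiE_def)

lemma alg_end_inverse:
  assumes \<phi>: "\<phi> \<in> alg_aut B" and \<psi>: "\<psi> \<in> carrier B \<rightarrow>\<^sub>E carrier B"
    and inv: "\<And>f. f \<in> carrier B \<Longrightarrow> \<phi> (\<psi> f) = f"
  shows "\<psi> \<in> alg_aut B"
proof -
  note endo = alg_autD(1)[OF \<phi>]
  have inj: "f = h" if "f \<in> carrier B" "h \<in> carrier B" "\<phi> f = \<phi> h" for f h
    using alg_autD(2)[OF \<phi>] that by (auto simp: bij_betw_def dest: inj_onD)
  have mem: "\<psi> f \<in> carrier B" if "f \<in> carrier B" for f using \<psi> that by auto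
  have "alg_end B \<psi>"
    unfolding alg_end_def
  proof (intro conjI ballI allI)
    show "\<psi> \<in> carrier B \<rightarrow>\<^sub>E carrier B" by (rule \<psi>)
    show "\<psi> \<one> = \<one>" by (rule inj) (use mem inv endo in \<open>auto simp: alg_end_one\<close>)
    fix f assume f: "f \<in> carrier B"
    show "\<psi> (c \<odot> f) = c \<odot> \<psi> f" for c
      by (rule inj) (use f mem inv endo in \<open>auto simp: alg_end_smult\<close>)
    fix h assume h: "h \<in> carrier B"
    show "\<psi> (f \<oplus> h) = \<psi> f \<oplus> \<psi> h"
      by (rule inj) (use f h mem inv endo in \<open>auto simp: alg_end_add\<close>)
    show "\<psi> (f \<otimes> h) = \<psi> f \<otimes> \<psi> h"
      by (rule inj) (use f h mem inv endo in \<open>auto simp: alg_end_mult\<close>)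
  qed
  moreover have "\<psi> (\<phi> f) = f" if "f \<in> carrier B" for f
    by (rule inj) (use that mem inv endo in auto)
  then have "bij_betw \<psi> (carrier B) (carrier B)"
    by (intro bij_betw_byWitness[where f' = \<phi>]) (use inv mem endo in auto)
  ultimately show ?thesis by (simp add: alg_aut_iff)
qed

lemma alg_aut_compose:
  assumes "\<phi> \<in> alg_aut B" "\<psi> \<in> alg_aut B"
  shows "compose (carrier B) \<phi> \<psi> \<in> alg_aut B"
proof -
  have "alg_end B (compose (carrier B) \<phi> \<psi>)"
    using alg_autD(1)[OF assms(1)] alg_autD(1)[OF assms(2)] by (intro alg_end_compose) auto
  moreover have "bij_betw (compose (carrier B) \<phi> \<psi>) (carrier B) (carrier B)"
    using alg_autD(2)[OF assms(1)] alg_autD(2)[OF assms(2)] by (metis bij_betw_compose)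
  ultimately show ?thesis by (simp add: alg_aut_iff)
qed

lemma alg_aut_id: "(\<lambda>f\<in>carrier B. f) \<in> alg_aut B"
  using alg_end_id by (auto simp: alg_aut_iff bij_betw_def inj_on_def)

lemma subgroup_centralizer:
  assumes D: "derivation B D"
  shows "subgroup (aut_centralizer B D) (BijGroup (carrier B))"
proof (rule group.subgroupI[OF group_BijGroup])
  show "aut_centralizer B D \<subseteq> carrier (BijGroup (carrier B))"
    using alg_autD(3) by (auto simp: aut_centralizer_def BijGroup_def)
  have "(\<lambda>f\<in>carrier B. f) \<in> aut_centralizer B D"
    using alg_aut_id D by (auto simp: aut_centralizer_def)
  then show "aut_centralizer B D \<noteq> {}" by blast
next
  fix \<phi> assume "\<phi> \<in> aut_centralizer B D"
  then have \<phi>: "\<phi> \<in> alg_aut B" and com: "\<And>f. f \<in> carrier B \<Longrightarrow> \<phi> (D f) = D (\<phi> f)"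
    by (auto simp: aut_centralizer_def)
  define \<psi> where "\<psi> = (\<lambda>f\<in>carrier B. inv_into (carrier B) \<phi> f)"
  have eq: "inv\<^bsub>BijGroup (carrier B)\<^esub> \<phi> = \<psi>"
    unfolding \<psi>_def by (rule inv_BijGroup[OF alg_autD(3)[OF \<phi>]])
  have mem: "\<psi> f \<in> carrier B" if "f \<in> carrier B" for f
    using that alg_autD(3)[OF \<phi>] by (simp add: \<psi>_def Bij_inv_into_mem)
  have inv: "\<phi> (\<psi> f) = f" if "f \<in> carrier B" for f
    using that alg_autD(2)[OF \<phi>] by (simp add: \<psi>_def bij_betw_inv_into_right)
  have inj: "f = h" if "f \<in> carrier B" "h \<in> carrier B" "\<phi> f = \<phi> h" for f h
    using alg_autD(2)[OF \<phi>] that by (auto simp: bij_betw_def dest: inj_onD)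
  have "\<psi> \<in> alg_aut B" 
  proof (rule alg_end_inverse[OF \<phi>])
    show "\<psi> \<in> carrier B \<rightarrow>\<^sub>E carrier B" using mem by (auto simp: PiE_iff \<psi>_def)
  qed (rule inv)
  moreover have "\<psi> (D f) = D (\<psi> f)" if f: "f \<in> carrier B" for f
  proof (rule inj)
    show "\<phi> (\<psi> (D f)) = \<phi> (D (\<psi> f))"
      using inv[OF derivation_mem[OF D f]] com[OF mem[OF f]] inv[OF f] by simp
  qed (use mem D f in simp_all)
  ultimately show "inv\<^bsub>BijGroup (carrier B)\<^esub> \<phi> \<in> aut_centralizer B D"
    unfolding eq aut_centralizer_def by blast
next
  fix \<phi> \<psi> assume "\<phi> \<in> aut_centralizer B D" "\<psi> \<in> aut_centralizer B D"
  then have \<phi>: "\<phi> \<in> alg_aut B" "\<And>f. f \<in> carrier B \<Longrightarrow> \<phi> (D f) = D (\<phi> f)"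
    and \<psi>: "\<psi> \<in> alg_aut B" "\<And>f. f \<in> carrier B \<Longrightarrow> \<psi> (D f) = D (\<psi> f)"
    by (auto simp: aut_centralizer_def)
  have "\<phi> \<otimes>\<^bsub>BijGroup (carrier B)\<^esub> \<psi> = compose (carrier B) \<phi> \<psi>"
    using alg_autD(3)[OF \<phi>(1)] alg_autD(3)[OF \<psi>(1)] by (simp add: BijGroup_def)
  moreover have "compose (carrier B) \<phi> \<psi> (D f) = D (compose (carrier B) \<phi> \<psi> f)" if "f \<in> carrier B" for f
    using that \<phi> \<psi> D alg_autD(1)[OF \<psi>(1)] by (simp add: compose_def)
  ultimately show "\<phi> \<otimes>\<^bsub>BijGroup (carrier B)\<^esub> \<psi> \<in> aut_centralizer B D"
    using alg_aut_compose[OF \<phi>(1) \<psi>(1)] by (simp add: aut_centralizer_def)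
qed

end

section \<open>Automorphisms commuting with the standard derivation\<close>

context standard_lnd
begin

abbreviation Z :: "(((coord \<Rightarrow> 'k) \<Rightarrow> 'k) \<Rightarrow> ((coord \<Rightarrow> 'k) \<Rightarrow> 'k)) set" where
  "Z \<equiv> aut_centralizer B \<delta>"

lemma centralizerD:
  assumes "\<phi> \<in> Z"
  shows "alg_end B \<phi>" "\<phi> \<in> alg_aut B" "f \<in> carrier B \<Longrightarrow> \<phi> (\<delta> f) = \<delta> (\<phi> f)"
  using assms alg_autD by (auto simp: aut_centralizer_def)

lemma centralizer_inj: "\<phi> \<in> Z \<Longrightarrow> f \<in> carrier B \<Longrightarrow> h \<in> carrier B \<Longrightarrow> \<phi> f = \<phi> h \<Longrightarrow> f = h"
  using alg_autD(2)[OF centralizerD(2)] by (auto simp: bij_betw_def dest: inj_onD)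

lemma centralizer_inverse:
  assumes \<phi>: "\<phi> \<in> Z"
  obtains \<psi> where "\<psi> \<in> Z" "\<forall>f\<in>carrier B. \<phi> (\<psi> f) = f" "\<forall>f\<in>carrier B. \<psi> (\<phi> f) = f"
proof -
  note sub = subgroup_centralizer[OF der_\<delta>]
  let ?\<psi> = "inv\<^bsub>BijGroup (carrier B)\<^esub> \<phi>"
  have eq: "?\<psi> = (\<lambda>f\<in>carrier B. inv_into (carrier B) \<phi> f)"
    by (rule inv_BijGroup[OF alg_autD(3)[OF centralizerD(2)[OF \<phi>]]])
  note bij = alg_autD(2)[OF centralizerD(2)[OF \<phi>]]
  show thesis
  proof (rule that[of ?\<psi>])
    show "?\<psi> \<in> Z" by (rule subgroup.m_inv_closed[OF sub \<phi>])
    show "\<forall>f\<in>carrier B. \<phi> (?\<psi> f) = f"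
      unfolding eq using bij by (simp add: bij_betw_inv_into_right)
    show "\<forall>f\<in>carrier B. ?\<psi> (\<phi> f) = f"
      unfolding eq using bij centralizerD(1)[OF \<phi>] by (simp add: bij_betw_inv_into_left)
  qed
qed

lemma centralizer_iota:
  assumes \<phi>: "\<phi> \<in> Z" and F: "F \<in> polyfun W"
  obtains F' where "F' \<in> polyfun W" "\<phi> (\<iota> F) = \<iota> F'"
proof -
  have "\<delta> (\<phi> (\<iota> F)) = \<phi> \<zero>" unfolding \<delta>_iota[OF F, symmetric] by (rule centralizerD(3)[OF \<phi> iota_mem[OF F], symmetric])
  also have "\<dots> = \<zero>" by (rule alg_end_zero[OF centralizerD(1)[OF \<phi>]])
  finally show thesis using kernelE[OF alg_end_closed[OF centralizerD(1)[OF \<phi>] iota_mem[OF F]]] that by blast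
qed

text \<open>
  As \<open>\<delta>\<^sup>2 z = 0\<close>, also \<open>\<delta>\<^sup>2 \<phi>(z) = 0\<close>, which makes \<open>\<phi>(z)\<close> affine in \<open>z\<close>; then \<open>\<phi>(M)\<close> is read off
  from \<open>\<phi>(\<delta>(z)) = \<delta>(\<phi>(z))\<close>.
\<close>

lemma centralizer_z_affine:
  assumes \<phi>: "\<phi> \<in> Z"
  obtains b0 b where "b0 \<in> polyfun W" "b \<in> polyfun W"
    "\<forall>p\<in>\<V>. \<phi> (g VZ) p = b0 p + b p * p VZ"
    "\<forall>p\<in>\<V>. \<phi> (\<iota> M) p = b p * M p"
proof -
  note endo = centralizerD(1)[OF \<phi>]
  have z: "\<phi> (g VZ) \<in> carrier B" using endo by simp
  have d: "\<delta> (\<phi> (g VZ)) = \<phi> (\<delta> (g VZ))" by (rule centralizerD(3)[OF \<phi> gen_mem[OF VZ_coords], symmetric])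
  have "\<delta> (\<delta> (\<phi> (g VZ))) = \<phi> (\<delta> (\<delta> (g VZ)))"
    unfolding d by (rule centralizerD(3)[OF \<phi> \<delta>_mem[OF gen_mem[OF VZ_coords]], symmetric])
  then have 0: "\<delta> (\<delta> (\<phi> (g VZ))) = \<zero>" unfolding \<delta>_\<delta>_z alg_end_zero[OF endo] .
  obtain b0 b where b: "b0 \<in> polyfun W" "b \<in> polyfun W"
    "\<And>p. p \<in> \<V> \<Longrightarrow> \<phi> (g VZ) p = b0 p + b p * p VZ"
    using \<delta>_\<delta>_zeroE[OF z 0] by metis
  note m = iota_mem[OF b(1)] iota_mem[OF b(2)]
  have eq: "\<phi> (g VZ) = \<iota> b0 \<oplus> \<iota> b \<otimes> g VZ"
    by (rule elem_eqI[OF z]) (use b(3) m in \<open>auto intro!: add_mem' mult_mem'\<close>)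
  have "\<delta> (\<iota> b0 \<oplus> \<iota> b \<otimes> g VZ) = \<delta> (\<iota> b0) \<oplus> \<iota> b \<otimes> \<delta> (g VZ)"
    unfolding derivation_add[OF der_\<delta> m(1) mult_mem'[OF m(2) gen_mem[OF VZ_coords]]]
      \<delta>_mult_kernel[OF b(2) gen_mem[OF VZ_coords]] ..
  then have "\<phi> (c \<odot> \<iota> M) = \<zero> \<oplus> \<iota> b \<otimes> \<delta> (g VZ)"
    using d unfolding eq \<delta>_iota[OF b(1)] \<delta>_z_eq[symmetric] by simp
  then have "c \<odot> \<phi> (\<iota> M) = \<zero> \<oplus> \<iota> b \<otimes> \<delta> (g VZ)"
    unfolding alg_end_smult[OF endo iota_M_mem] .
  note pointwise = fun_cong[OF this]
  have "\<phi> (\<iota> M) p = b p * M p" if p: "p \<in> \<V>" for p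
  proof -
    have "c * \<phi> (\<iota> M) p = c * (b p * M p)" using pointwise[of p] p \<delta>_z[OF p] by simp
    then show ?thesis using c_nonzero by simp
  qed
  then show thesis using that b by blast
qed

lemma iota_M_cancel:
  assumes F: "F \<in> polyfun W" and H: "H \<in> polyfun W"
    and eq: "\<And>p. p \<in> \<V> \<Longrightarrow> F p * M p = H p * M p"
  shows "F q = H q"
proof -
  have "(F q - H q) * M q = 0" for q
    using iota_eqD[OF polyfun_mult[OF F M_polyfun] polyfun_mult[OF H M_polyfun] eq, of q]
    by (simp add: algebra_simps)
  from polyfun_mult_eq_0[OF polyfun_diff[OF F H] M_polyfun this]
  consider "\<forall>p. F p - H p = 0" | "\<forall>p. M p = (0::'k)" by blast
  then show ?thesis
  proof cases
    case 2
    then have "M (\<lambda>_. 1) = (0::'k)" by blast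
    then show ?thesis by (simp add: monomial_def)
  qed simp
qed

text \<open>
  As \<open>k \<ge> 2\<close>, there is an \<open>x\<^sub>j\<close> in \<open>W\<close>, so that \<open>M\<close> is not constant.
\<close>

lemma M_zero: "M (\<lambda>_. 0) = (0 :: 'k)"
proof -
  obtain j where j: "j \<in> {1..k}" "j \<noteq> i"
    using k_ge by (metis Suc_1 atLeastAtMost_iff numeral_2_eq_2 le_refl one_le_numeral Suc_le_mono le_trans n_not_Suc_n)
  then have "VX j \<in> W" by (auto simp: coords_def)
  then show ?thesis unfolding monomial_def using exponent_pos[of "VX j"]
    by (intro prod_zero) (auto intro!: bexI[of _ "VX j"])
qed

text \<open>The slope of \<open>\<phi>(z)\<close> is invertible, its inverse being the image of the slope for \<open>\<phi>\<^sup>-\<^sup>1\<close>.\<close>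

lemma centralizer_z_slope:
  assumes \<phi>: "\<phi> \<in> Z"
  obtains b0 \<beta> where "b0 \<in> polyfun W" "\<beta> \<noteq> 0"
    "\<forall>p\<in>\<V>. \<phi> (g VZ) p = b0 p + \<beta> * p VZ"
    "\<forall>p\<in>\<V>. \<phi> (\<iota> M) p = \<beta> * M p"
proof -
  obtain b0 b where b: "b0 \<in> polyfun W" "b \<in> polyfun W"
    "\<forall>p\<in>\<V>. \<phi> (g VZ) p = b0 p + b p * p VZ"
    "\<forall>p\<in>\<V>. \<phi> (\<iota> M) p = b p * M p" by (rule centralizer_z_affine[OF \<phi>])
  note b = b[rule_format]
  obtain \<psi> where \<psi>: "\<psi> \<in> Z" "\<forall>f\<in>carrier B. \<phi> (\<psi> f) = f"
    "\<forall>f\<in>carrier B. \<psi> (\<phi> f) = f" by (rule centralizer_inverse[OF \<phi>])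
  note \<psi> = \<psi>[rule_format]
  obtain b0' b' where "b0' \<in> polyfun W" and b': "b' \<in> polyfun W"
    and "\<forall>p\<in>\<V>. \<psi> (g VZ) p = b0' p + b' p * p VZ"
    and \<psi>M: "\<forall>p\<in>\<V>. \<psi> (\<iota> M) p = b' p * M p"
    by (rule centralizer_z_affine[OF \<psi>(1)])
  note \<psi>M = \<psi>M[rule_format]
  obtain B1 where B1: "B1 \<in> polyfun W" "\<phi> (\<iota> b') = \<iota> B1" by (rule centralizer_iota[OF \<phi> b'])
  have "\<psi> (\<iota> M) = \<iota> b' \<otimes> \<iota> M"
    by (rule elem_eqI) (use \<psi>M iota_mem[OF b'] centralizerD(1)[OF \<psi>(1)] in \<open>auto intro!: alg_end_closed mult_mem'\<close>)
  then have "\<iota> M = \<phi> (\<iota> b' \<otimes> \<iota> M)" using \<psi>(2)[OF iota_M_mem] by argo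
  also have "\<dots> = \<iota> B1 \<otimes> \<phi> (\<iota> M)"
    unfolding alg_end_mult[OF centralizerD(1)[OF \<phi>] iota_mem[OF b'] iota_M_mem] B1(2) ..
  finally have eq: "\<iota> M = \<iota> B1 \<otimes> \<phi> (\<iota> M)" .
  have "1 * M p = (B1 p * b p) * M p" if "p \<in> \<V>" for p
    using fun_cong[OF eq, of p] b(4)[OF that] that by simp
  then have 1: "b p * B1 p = 1" for p
    using iota_M_cancel[OF polyfun_const[of 1] polyfun_mult[OF B1(1) b(2)], of p] by (simp add: mult.commute)
  obtain \<beta> where \<beta>: "\<beta> \<noteq> 0" "\<And>p. b p = \<beta>" using polyfun_unit_const[OF b(2) B1(1) 1] by auto
  show thesis by (rule that[OF b(1) \<beta>(1)]) (use b \<beta> in auto)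
qed

lemma expansion_coeffs_unique:
  assumes b: "expansion b L F" and b': "expansion b' L' F"
  shows "(if N < L then b N q else 0) = (if N < L' then b' N q else 0)"
proof -
  define e where "e N = (\<lambda>p. (if N < L then b N p else 0) - (if N < L' then b' N p else 0))" for N
  let ?L = "max (max L L') (Suc N)"
  have eW: "e N \<in> polyfun W" for N
    using b b' unfolding e_def expansion_def
    by (intro polyfun_diff; cases "N < L"; cases "N < L'") (auto intro: polyfun_const)
  have "(\<Sum>N<?L. e N p * basis N p) = 0" if p: "p \<in> \<V>" for p
  proof -
    have "F p = (\<Sum>N<?L. (if N < L then b N p else 0) * basis N p)"
      unfolding b[unfolded expansion_def, THEN conjunct2, rule_format, OF p]
      by (rule sum.mono_neutral_cong_left) auto
    moreover have "F p = (\<Sum>N<?L. (if N < L' then b' N p else 0) * basis N p)"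
      unfolding b'[unfolded expansion_def, THEN conjunct2, rule_format, OF p]
      by (rule sum.mono_neutral_cong_left) auto
    ultimately show ?thesis by (simp only: e_def sum_subtractf left_diff_distrib) simp
  qed
  then have "expansion e ?L (\<lambda>_. 0)" using eW by (simp add: expansion_def)
  then have "e N q = 0" by (rule expansion_unique) auto
  then show ?thesis by (simp add: e_def)
qed

text \<open>
  The equation \<open>\<phi>(x\<^sub>i) \<phi>(M) = \<phi>(z)\<^sup>n + 1\<close> with \<open>\<phi>(z) = b\<^sub>0 + \<beta>z\<close>, compared in the basis: the
  coefficient of \<open>z\<^sup>n\<^sup>-\<^sup>1\<close> shows that \<open>M\<close> divides \<open>b\<^sub>0\<close>, and the constant coefficient at the origin that
  \<open>\<beta>\<^sup>n = 1\<close>.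
\<close>

lemma centralizer_z:
  assumes \<phi>: "\<phi> \<in> Z"
  obtains h \<beta> where "h \<in> polyfun W" "\<beta> ^ n = 1" "\<beta> \<noteq> 0"
    "\<forall>p\<in>\<V>. \<phi> (g VZ) p = h p * M p + \<beta> * p VZ"
    "\<forall>p\<in>\<V>. \<phi> (\<iota> M) p = \<beta> * M p"
proof -
  note endo = centralizerD(1)[OF \<phi>]
  obtain b0 \<beta> where b0: "b0 \<in> polyfun W" and \<beta>: "\<beta> \<noteq> 0"
    and z: "\<forall>p\<in>\<V>. \<phi> (g VZ) p = b0 p + \<beta> * p VZ"
    and M: "\<forall>p\<in>\<V>. \<phi> (\<iota> M) p = \<beta> * M p" by (rule centralizer_z_slope[OF \<phi>])
  note z = z[rule_format] and M = M[rule_format]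
  have "\<phi> (g (VX i)) \<in> carrier B" using endo by simp
  then obtain q L where q: "expansion q L (\<phi> (g (VX i)))" using expansion_exists by blast
  then have qW: "q N \<in> polyfun W" for N by (auto simp: expansion_def)
  define F where "F p = \<phi> (g (VX i)) p * (\<beta> * M p)" for p
  have 1: "expansion (\<lambda>N p. \<beta> * M p * q N p) L F"
    unfolding expansion_def
  proof (intro conjI allI ballI)
    show "(\<lambda>p. \<beta> * M p * q N p) \<in> polyfun W" for N
      by (intro polyfun_mult polyfun_scale M_polyfun qW)
    fix p assume "p \<in> \<V>"
    then show "F p = (\<Sum>N<L. \<beta> * M p * q N p * basis N p)"
      using q by (simp add: F_def expansion_def sum_distrib_left sum_distrib_right ac_simps)
  qed
  \<comment> \<open>The expansion of \<open>(b\<^sub>0 + \<beta>z)\<^sup>n + 1\<close> according to the binomial theorem, where \<open>z\<^sup>n\<close> is replaced by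
     \<open>x\<^sub>i M - 1\<close> and \<open>x\<^sub>i\<close> is the basis element with index \<open>n\<close>.\<close>
  define e where "e N = (\<lambda>p. if N = n then \<beta> ^ n * M p
     else of_nat (n choose N) * \<beta> ^ N * b0 p ^ (n - N) + (if N = 0 then 1 - \<beta> ^ n else 0))" for N
  have 2: "expansion e (Suc n) F"
    unfolding expansion_def
  proof (intro conjI allI ballI)
    show "e N \<in> polyfun W" for N
    proof (cases "N = n")
      case True
      then show ?thesis by (simp add: e_def polyfun_scale M_polyfun)
    next
      case False
      then show ?thesis unfolding e_def
        by (simp only: if_False) (intro polyfun_add polyfun_mult polyfun_const polyfun_pow b0)
    qed
    fix p assume p: "p \<in> \<V>"
    have "F p = (\<beta> * p VZ + b0 p) ^ n + 1"
      using alg_end_x[OF endo p] by (simp add: F_def z[OF p] M[OF p] add.commute)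
    also have "(\<beta> * p VZ + b0 p) ^ n = (\<Sum>N\<le>n. of_nat (n choose N) * (\<beta> * p VZ) ^ N * b0 p ^ (n - N))"
      by (rule binomial_ring)
    also have "\<dots> = (\<Sum>N<n. of_nat (n choose N) * (\<beta> * p VZ) ^ N * b0 p ^ (n - N)) + \<beta> ^ n * p VZ ^ n"
      by (simp add: lessThan_Suc_atMost[symmetric] power_mult_distrib)
    also have "p VZ ^ n = M p * basis n p - 1"
      using on_hypersurface[OF p] n_ge by (simp add: basis_def algebra_simps)
    finally have F: "F p = (\<Sum>N<n. of_nat (n choose N) * (\<beta> * p VZ) ^ N * b0 p ^ (n - N))
        + (1 - \<beta> ^ n) + \<beta> ^ n * M p * basis n p" by (simp add: algebra_simps)
    have "(\<Sum>N<n. e N p * basis N p)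
        = (\<Sum>N<n. of_nat (n choose N) * (\<beta> * p VZ) ^ N * b0 p ^ (n - N) + (if N = 0 then 1 - \<beta> ^ n else 0))"
      by (rule sum.cong) (auto simp: e_def basis_def power_mult_distrib algebra_simps)
    also have "\<dots> = (\<Sum>N<n. of_nat (n choose N) * (\<beta> * p VZ) ^ N * b0 p ^ (n - N)) + (1 - \<beta> ^ n)"
      using n_ge by (simp add: sum.distrib)
    finally show "F p = (\<Sum>N<Suc n. e N p * basis N p)" unfolding F by (simp add: e_def)
  qed
  note coeffs = expansion_coeffs_unique[OF 1 2]
  define h where "h = (\<lambda>p. \<beta> / (of_nat n * \<beta> ^ (n - 1)) * (if n - 1 < L then q (n - 1) p else 0))"
  have "(\<lambda>p. if n - 1 < L then q (n - 1) p else 0) \<in> polyfun W"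
    using qW by (cases "n - 1 < L") (simp_all add: polyfun_const)
  then have hW: "h \<in> polyfun W" unfolding h_def by (rule polyfun_scale)
  have n0: "(of_nat n * \<beta> ^ (n - 1) :: 'k) \<noteq> 0" using n_ge \<beta> by simp
  have b0h: "b0 p = h p * M p" for p
  proof -
    have nc: "n choose (n - 1) = n" using n_ge by (metis binomial_symmetric choose_one diff_diff_cancel
          diff_le_self le_trans one_le_numeral)
    have "e (n - 1) p = of_nat n * \<beta> ^ (n - 1) * b0 p"
    proof -
      have "n - 1 \<noteq> n" "n - 1 \<noteq> 0" "n - (n - 1) = 1" using n_ge by auto
      then show ?thesis unfolding e_def nc by (simp only: if_False add_0_right power_one_right)
    qed
    then have "of_nat n * \<beta> ^ (n - 1) * b0 p = (if n - 1 < L then \<beta> * M p * q (n - 1) p else 0)"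
      using coeffs[of "n - 1" p] by simp
    also have "\<dots> = of_nat n * \<beta> ^ (n - 1) * (h p * M p)"
      using n0 by (simp add: h_def)
    finally show ?thesis using n0 by (metis mult_left_cancel)
  qed
  have "e 0 (\<lambda>_. 0) = 0" using coeffs[of 0 "\<lambda>_. 0"] M_zero by (simp split: if_splits)
  then have "\<beta> ^ n = 1" using n_ge b0h[of "\<lambda>_. 0"] M_zero by (simp add: e_def power_0_left)
  then show thesis using that[OF hW] \<beta> z M b0h by simp
qed

lemma power_2_eq_iff: "(2 :: 'k) ^ x = 2 ^ y \<longleftrightarrow> x = y"
proof
  assume "(2 :: 'k) ^ x = 2 ^ y"
  then have "(of_nat (2 ^ x) :: 'k) = of_nat (2 ^ y)" by simp
  then have "(2::nat) ^ x = 2 ^ y" by (simp only: of_nat_eq_iff)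
  then show "x = y" by simp
qed simp

lemma gen_W_iota: "v \<in> W \<Longrightarrow> g v = \<iota> (\<lambda>p. p v)"
  by (simp add: gen_def)

text \<open>
  The image of \<open>v\<close> divides \<open>\<phi>(M) = \<beta>M\<close>, hence is a multiple of a monomial, and it is not constant as
  \<open>\<phi>\<close> is injective.
\<close>

lemma centralizer_monomials:
  assumes \<phi>: "\<phi> \<in> Z"
  obtains r e where "\<forall>v\<in>W. r v \<noteq> 0"
    "\<forall>v\<in>W. \<forall>p\<in>\<V>. \<phi> (g v) p = r v * monomial W (e v) p"
    "\<forall>v\<in>W. (\<Sum>u\<in>W. e v u) \<ge> 1"
proof -
  note endo = centralizerD(1)[OF \<phi>]
  obtain h \<beta> where "h \<in> polyfun W" "\<beta> ^ n = 1" and \<beta>: "\<beta> \<noteq> 0"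
    and "\<forall>p\<in>\<V>. \<phi> (g VZ) p = h p * M p + \<beta> * p VZ"
    and M: "\<forall>p\<in>\<V>. \<phi> (\<iota> M) p = \<beta> * M p" by (rule centralizer_z[OF \<phi>])
  note M = M[rule_format]
  have "\<exists>F. F \<in> polyfun W \<and> \<phi> (g v) = \<iota> F" if "v \<in> W" for v
    using centralizer_iota[OF \<phi> polyfun_var[OF that]] unfolding gen_W_iota[OF that] by blast
  then obtain F where F: "\<And>v. v \<in> W \<Longrightarrow> F v \<in> polyfun W" "\<And>v. v \<in> W \<Longrightarrow> \<phi> (g v) = \<iota> (F v)" by metis
  have prod: "(\<Prod>v\<in>W. F v p ^ \<alpha> v) = \<beta> * M p" for p
  proof (rule iota_eqD[where F = "\<lambda>p. \<Prod>v\<in>W. F v p ^ \<alpha> v" and H = "\<lambda>p. \<beta> * M p"])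
    show "(\<lambda>p. \<Prod>v\<in>W. F v p ^ \<alpha> v) \<in> polyfun W" by (intro polyfun_prod polyfun_pow F)
    show "(\<lambda>p. \<beta> * M p) \<in> polyfun W" by (intro polyfun_scale M_polyfun)
    fix p assume p: "p \<in> \<V>"
    have "\<phi> (\<iota> M) p = (\<Prod>v\<in>W. F v p ^ \<alpha> v)"
      unfolding alg_end_M[OF endo p] using F(2) p by (intro prod.cong) auto
    then show "(\<Prod>v\<in>W. F v p ^ \<alpha> v) = \<beta> * M p" using M[OF p] by simp
  qed
  have "\<exists>r e. r \<noteq> 0 \<and> (\<forall>p. F v p = r * monomial W e p)" if v: "v \<in> W" for v
  proof (rule polyfun_dvd_monomial)
    show "(\<lambda>p. F v p ^ (\<alpha> v - 1) * (\<Prod>u\<in>W - {v}. F u p ^ \<alpha> u)) \<in> polyfun W"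
      by (intro polyfun_mult polyfun_prod polyfun_pow F v) auto
    fix p
    have "\<alpha> v \<ge> 1" using exponent_pos[of v] v by simp
    then have "F v p * F v p ^ (\<alpha> v - 1) = F v p ^ \<alpha> v" by (cases "\<alpha> v") auto
    then show "F v p * (F v p ^ (\<alpha> v - 1) * (\<Prod>u\<in>W - {v}. F u p ^ \<alpha> u)) = \<beta> * M p"
      using prod[of p] prod.remove[of W v "\<lambda>v. F v p ^ \<alpha> v"] v by (simp add: mult.assoc[symmetric])
  qed (use F v \<beta> in auto)
  then obtain r e where re: "\<And>v. v \<in> W \<Longrightarrow> r v \<noteq> 0" "\<And>v p. v \<in> W \<Longrightarrow> F v p = r v * monomial W (e v) p"
    by metis
  have "(\<Sum>u\<in>W. e v u) \<ge> 1" if v: "v \<in> W" for v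
  proof (rule ccontr)
    assume "\<not> ?thesis"
    then have "(\<Sum>u\<in>W. e v u) = 0" by linarith
    then have "e v u = 0" if "u \<in> W" for u using that by simp
    then have "monomial W (e v) p = 1" for p :: "coord \<Rightarrow> 'k" by (simp add: monomial_def)
    then have "\<phi> (g v) = (\<lambda>p\<in>\<V>. r v)" using F(2)[OF v] re(2)[OF v] by simp
    then have "\<phi> (g v) = \<phi> (\<lambda>p\<in>\<V>. r v)" unfolding alg_end_const[OF endo] .
    then have eq: "g v = (\<lambda>p\<in>\<V>. r v)" by (rule centralizer_inj[OF \<phi> _ const_mem, rotated]) (use v in simp)
    have "p v = r v" if "p \<in> \<V>" for p using fun_cong[OF eq, of p] that by simp
    then have "q v = r v" for q :: "coord \<Rightarrow> 'k"
      using iota_eqD[OF polyfun_var[OF v] polyfun_const[of "r v"]] by blast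
    from this[of "\<lambda>_. 0"] this[of "\<lambda>_. 1"] show False by simp
  qed
  then show thesis using that[of r e] re F(2) by simp
qed

text \<open>
  An automorphism and its inverse send variables of \<open>W\<close> to nonconstant monomials. Their composition
  multiplies total degrees, so these monomials have degree \<open>1\<close>.
\<close>

lemma centralizer_variables:
  assumes \<psi>: "\<psi> \<in> Z" and v: "v \<in> W"
  shows "\<exists>u\<in>W. \<exists>r. r \<noteq> 0 \<and> (\<forall>p\<in>\<V>. \<psi> (g v) p = r * p u)"
proof -
  obtain \<phi> where \<phi>: "\<phi> \<in> Z" "\<forall>f\<in>carrier B. \<psi> (\<phi> f) = f"
    "\<forall>f\<in>carrier B. \<phi> (\<psi> f) = f" by (rule centralizer_inverse[OF \<psi>])
  note \<phi> = \<phi>[rule_format]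
  obtain r e where re: "\<forall>v\<in>W. r v \<noteq> 0"
    "\<forall>v\<in>W. \<forall>p\<in>\<V>. \<phi> (g v) p = r v * monomial W (e v) p"
    "\<forall>v\<in>W. (\<Sum>u\<in>W. e v u) \<ge> 1" by (rule centralizer_monomials[OF \<phi>(1)])
  note re = re[rule_format]
  obtain r' e' where re': "\<forall>v\<in>W. r' v \<noteq> 0"
    "\<forall>v\<in>W. \<forall>p\<in>\<V>. \<psi> (g v) p = r' v * monomial W (e' v) p"
    "\<forall>v\<in>W. (\<Sum>u\<in>W. e' v u) \<ge> 1" by (rule centralizer_monomials[OF \<psi>])
  note re' = re'[rule_format]
  let ?P = "\<lambda>p. r' v * (\<Prod>u\<in>W. (r u * monomial W (e u) p) ^ e' v u)"
  have id: "p v = ?P p" for p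
  proof (rule iota_eqD[where F = "\<lambda>p. p v" and H = ?P])
    show "(\<lambda>p. p v) \<in> polyfun W" by (rule polyfun_var[OF v])
    show "?P \<in> polyfun W"
      by (intro polyfun_scale polyfun_prod polyfun_pow polyfun_monomial) simp
    fix p assume p: "p \<in> \<V>"
    let ?m = "\<lambda>p. r' v * monomial W (e' v) p"
    have mW: "?m \<in> polyfun W" by (intro polyfun_scale polyfun_monomial) simp
    have "\<psi> (g v) = \<iota> ?m"
      by (rule elem_eqI) (use re'(2)[OF v] v centralizerD(1)[OF \<psi>] iota_mem[OF mW] in \<open>auto intro!: alg_end_closed\<close>)
    then have "\<phi> (\<iota> ?m) = g v" using \<phi>(3)[of "g v"] v by simp
    then have "p v = \<phi> (\<iota> ?m) p" using p by simp
    also have "\<dots> = ?m (\<lambda>u. \<phi> (g u) p)" by (rule alg_end_eval[OF centralizerD(1)[OF \<phi>(1)] polyfun_W_C[OF mW] p])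
    also have "\<dots> = ?P p" unfolding monomial_def[of W "e' v"] using re(2) p by simp
    finally show "p v = ?P p" .
  qed
  define d where "d u = (\<Sum>w\<in>W. e u w)" for u
  define K where "K = r' v * (\<Prod>u\<in>W. r u ^ e' v u)"
  have fin: "finite W" by simp
  have diag: "t = K * t ^ (\<Sum>u\<in>W. d u * e' v u)" for t :: 'k
  proof -
    have "t = r' v * (\<Prod>u\<in>W. (r u * t ^ d u) ^ e' v u)"
      using id[of "\<lambda>_. t"] unfolding monomial_diagonal[OF fin] d_def .
    also have "\<dots> = r' v * ((\<Prod>u\<in>W. r u ^ e' v u) * (\<Prod>u\<in>W. t ^ (d u * e' v u)))"
      by (simp add: power_mult_distrib prod.distrib power_mult)
    finally show ?thesis by (simp add: K_def power_sum mult.assoc)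
  qed
  have "K = 1" using diag[of 1] by simp
  then have "(2 :: 'k) ^ 1 = 2 ^ (\<Sum>u\<in>W. d u * e' v u)" using diag[of 2] by simp
  then have S: "(\<Sum>u\<in>W. d u * e' v u) = 1" by (metis power_2_eq_iff)
  have "(\<Sum>u\<in>W. e' v u) \<le> (\<Sum>u\<in>W. d u * e' v u)"
    by (rule sum_mono) (use re(3) d_def in auto)
  then have 1: "(\<Sum>u\<in>W. e' v u) = 1" using S re'(3)[OF v] by simp
  have "\<exists>u\<in>W. e' v u = 1 \<and> (\<forall>w\<in>W. u \<noteq> w \<longrightarrow> e' v w = 0)"
    using 1 unfolding sum_eq_1_iff[OF fin] .
  then obtain u where u: "u \<in> W" "e' v u = 1" "\<And>w. w \<in> W \<Longrightarrow> w \<noteq> u \<Longrightarrow> e' v w = 0"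
    by metis
  have "monomial W (e' v) p = p u" for p :: "coord \<Rightarrow> 'k"
    unfolding monomial_def using prod.remove[OF fin u(1), of "\<lambda>w. p w ^ e' v w"] u by simp
  then show ?thesis using u(1) re'(1,2)[OF v] by auto
qed

definition admissible :: "(coord \<Rightarrow> coord) \<Rightarrow> bool" where
  "admissible \<sigma> \<longleftrightarrow> \<sigma> permutes W \<and> (\<forall>v\<in>W. \<alpha> (\<sigma> v) = \<alpha> v)"

text \<open>
  Injectivity of \<open>\<phi>\<close> makes the assignment of variables a permutation; evaluating \<open>\<phi>(M) = \<beta>M\<close> at the point
  with one coordinate \<open>2\<close> and the others \<open>1\<close> compares the exponents.
\<close>

lemma centralizer_permutation:
  assumes \<phi>: "\<phi> \<in> Z"
  obtains \<sigma> r where "admissible \<sigma>" "\<forall>v\<in>W. r v \<noteq> 0"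
    "\<forall>v\<in>W. \<forall>p\<in>\<V>. \<phi> (g v) p = r v * p (\<sigma> v)"
proof -
  note endo = centralizerD(1)[OF \<phi>]
  obtain s r where s: "\<And>v. v \<in> W \<Longrightarrow> s v \<in> W" "\<And>v. v \<in> W \<Longrightarrow> r v \<noteq> 0"
    "\<And>v p. v \<in> W \<Longrightarrow> p \<in> \<V> \<Longrightarrow> \<phi> (g v) p = r v * p (s v)"
    using centralizer_variables[OF \<phi>] by metis
  define \<sigma> where "\<sigma> v = (if v \<in> W then s v else v)" for v
  have \<sigma>W: "\<sigma> v = s v" if "v \<in> W" for v using that by (simp add: \<sigma>_def)
  have "inj_on \<sigma> W"
  proof (rule inj_onI)
    fix v w assume v: "v \<in> W" and w: "w \<in> W" and "\<sigma> v = \<sigma> w"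
    then have sw: "s v = s w" by (simp add: \<sigma>_def)
    have "\<phi> (r w \<odot> g v) = \<phi> (r v \<odot> g w)"
      by (rule elem_eqI) (use v w s(3) sw endo in \<open>auto simp: alg_end_smult\<close>)
    then have eq: "r w \<odot> g v = r v \<odot> g w" by (rule centralizer_inj[OF \<phi>, rotated 2]) (use v w in auto)
    have "r w * p v = r v * p w" if "p \<in> \<V>" for p using fun_cong[OF eq, of p] that by simp
    then have "r w * q v = r v * q w" for q
      using iota_eqD[OF polyfun_scale[OF polyfun_var[OF v]] polyfun_scale[OF polyfun_var[OF w]]] by blast
    from this[of "\<lambda>u. if u = w then 1 else 0"] show "v = w" using s(2)[OF v] by (auto split: if_splits)
  qed
  moreover have "\<sigma> ` W \<subseteq> W" using s(1) \<sigma>W by auto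
  ultimately have "bij_betw \<sigma> W W" by (simp add: bij_betw_def endo_inj_surj)
  then have perm: "\<sigma> permutes W" by (rule bij_imp_permutes) (unfold \<sigma>_def, auto)
  obtain h \<beta> where "h \<in> polyfun W" "\<beta> ^ n = 1" and \<beta>: "\<beta> \<noteq> 0"
    and "\<forall>p\<in>\<V>. \<phi> (g VZ) p = h p * M p + \<beta> * p VZ"
    and M: "\<forall>p\<in>\<V>. \<phi> (\<iota> M) p = \<beta> * M p" by (rule centralizer_z[OF \<phi>])
  note M = M[rule_format]
  have prod: "(\<Prod>v\<in>W. (r v * p (s v)) ^ \<alpha> v) = \<beta> * M p" for p
  proof (rule iota_eqD[where F = "\<lambda>p. \<Prod>v\<in>W. (r v * p (s v)) ^ \<alpha> v" and H = "\<lambda>p. \<beta> * M p"])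
    show "(\<lambda>p. \<Prod>v\<in>W. (r v * p (s v)) ^ \<alpha> v) \<in> polyfun W"
      by (intro polyfun_prod polyfun_pow polyfun_scale polyfun_var s(1))
    show "(\<lambda>p. \<beta> * M p) \<in> polyfun W" by (intro polyfun_scale M_polyfun)
    fix p assume p: "p \<in> \<V>"
    have "\<phi> (\<iota> M) p = (\<Prod>v\<in>W. (r v * p (s v)) ^ \<alpha> v)"
      unfolding alg_end_M[OF endo p] using s(3) p by (intro prod.cong) auto
    then show "(\<Prod>v\<in>W. (r v * p (s v)) ^ \<alpha> v) = \<beta> * M p" using M[OF p] by simp
  qed
  have "\<alpha> (\<sigma> w) = \<alpha> w" if w: "w \<in> W" for w
  proof -
    let ?q = "\<lambda>u. if u = \<sigma> w then 2 else (1 :: 'k)"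
    have fin: "finite W" by simp
    have R: "(\<Prod>v\<in>W. r v ^ \<alpha> v) = \<beta>" using prod[of "\<lambda>_. 1"] by (simp add: monomial_def)
    have "s v = \<sigma> w \<longleftrightarrow> v = w" if "v \<in> W" for v
      using that w perm \<sigma>W by (metis permutes_inj_on inj_onD UNIV_I permutes_inj)
    then have "(\<Prod>v\<in>W. ?q (s v) ^ \<alpha> v) = (\<Prod>v\<in>W. if v = w then 2 ^ \<alpha> v else 1)"
      by (intro prod.cong) auto
    then have L: "(\<Prod>v\<in>W. ?q (s v) ^ \<alpha> v) = 2 ^ \<alpha> w" using w fin by simp
    have "M ?q = (\<Prod>v\<in>W. if v = \<sigma> w then 2 ^ \<alpha> v else 1)" unfolding monomial_def by (intro prod.cong) auto
    then have "M ?q = 2 ^ \<alpha> (\<sigma> w)" using s(1)[OF w] \<sigma>W[OF w] fin by simp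
    then have "\<beta> * 2 ^ \<alpha> w = \<beta> * 2 ^ \<alpha> (\<sigma> w)"
      using prod[of ?q] unfolding power_mult_distrib prod.distrib R L by simp
    then show ?thesis using \<beta> power_2_eq_iff by simp
  qed
  then have "admissible \<sigma>" using perm by (simp add: admissible_def)
  then show thesis using that[of \<sigma> r] s \<sigma>W by simp
qed

end


section \<open>The quasitorus\<close>

lemma lookup_exponent_vector:
  assumes "finite V" "v \<in> V"
  shows "poly_mapping.lookup (exponent_vector V e) v = int (e v)"
proof -
  have "poly_mapping.lookup (exponent_vector V e) v = (\<Sum>u\<in>V. int (e u) * (if v = u then 1 else 0))"
    using assms(1) by (simp add: exponent_vector_def lookup_sum lookup_single when_def)
  also have "\<dots> = int (e v)" using assms by (simp add: if_distrib cong: if_cong)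
  finally show ?thesis .
qed

lemma exponent_vector_keys:
  assumes "finite V" shows "Poly_Mapping.keys (exponent_vector V e) \<subseteq> V"
proof
  fix u assume "u \<in> Poly_Mapping.keys (exponent_vector V e)"
  then have "poly_mapping.lookup (exponent_vector V e) u \<noteq> 0" by (simp add: in_keys_iff)
  then have "(\<Sum>v\<in>V. int (e v) * (if u = v then 1 else 0)) \<noteq> 0"
    using assms(1) by (simp add: exponent_vector_def lookup_sum lookup_single when_def)
  then obtain v where "v \<in> V" "int (e v) * (if u = v then 1 else 0) \<noteq> 0"
    by (rule sum.not_neutral_contains_not_neutral)
  then show "u \<in> V" by (auto split: if_splits)
qed

context hypersurface_ring
begin

abbreviation A :: "(coord \<Rightarrow>\<^sub>0 int) monoid" where "A \<equiv> free_Abelian_group C"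
abbreviation R :: "(coord \<Rightarrow>\<^sub>0 int) set" where "R \<equiv> relation_lattice k m n a"

lemma relation_generators:
  "{exponent_vector C \<alpha>, exponent_vector C (z_exponent n)} \<subseteq> carrier A"
  by (simp add: exponent_vector_keys)

lemma relation_normal: "R \<lhd> A"
proof -
  interpret comm_group A by (rule abelian_free_Abelian_group)
  show ?thesis unfolding relation_lattice_def
    by (intro subgroup_imp_normal generate_is_subgroup relation_generators)
qed

text \<open>
  A character of the free abelian group factors through the degree group as soon as it is trivial on
  the two monomials of the defining equation.
\<close>

lemma character_exists:
  fixes r :: "coord \<Rightarrow> 'k"
  assumes nz: "\<And>v. v \<in> C \<Longrightarrow> r v \<noteq> 0"
    and xy: "(\<Prod>v\<in>C. r v ^ \<alpha> v) = 1" and z: "r VZ ^ n = 1"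
  obtains \<chi> where "\<chi> \<in> hom (degree_group k m n a) (nonzero_scalars :: 'k monoid)"
    "\<And>v. v \<in> C \<Longrightarrow> \<chi> (degree_class k m n a (frag_of v)) = r v"
proof -
  define h where "h x = (\<Prod>v\<in>C. r v powi poly_mapping.lookup x v)" for x
  have G: "group (nonzero_scalars :: 'k monoid)"
  proof (rule groupI)
    fix x assume "x \<in> carrier (nonzero_scalars :: 'k monoid)"
    then show "\<exists>y\<in>carrier nonzero_scalars. y \<otimes>\<^bsub>nonzero_scalars\<^esub> x = \<one>\<^bsub>nonzero_scalars :: 'k monoid\<^esub>"
      by (intro bexI[of _ "inverse x"]) (auto simp: nonzero_scalars_def)
  qed (auto simp: nonzero_scalars_def)
  have hom: "h \<in> hom A (nonzero_scalars :: 'k monoid)"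
    by (rule homI) (auto simp: nonzero_scalars_def h_def nz lookup_add power_int_add prod.distrib)
  interpret group_hom A "nonzero_scalars :: 'k monoid" h
    by (intro group_hom.intro group_hom_axioms.intro G hom) simp
  have "h (exponent_vector C \<alpha>) = 1" using xy by (simp add: h_def lookup_exponent_vector)
  moreover have "h (exponent_vector C (z_exponent n)) = 1"
  proof -
    have "h (exponent_vector C (z_exponent n)) = (\<Prod>v\<in>C. r v ^ z_exponent n v)"
      by (simp add: h_def lookup_exponent_vector)
    also have "\<dots> = (\<Prod>v\<in>{VZ}. r v ^ z_exponent n v)"
      by (rule prod.mono_neutral_right) (auto simp: z_exponent_def)
    finally show ?thesis using z by (simp add: z_exponent_def)
  qed
  ultimately have "{exponent_vector C \<alpha>, exponent_vector C (z_exponent n)} \<subseteq> kernel A nonzero_scalars h"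
    using relation_generators by (auto simp: kernel_def nonzero_scalars_def)
  then have "R \<subseteq> kernel A nonzero_scalars h"
    unfolding relation_lattice_def by (rule G.generate_subgroup_incl[OF _ subgroup_kernel])
  then obtain \<chi> where \<chi>: "\<chi> \<in> hom (A Mod R) (nonzero_scalars :: 'k monoid)"
    "\<And>x. x \<in> carrier A \<Longrightarrow> \<chi> (R #>\<^bsub>A\<^esub> x) = h x"
    using FactGroup_universal_kernel[OF relation_normal] by blast
  have "h (frag_of v) = r v" if v: "v \<in> C" for v
  proof -
    have "h (frag_of v) = (\<Prod>u\<in>C. if u = v then r u else 1)"
      unfolding h_def by (rule prod.cong) (auto simp: lookup_single when_def)
    then show ?thesis using v by simp
  qed
  then show thesis using that \<chi> by (simp add: degree_group_def degree_class_def)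
qed

text \<open>
  Automorphisms rescaling the generators automatically preserve both monomials, as is seen at
  the points of the chart with all coordinates in \<open>W\<close> equal to \<open>1\<close> and \<open>z = 0, 1\<close>.
\<close>

lemma quasitorus_iff:
  "\<phi> \<in> quasitorus k m n a \<longleftrightarrow>
     \<phi> \<in> alg_aut B \<and> (\<exists>r. \<forall>v\<in>C. \<phi> (g v) = r v \<odot> g v)"
proof
  assume "\<phi> \<in> quasitorus k m n a"
  then obtain \<chi> where "\<phi> \<in> alg_aut B"
    "\<forall>v\<in>C. \<phi> (g v) = \<chi> (degree_class k m n a (frag_of v)) \<odot> g v"
    unfolding quasitorus_def B_def[symmetric] by blast
  then show "\<phi> \<in> alg_aut B \<and> (\<exists>r. \<forall>v\<in>C. \<phi> (g v) = r v \<odot> g v)"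
    by (intro conjI exI[of _ "\<lambda>v. \<chi> (degree_class k m n a (frag_of v))"])
next
  assume "\<phi> \<in> alg_aut B \<and> (\<exists>r. \<forall>v\<in>C. \<phi> (g v) = r v \<odot> g v)"
  then obtain r where \<phi>: "\<phi> \<in> alg_aut B" and r: "\<And>v. v \<in> C \<Longrightarrow> \<phi> (g v) = r v \<odot> g v" by blast
  note endo = alg_autD(1)[OF \<phi>]
  have nz: "r v \<noteq> 0" if v: "v \<in> C" for v
  proof
    assume "r v = 0"
    then have "\<phi> (g v) = \<phi> \<zero>"
      unfolding r[OF v] alg_end_zero[OF endo] by (intro elem_eqI) (use v in auto)
    then have "g v = \<zero>" using alg_autD(2)[OF \<phi>] v by (auto simp: bij_betw_def dest: inj_onD)
    then show False using gen_nonzero[OF v] by simp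
  qed
  interpret chart k m n a B k
    by unfold_locales (use k_ge in auto)
  let ?q = "\<lambda>t. chart_point (\<lambda>_. 1) (t :: 'k)"
  have M1: "M (\<lambda>_. 1) = (1 :: 'k)" by (simp add: monomial_def)
  then have q: "?q t \<in> \<V>" for t by (intro chart_point_mem) simp
  define \<rho> where "\<rho> = (\<Prod>v\<in>W. r v ^ \<alpha> v)"
  have eq: "r (VX k) * (t ^ n + 1) * \<rho> = r VZ ^ n * t ^ n + 1" for t
  proof -
    have "\<phi> (\<iota> M) (?q t) = (\<Prod>v\<in>W. (r v * 1) ^ \<alpha> v)"
      unfolding alg_end_M[OF endo q] using r q by (intro prod.cong) (auto simp: chart_point_def)
    then have "\<phi> (\<iota> M) (?q t) = \<rho>" by (simp add: \<rho>_def)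
    then show ?thesis using alg_end_x[OF endo q, of t] r q M1 by (simp add: power_mult_distrib)
  qed
  have xy: "r (VX k) * \<rho> = 1" using eq[of 0] n_ge by (simp add: power_0_left)
  have "(r (VX k) * \<rho>) * 2 = r VZ ^ n + 1" using eq[of 1] by (simp add: algebra_simps)
  then have z: "r VZ ^ n = 1" unfolding xy by simp
  have "(\<Prod>v\<in>C. r v ^ \<alpha> v) = r (VX k) * \<rho>"
  proof -
    have "(\<Prod>v\<in>C. r v ^ \<alpha> v) = (\<Prod>v\<in>C - {VZ}. r v ^ \<alpha> v)"
      using prod.remove[of C VZ "\<lambda>v. r v ^ \<alpha> v"] by simp
    also have "\<dots> = r (VX k) * M r" using monomial_split[of r] unfolding monomial_def .
    finally show ?thesis by (simp add: \<rho>_def monomial_def)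
  qed
  then have "(\<Prod>v\<in>C. r v ^ \<alpha> v) = 1" using xy by simp
  then obtain \<chi> where \<chi>: "\<chi> \<in> hom (degree_group k m n a) (nonzero_scalars :: 'k monoid)"
    "\<And>v. v \<in> C \<Longrightarrow> \<chi> (degree_class k m n a (frag_of v)) = r v"
    using character_exists[of r] nz z by blast
  show "\<phi> \<in> quasitorus k m n a"
    unfolding quasitorus_def B_def[symmetric]
    using \<phi> r \<chi>(2) by (auto intro!: bexI[OF _ \<chi>(1)])
qed

end

section \<open>Permutations of the variables\<close>

context standard_lnd
begin

definition perm_aut :: "(coord \<Rightarrow> coord) \<Rightarrow> ((coord \<Rightarrow> 'k) \<Rightarrow> 'k) \<Rightarrow> ((coord \<Rightarrow> 'k) \<Rightarrow> 'k)" where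
  "perm_aut \<sigma> = (\<lambda>f\<in>carrier B. \<lambda>p\<in>\<V>. f (\<lambda>v\<in>C. p (\<sigma> v)))"

lemma admissible_simps:
  assumes "admissible \<sigma>"
  shows "\<sigma> VZ = VZ" "\<sigma> (VX i) = VX i" "v \<in> C \<Longrightarrow> \<sigma> v \<in> C" "v \<in> W \<Longrightarrow> \<sigma> v \<in> W"
proof -
  have p: "\<sigma> permutes W" using assms by (simp add: admissible_def)
  show "\<sigma> VZ = VZ" "\<sigma> (VX i) = VX i" using permutes_not_in[OF p] by auto
  show "v \<in> W \<Longrightarrow> \<sigma> v \<in> W" using permutes_in_image[OF p] by blast
  show "v \<in> C \<Longrightarrow> \<sigma> v \<in> C"
    using permutes_in_image[OF p, of v] permutes_not_in[OF p, of v] by (cases "v \<in> W") auto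
qed

lemma admissible_inv: assumes "admissible \<sigma>" shows "admissible (inv_into UNIV \<sigma>)"
proof -
  have p: "\<sigma> permutes W" using assms by (simp add: admissible_def)
  note pi = permutes_inv[OF p]
  have "\<alpha> (inv_into UNIV \<sigma> v) = \<alpha> v" if "v \<in> W" for v
  proof -
    have "inv_into UNIV \<sigma> v \<in> W" using that permutes_in_image[OF pi] by blast
    then have "\<alpha> (\<sigma> (inv_into UNIV \<sigma> v)) = \<alpha> (inv_into UNIV \<sigma> v)" using assms by (simp add: admissible_def)
    then show ?thesis by (simp add: permutes_inverses(1)[OF p])
  qed
  then show ?thesis using pi by (simp add: admissible_def)
qed

lemma admissible_comp: "admissible \<sigma> \<Longrightarrow> admissible \<tau> \<Longrightarrow> admissible (\<sigma> \<circ> \<tau>)"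
  using admissible_simps(4)[of \<tau>] by (auto simp: admissible_def intro: permutes_compose)

lemma M_permuted:
  assumes "admissible \<sigma>" shows "M (\<lambda>v. p (\<sigma> v)) = (M p :: 'k)"
proof -
  have perm: "\<sigma> permutes W" using assms by (simp add: admissible_def)
  have "M (\<lambda>v. p (\<sigma> v)) = (\<Prod>v\<in>W. p (\<sigma> v) ^ \<alpha> (\<sigma> v))"
    unfolding monomial_def using assms by (intro prod.cong) (auto simp: admissible_def)
  also have "\<dots> = M p"
    unfolding monomial_def using prod.permute[OF perm, of "\<lambda>v. p v ^ \<alpha> v"] by (simp add: comp_def)
  finally show ?thesis .
qed

lemma permuted_point:
  assumes \<sigma>: "admissible \<sigma>" and p: "p \<in> \<V>"
  shows "(\<lambda>v\<in>C. p (\<sigma> v)) \<in> \<V>"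
proof -
  let ?p = "\<lambda>v\<in>C. p (\<sigma> v)"
  have "M ?p = M (\<lambda>v. p (\<sigma> v))" unfolding monomial_def by (rule prod.cong) auto
  also have "\<dots> = M p" by (rule M_permuted[OF \<sigma>])
  finally have "M ?p = M p" .
  then show ?thesis using on_hypersurface[OF p] admissible_simps(1,2)[OF \<sigma>]
    by (simp add: hypersurface_iff monomial_split)
qed

lemma perm_aut_polyfun:
  assumes \<sigma>: "admissible \<sigma>" and F: "F \<in> polyfun C"
  shows "perm_aut \<sigma> (\<lambda>p\<in>\<V>. F p) = (\<lambda>p\<in>\<V>. F (\<lambda>v. p (\<sigma> v)))"
proof
  fix p
  have "F (\<lambda>v\<in>C. p (\<sigma> v)) = F (\<lambda>v. p (\<sigma> v))" by (rule polyfun_cong[OF F]) simp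
  then show "perm_aut \<sigma> (\<lambda>p\<in>\<V>. F p) p = (\<lambda>p\<in>\<V>. F (\<lambda>v. p (\<sigma> v))) p"
    using polyfun_mem[OF F] permuted_point[OF \<sigma>, of p] by (simp add: perm_aut_def)
qed

lemma perm_aut_mem:
  assumes \<sigma>: "admissible \<sigma>" and f: "f \<in> carrier B"
  shows "perm_aut \<sigma> f \<in> carrier B"
proof -
  obtain F where F: "F \<in> polyfun C" "f = (\<lambda>p\<in>\<V>. F p)" using f by (rule carrierE)
  have "(\<lambda>p. F (\<lambda>v. p (\<sigma> v))) \<in> polyfun C"
    by (rule polyfun_subst[OF F(1)]) (intro polyfun_var admissible_simps(3)[OF \<sigma>])
  then show ?thesis unfolding F(2) perm_aut_polyfun[OF \<sigma> F(1)] by (rule polyfun_mem)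
qed

lemma alg_end_perm_aut:
  assumes \<sigma>: "admissible \<sigma>" shows "alg_end B (perm_aut \<sigma>)"
proof -
  have ev: "perm_aut \<sigma> f p = f (\<lambda>v\<in>C. p (\<sigma> v))" if "f \<in> carrier B" "p \<in> \<V>" for f p
    using that by (simp add: perm_aut_def)
  note pt = permuted_point[OF \<sigma>] and mem = perm_aut_mem[OF \<sigma>]
  show ?thesis
    unfolding alg_end_def
  proof (intro conjI ballI allI)
    show "perm_aut \<sigma> \<in> carrier B \<rightarrow>\<^sub>E carrier B" using mem by (auto simp: PiE_iff perm_aut_def)
    show "perm_aut \<sigma> \<one> = \<one>" by (rule elem_eqI) (use mem ev pt in auto)
    fix f assume f: "f \<in> carrier B"
    show "perm_aut \<sigma> (c \<odot> f) = c \<odot> perm_aut \<sigma> f" for c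
      by (rule elem_eqI) (use f mem ev pt in auto)
    fix h assume h: "h \<in> carrier B"
    show "perm_aut \<sigma> (f \<oplus> h) = perm_aut \<sigma> f \<oplus> perm_aut \<sigma> h"
      by (rule elem_eqI) (use f h mem ev pt in auto)
    show "perm_aut \<sigma> (f \<otimes> h) = perm_aut \<sigma> f \<otimes> perm_aut \<sigma> h"
      by (rule elem_eqI) (use f h mem ev pt in auto)
  qed
qed

lemma perm_aut_gen: assumes \<sigma>: "admissible \<sigma>" and v: "v \<in> C" shows "perm_aut \<sigma> (g v) = g (\<sigma> v)"
  unfolding gen_def using perm_aut_polyfun[OF \<sigma> polyfun_var[OF v]] .

lemma perm_aut_comp:
  assumes \<sigma>: "admissible \<sigma>" and \<tau>: "admissible \<tau>"
  shows "compose (carrier B) (perm_aut \<sigma>) (perm_aut \<tau>) = perm_aut (\<sigma> \<circ> \<tau>)"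
proof (rule alg_end_eqI)
  fix v assume v: "v \<in> C"
  show "compose (carrier B) (perm_aut \<sigma>) (perm_aut \<tau>) (g v) = perm_aut (\<sigma> \<circ> \<tau>) (g v)"
    using v admissible_simps(3)[OF \<tau> v]
    by (simp add: compose_eq perm_aut_gen \<sigma> \<tau> admissible_comp)
qed (intro alg_end_compose' alg_end_perm_aut admissible_comp \<sigma> \<tau>)+

lemma admissible_id: "admissible id"
  by (simp add: admissible_def permutes_id)

lemma perm_aut_id: "perm_aut id = (\<lambda>f\<in>carrier B. f)"
proof (rule alg_end_eqI[OF alg_end_perm_aut[OF admissible_id] alg_end_id])
  show "perm_aut id (g v) = (\<lambda>f\<in>carrier B. f) (g v)" if "v \<in> C" for v
    using that by (simp add: perm_aut_gen[OF admissible_id])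
qed

lemma perm_aut_inverse:
  assumes \<sigma>: "admissible \<sigma>"
  shows "compose (carrier B) (perm_aut (inv_into UNIV \<sigma>)) (perm_aut \<sigma>) = (\<lambda>f\<in>carrier B. f)"
    "compose (carrier B) (perm_aut \<sigma>) (perm_aut (inv_into UNIV \<sigma>)) = (\<lambda>f\<in>carrier B. f)"
proof -
  have p: "\<sigma> permutes W" using \<sigma> by (simp add: admissible_def)
  show "compose (carrier B) (perm_aut (inv_into UNIV \<sigma>)) (perm_aut \<sigma>) = (\<lambda>f\<in>carrier B. f)"
    "compose (carrier B) (perm_aut \<sigma>) (perm_aut (inv_into UNIV \<sigma>)) = (\<lambda>f\<in>carrier B. f)"
    unfolding perm_aut_comp[OF \<sigma> admissible_inv[OF \<sigma>]] perm_aut_comp[OF admissible_inv[OF \<sigma>] \<sigma>]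
      permutes_inv_o[OF p] by (rule perm_aut_id)+
qed

lemma perm_aut_centralizes: assumes \<sigma>: "admissible \<sigma>" shows "perm_aut \<sigma> \<in> Z"
proof -
  let ?\<tau> = "inv_into UNIV \<sigma>"
  note endo = alg_end_perm_aut[OF \<sigma>]
  have inv: "perm_aut ?\<tau> (perm_aut \<sigma> f) = f" "perm_aut \<sigma> (perm_aut ?\<tau> f) = f" if "f \<in> carrier B" for f
    using compose_eq[OF that, of "perm_aut ?\<tau>" "perm_aut \<sigma>"]
      compose_eq[OF that, of "perm_aut \<sigma>" "perm_aut ?\<tau>"] that
    unfolding perm_aut_inverse[OF \<sigma>] by simp_all
  have "bij_betw (perm_aut \<sigma>) (carrier B) (carrier B)"
    by (rule bij_betw_byWitness[where f' = "perm_aut ?\<tau>"])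
      (use inv perm_aut_mem[OF \<sigma>] perm_aut_mem[OF admissible_inv[OF \<sigma>]] in auto)
  then have aut: "perm_aut \<sigma> \<in> alg_aut B" using endo by (simp add: alg_aut_iff)
  have M: "perm_aut \<sigma> (\<iota> M) = \<iota> M"
  proof (rule elem_eqI[OF perm_aut_mem[OF \<sigma> iota_M_mem] iota_M_mem])
    fix p assume p: "p \<in> \<V>"
    have "perm_aut \<sigma> (\<iota> M) p = M (\<lambda>v. p (\<sigma> v))"
      unfolding perm_aut_polyfun[OF \<sigma> polyfun_W_C[OF M_polyfun]] using p by simp
    also have "\<dots> = M p" by (rule M_permuted[OF \<sigma>])
    finally show "perm_aut \<sigma> (\<iota> M) p = \<iota> M p" using p by simp
  qed
  have "perm_aut \<sigma> (\<delta> f) = \<delta> (perm_aut \<sigma> f)" if f: "f \<in> carrier B" for f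
  proof (rule commute_criterion[OF endo der_\<delta> _ kills_W _ _ f])
    show "perm_aut \<sigma> (\<iota> M) \<noteq> \<zero>" unfolding M by (rule iota_M_nonzero)
    show "\<delta> (perm_aut \<sigma> (g v)) = \<zero>" if "v \<in> W" for v
      using that perm_aut_gen[OF \<sigma>, of v] kills_W[OF admissible_simps(4)[OF \<sigma> that]] by simp
    show "perm_aut \<sigma> (\<delta> (g VZ)) = \<delta> (perm_aut \<sigma> (g VZ))"
      unfolding perm_aut_gen[OF \<sigma> VZ_coords] admissible_simps(1)[OF \<sigma>] \<delta>_z_eq
        alg_end_smult[OF endo iota_M_mem] M ..
  qed
  then show ?thesis using aut by (simp add: aut_centralizer_def)
qed

lemma M_eq_finprod:
  assumes p: "p \<in> \<V>"
  shows "((\<Otimes>s\<in>{1..m}. g (VY s) [^] a s) \<otimes> (\<Otimes>j\<in>{1..k} - {i}. g (VX j))) p = M p"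
proof -
  have C: "VY s \<in> C" if "s \<in> {1..m}" for s using that by (auto simp: coords_def)
  have C': "VX j \<in> C" if "j \<in> {1..k}" for j using that by (auto simp: coords_def)
  have W: "W = VX ` ({1..k} - {i}) \<union> VY ` {1..m}" by (auto simp: coords_def)
  have "((\<Otimes>s\<in>{1..m}. g (VY s) [^] a s) \<otimes> (\<Otimes>j\<in>{1..k} - {i}. g (VX j))) p
      = (\<Prod>s=1..m. p (VY s) ^ a s) * (\<Prod>j\<in>{1..k} - {i}. p (VX j))"
  proof -
    have "(\<Otimes>s\<in>{1..m}. g (VY s) [^] a s) p = (\<Prod>s=1..m. (g (VY s) [^] a s) p)"
      by (rule eval_finprod[OF _ pow_mem[OF gen_mem[OF C]] p]) simp
    moreover have "(\<Otimes>j\<in>{1..k} - {i}. g (VX j)) p = (\<Prod>j\<in>{1..k} - {i}. g (VX j) p)"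
      by (rule eval_finprod[OF _ gen_mem[OF C'] p]) auto
    ultimately show ?thesis using p by simp
  qed
  also have "\<dots> = M p" unfolding monomial_def W prod_coords[OF Diff_subset] by simp
  finally show ?thesis .
qed

lemma proportional: "proportional_to_partial k m n a i \<delta>"
proof -
  define D where "D = replica (\<lambda>_. inverse c)"
  have const: "(\<lambda>_. inverse c) \<in> polyfun W" by (rule polyfun_const)
  have ev: "D f p = inverse c * \<delta> f p" if "f \<in> carrier B" "p \<in> \<V>" for f p
    unfolding D_def using eval_replica that by simp
  have D: "derivation B D" unfolding D_def by (rule derivation_replica[OF const])
  note mem = derivation_mem[OF D]
  have Cx: "VX j \<in> C" if "j \<in> {1..k}" for j using that by (auto simp: coords_def)
  have Cy: "VY s \<in> C" if "s \<in> {1..m}" for s using that by (auto simp: coords_def)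
  have "is_partial k m n a i D"
    unfolding is_partial_def Let_def B_def[symmetric]
  proof (intro conjI ballI D)
    show "D (g (VX i)) = of_nat n \<odot> g VZ [^] (n - 1)"
      by (rule elem_eqI) (use mem c_nonzero in \<open>auto simp: ev \<delta>_x\<close>)
    show "D (g VZ) = (\<Otimes>s\<in>{1..m}. g (VY s) [^] a s) \<otimes> (\<Otimes>j\<in>{1..k} - {i}. g (VX j))"
    proof (rule elem_eqI)
      fix p assume p: "p \<in> \<V>"
      show "D (g VZ) p = ((\<Otimes>s\<in>{1..m}. g (VY s) [^] a s) \<otimes> (\<Otimes>j\<in>{1..k} - {i}. g (VX j))) p"
        unfolding M_eq_finprod[OF p] using p c_nonzero by (simp add: ev \<delta>_z)
    qed (use mem Cx Cy in \<open>auto intro!: mult_mem' finprod_mem\<close>)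
    have "D (g v) = \<zero>" if "v \<in> W" for v
      by (rule elem_eqI) (use that mem kills_W[OF that] in \<open>auto simp: ev\<close>)
    then show "j \<in> {1..k} - {i} \<Longrightarrow> D (g (VX j)) = \<zero>" "s \<in> {1..m} \<Longrightarrow> D (g (VY s)) = \<zero>" for j s
      using Cx[of j] Cy[of s] by auto
  qed
  moreover have "\<delta> = (\<lambda>f\<in>carrier B. c \<odot> D f)"
  proof (rule extensionalityI[of _ "carrier B"])
    show "\<delta> \<in> extensional (carrier B)" using der_\<delta> by (auto simp: derivation_def PiE_def)
    fix f assume f: "f \<in> carrier B"
    have "\<delta> f = c \<odot> D f" by (rule elem_eqI) (use f mem c_nonzero in \<open>auto simp: ev\<close>)
    then show "\<delta> f = (\<lambda>f\<in>carrier B. c \<odot> D f) f" using f by simp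
  qed simp
  ultimately show ?thesis unfolding proportional_to_partial_def B_def[symmetric] using c_nonzero by blast
qed

text \<open>
  The index is determined by \<open>\<delta>\<close>, since \<open>x\<^sub>i\<close> is the only one of the \<open>x\<^sub>j\<close> that \<open>\<delta>\<close> moves.
\<close>

lemma proportional_unique:
  assumes "proportional_to_partial k m n a j \<delta>" "j \<in> {1..k}"
  shows "j = i"
proof (rule ccontr)
  assume "j \<noteq> i"
  obtain c' D where D: "is_partial k m n a j D" and \<delta>: "\<delta> = (\<lambda>f\<in>carrier B. c' \<odot> D f)"
    using assms(1) unfolding proportional_to_partial_def B_def[symmetric] by blast
  have "D (g (VX i)) = \<zero>"
    using D \<open>j \<noteq> i\<close> i_mem unfolding is_partial_def Let_def B_def[symmetric] by blast
  then have eq: "\<delta> (g (VX i)) = c' \<odot> \<zero>" unfolding \<delta> by simp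
  obtain p where p: "p \<in> \<V>" "\<And>v. v \<in> C \<Longrightarrow> p v \<noteq> 0" using generic_point by blast
  have "of_nat n * c * p VZ ^ (n - 1) = (0::'k)" using fun_cong[OF eq, of p] \<delta>_x[OF p(1)] p(1) by simp
  then show False using p(2)[of VZ] c_nonzero n_ge by simp
qed

lemma permutation_aut_eq: "permutation_aut k m n a \<delta> = {perm_aut \<sigma> | \<sigma>. admissible \<sigma>}"
proof (intro equalityI subsetI)
  fix \<phi> assume "\<phi> \<in> permutation_aut k m n a \<delta>"
  then obtain \<sigma> where \<phi>: "\<phi> \<in> alg_aut B" and \<sigma>: "admissible \<sigma>"
    and gens: "\<forall>v\<in>C. \<phi> (g v) = g (\<sigma> v)"
    using proportional_unique unfolding permutation_aut_def B_def[symmetric] admissible_def by blast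
  have "\<phi> = perm_aut \<sigma>"
    by (rule alg_end_eqI[OF alg_autD(1)[OF \<phi>] alg_end_perm_aut[OF \<sigma>]])
      (use gens perm_aut_gen[OF \<sigma>] in auto)
  then show "\<phi> \<in> {perm_aut \<sigma> | \<sigma>. admissible \<sigma>}" using \<sigma> by blast
next
  fix \<phi> assume "\<phi> \<in> {perm_aut \<sigma> | \<sigma>. admissible \<sigma>}"
  then obtain \<sigma> where \<phi>: "\<phi> = perm_aut \<sigma>" and \<sigma>: "admissible \<sigma>" by blast
  then show "\<phi> \<in> permutation_aut k m n a \<delta>"
    unfolding permutation_aut_def B_def[symmetric]
    using centralizerD(2)[OF perm_aut_centralizes[OF \<sigma>]] proportional i_mem perm_aut_gen[OF \<sigma>]
    by (auto simp: admissible_def)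
qed

lemma quasitorus_centralizer_iff:
  "\<phi> \<in> quasitorus_centralizer k m n a \<delta> \<longleftrightarrow> \<phi> \<in> Z \<and> (\<exists>r. \<forall>v\<in>C. \<phi> (g v) = r v \<odot> g v)"
  unfolding quasitorus_centralizer_def B_def[symmetric] Int_iff quasitorus_iff using centralizerD(2) by blast

end


section \<open>The semidirect decomposition\<close>

lemma (in group) semidirect_of_normalizing:
  assumes S: "subgroup S G" and H: "subgroup H G"
    and norm: "\<And>s h. s \<in> S \<Longrightarrow> h \<in> H \<Longrightarrow> s \<otimes> h \<otimes> inv s \<in> H"
    and triv: "S \<inter> H = {\<one>}"
  shows "subgroup (S <#> H) G" "internal_semidirect (G\<lparr>carrier := S <#> H\<rparr>) S H"
proof -
  note Sc = subgroup.mem_carrier[OF S] and Hc = subgroup.mem_carrier[OF H]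
  have norm': "inv s \<otimes> h \<otimes> s \<in> H" if "s \<in> S" "h \<in> H" for s h
    using norm[OF subgroup.m_inv_closed[OF S that(1)] that(2)] Sc[OF that(1)] by simp
  have SHI: "s \<otimes> h \<in> S <#> H" if "s \<in> S" "h \<in> H" for s h
    using that by (auto simp: set_mult_def)
  have SHE: "\<exists>s\<in>S. \<exists>h\<in>H. x = s \<otimes> h" if "x \<in> S <#> H" for x
    using that by (auto simp: set_mult_def)
  show Q: "subgroup (S <#> H) G"
  proof (rule subgroupI)
    show "S <#> H \<subseteq> carrier G" using Sc Hc by (auto simp: set_mult_def)
    show "S <#> H \<noteq> {}"
      using SHI[OF subgroup.one_closed[OF S] subgroup.one_closed[OF H]] by blast
  next
    fix x assume "x \<in> S <#> H"
    then obtain s h where x: "s \<in> S" "h \<in> H" "x = s \<otimes> h" using SHE by blast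
    note c = Sc[OF x(1)] Hc[OF x(2)]
    have "inv x = inv s \<otimes> (s \<otimes> inv h \<otimes> inv s)"
      using c by (simp add: x(3) inv_mult_group m_assoc[symmetric])
    then show "inv x \<in> S <#> H"
      using SHI[OF subgroup.m_inv_closed[OF S x(1)] norm[OF x(1) subgroup.m_inv_closed[OF H x(2)]]] by simp
  next
    fix x y assume "x \<in> S <#> H" "y \<in> S <#> H"
    then obtain s h s' h' where x: "s \<in> S" "h \<in> H" "x = s \<otimes> h"
      and y: "s' \<in> S" "h' \<in> H" "y = s' \<otimes> h'" using SHE by metis
    note c = Sc[OF x(1)] Hc[OF x(2)] Sc[OF y(1)] Hc[OF y(2)]
    have "s' \<otimes> (inv s' \<otimes> h \<otimes> s') = h \<otimes> s'" using c by (simp add: m_assoc[symmetric])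
    then have "(s \<otimes> s') \<otimes> ((inv s' \<otimes> h \<otimes> s') \<otimes> h') = s \<otimes> (h \<otimes> s') \<otimes> h'"
      using c by (metis m_assoc m_closed inv_closed)
    also have "\<dots> = x \<otimes> y" using c by (simp add: x(3) y(3) m_assoc)
    finally have "x \<otimes> y = (s \<otimes> s') \<otimes> ((inv s' \<otimes> h \<otimes> s') \<otimes> h')" by simp
    then show "x \<otimes> y \<in> S <#> H"
      using SHI[OF subgroup.m_closed[OF S x(1) y(1)]
          subgroup.m_closed[OF H norm'[OF y(1) x(2)] y(2)]] by simp
  qed
  have sub: "S \<subseteq> S <#> H" "H \<subseteq> S <#> H"
    using SHI[OF _ subgroup.one_closed[OF H]] SHI[OF subgroup.one_closed[OF S]] Sc Hc by fastforce+
  let ?G = "G\<lparr>carrier := S <#> H\<rparr>"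
  interpret Q: group ?G by (rule subgroup_imp_group[OF Q])
  have SQ: "subgroup S ?G" and HQ: "subgroup H ?G"
    using subgroup_incl[OF S Q sub(1)] subgroup_incl[OF H Q sub(2)] .
  have "x \<otimes> h \<otimes> inv x \<in> H" if x: "x \<in> S <#> H" and h: "h \<in> H" for x h
  proof -
    obtain s h' where s: "s \<in> S" "h' \<in> H" "x = s \<otimes> h'" using SHE[OF x] by blast
    note c = Sc[OF s(1)] Hc[OF s(2)] Hc[OF h]
    have "x \<otimes> h \<otimes> inv x = s \<otimes> (h' \<otimes> h \<otimes> inv h') \<otimes> inv s"
      using c by (simp add: s(3) inv_mult_group m_assoc)
    moreover have "h' \<otimes> h \<otimes> inv h' \<in> H"
      by (intro subgroup.m_closed[OF H] subgroup.m_inv_closed[OF H] s h)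
    ultimately show ?thesis using norm[OF s(1)] by simp
  qed
  then have "H \<lhd> ?G"
    unfolding Q.normal_inv_iff using HQ m_inv_consistent[OF Q] by simp
  moreover have "S <#>\<^bsub>?G\<^esub> H = carrier ?G" by (simp add: set_mult_def)
  ultimately show "internal_semidirect ?G S H"
    unfolding internal_semidirect_def using SQ triv Q.is_group by simp
qed

context standard_lnd
begin

abbreviation G :: "(((coord \<Rightarrow> 'k) \<Rightarrow> 'k) \<Rightarrow> ((coord \<Rightarrow> 'k) \<Rightarrow> 'k)) monoid" where
  "G \<equiv> aut_centralizer_group B \<delta>"

lemma G_group: "group G"
  unfolding aut_centralizer_group_def
  by (rule group.subgroup_imp_group[OF group_BijGroup subgroup_centralizer[OF der_\<delta>]])

lemma G_carrier [simp]: "carrier G = Z"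
  by (simp add: aut_centralizer_group_def)

lemma G_one: "\<one>\<^bsub>G\<^esub> = (\<lambda>f\<in>carrier B. f)"
  by (simp add: aut_centralizer_group_def BijGroup_def)

lemma G_mult: "\<phi> \<in> Z \<Longrightarrow> \<psi> \<in> Z \<Longrightarrow> \<phi> \<otimes>\<^bsub>G\<^esub> \<psi> = compose (carrier B) \<phi> \<psi>"
  using alg_autD(3)[OF centralizerD(2)] by (simp add: aut_centralizer_group_def BijGroup_def)

lemma G_mult_apply: "\<phi> \<in> Z \<Longrightarrow> \<psi> \<in> Z \<Longrightarrow> f \<in> carrier B \<Longrightarrow> (\<phi> \<otimes>\<^bsub>G\<^esub> \<psi>) f = \<phi> (\<psi> f)"
  by (simp add: G_mult compose_eq)

lemma G_inv:
  assumes "\<phi> \<in> Z"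
  shows "inv\<^bsub>G\<^esub> \<phi> \<in> Z" "f \<in> carrier B \<Longrightarrow> \<phi> ((inv\<^bsub>G\<^esub> \<phi>) f) = f"
    "f \<in> carrier B \<Longrightarrow> (inv\<^bsub>G\<^esub> \<phi>) (\<phi> f) = f"
proof -
  interpret G: group G by (rule G_group)
  show inv: "inv\<^bsub>G\<^esub> \<phi> \<in> Z" using assms G.inv_closed by simp
  assume f: "f \<in> carrier B"
  show "\<phi> ((inv\<^bsub>G\<^esub> \<phi>) f) = f"
    using G_mult_apply[OF assms inv f] G.r_inv[of \<phi>] assms f by (simp add: G_one)
  show "(inv\<^bsub>G\<^esub> \<phi>) (\<phi> f) = f"
    using G_mult_apply[OF inv assms f] G.l_inv[of \<phi>] assms f by (simp add: G_one)
qed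

lemma U_centralizes: "F \<in> polyfun W \<Longrightarrow> U F \<in> Z"
  using U_aut U_commutes by (simp add: aut_centralizer_def)

abbreviation S where "S \<equiv> permutation_aut k m n a \<delta>"
abbreviation H where "H \<equiv> quasitorus_centralizer k m n a \<delta>"
abbreviation UU where "UU \<equiv> unipotent_aut B \<delta>"

lemma G_inv_eqI: "\<phi> \<in> Z \<Longrightarrow> \<psi> \<in> Z \<Longrightarrow> compose (carrier B) \<psi> \<phi> = (\<lambda>f\<in>carrier B. f) \<Longrightarrow> inv\<^bsub>G\<^esub> \<phi> = \<psi>"
  by (rule group.inv_equality[OF G_group]) (simp_all add: G_mult G_one)

lemma S_subgroup: "subgroup S G"
proof (rule group.subgroupI[OF G_group])
  show "S \<subseteq> carrier G" using perm_aut_centralizes by (auto simp: permutation_aut_eq)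
  show "S \<noteq> {}" using admissible_id by (auto simp: permutation_aut_eq)
next
  fix \<phi> assume "\<phi> \<in> S"
  then obtain \<sigma> where \<sigma>: "\<phi> = perm_aut \<sigma>" "admissible \<sigma>" by (auto simp: permutation_aut_eq)
  have "inv\<^bsub>G\<^esub> \<phi> = perm_aut (inv_into UNIV \<sigma>)"
    unfolding \<sigma>(1) by (intro G_inv_eqI perm_aut_centralizes perm_aut_inverse admissible_inv \<sigma>(2))
  then show "inv\<^bsub>G\<^esub> \<phi> \<in> S" using admissible_inv[OF \<sigma>(2)] by (auto simp: permutation_aut_eq)
next
  fix \<phi> \<psi> assume "\<phi> \<in> S" "\<psi> \<in> S"
  then obtain \<sigma> \<tau> where \<sigma>: "\<phi> = perm_aut \<sigma>" "admissible \<sigma>" and \<tau>: "\<psi> = perm_aut \<tau>" "admissible \<tau>"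
    by (auto simp: permutation_aut_eq)
  have "\<phi> \<otimes>\<^bsub>G\<^esub> \<psi> = perm_aut (\<sigma> \<circ> \<tau>)"
    using \<sigma> \<tau> by (simp add: G_mult perm_aut_centralizes perm_aut_comp)
  then show "\<phi> \<otimes>\<^bsub>G\<^esub> \<psi> \<in> S" using admissible_comp[OF \<sigma>(2) \<tau>(2)] by (auto simp: permutation_aut_eq)
qed

lemma quasitorus_centralizerE:
  assumes "\<phi> \<in> H"
  obtains r where "\<phi> \<in> Z" "\<forall>v\<in>C. \<phi> (g v) = r v \<odot> g v"
  using assms unfolding quasitorus_centralizer_iff by blast

lemma quasitorus_centralizerI: "\<phi> \<in> Z \<Longrightarrow> (\<And>v. v \<in> C \<Longrightarrow> \<phi> (g v) = r v \<odot> g v) \<Longrightarrow> \<phi> \<in> H"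
  unfolding quasitorus_centralizer_iff by blast

lemma smult_smult: "f \<in> carrier B \<Longrightarrow> r \<odot> (s \<odot> f) = (r * s) \<odot> f"
  by (rule elem_eqI) auto

lemma smult_one: "f \<in> carrier B \<Longrightarrow> 1 \<odot> f = f"
  by (rule elem_eqI) auto

lemma H_nonzero:
  assumes "\<phi> \<in> Z" "\<phi> (g v) = r \<odot> g v" "v \<in> C" shows "r \<noteq> 0"
proof
  assume "r = 0"
  then have "\<phi> (g v) = \<phi> \<zero>"
    unfolding assms(2) alg_end_zero[OF centralizerD(1)[OF assms(1)]] by (intro elem_eqI) (use assms(3) in auto)
  then have "g v = \<zero>" using centralizer_inj[OF assms(1)] assms(3) by simp
  then show False using gen_nonzero[OF assms(3)] by simp
qed

lemma H_subgroup: "subgroup H G"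
proof (rule group.subgroupI[OF G_group])
  interpret G: group G by (rule G_group)
  show "H \<subseteq> carrier G" unfolding quasitorus_centralizer_iff subset_iff by simp
  have "\<one>\<^bsub>G\<^esub> \<in> H"
  proof (rule quasitorus_centralizerI[of _ "\<lambda>_. 1"])
    show "\<one>\<^bsub>G\<^esub> \<in> Z" using G.one_closed by simp
    show "\<one>\<^bsub>G\<^esub> (g v) = 1 \<odot> g v" if "v \<in> C" for v using that by (simp add: G_one smult_one)
  qed
  then show "H \<noteq> {}" by blast
next
  fix \<phi> assume "\<phi> \<in> H"
  then obtain r where \<phi>: "\<phi> \<in> Z" and r: "\<forall>v\<in>C. \<phi> (g v) = r v \<odot> g v" by (rule quasitorus_centralizerE)
  show "inv\<^bsub>G\<^esub> \<phi> \<in> H"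
  proof (rule quasitorus_centralizerI[of _ "\<lambda>v. inverse (r v)"])
    show i: "inv\<^bsub>G\<^esub> \<phi> \<in> Z" by (rule G_inv(1)[OF \<phi>])
    fix v assume v: "v \<in> C"
    have "\<phi> (inverse (r v) \<odot> g v) = g v"
      using r v H_nonzero[OF \<phi> _ v] centralizerD(1)[OF \<phi>] by (simp add: alg_end_smult smult_smult smult_one)
    then show "(inv\<^bsub>G\<^esub> \<phi>) (g v) = inverse (r v) \<odot> g v"
      using G_inv(3)[OF \<phi>, of "inverse (r v) \<odot> g v"] v by simp
  qed
next
  interpret G: group G by (rule G_group)
  fix \<phi> \<psi> assume "\<phi> \<in> H" "\<psi> \<in> H"
  then obtain r s where \<phi>: "\<phi> \<in> Z" and r: "\<forall>v\<in>C. \<phi> (g v) = r v \<odot> g v"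
    and \<psi>: "\<psi> \<in> Z" and s: "\<forall>v\<in>C. \<psi> (g v) = s v \<odot> g v" by (metis quasitorus_centralizerE)
  show "\<phi> \<otimes>\<^bsub>G\<^esub> \<psi> \<in> H"
  proof (rule quasitorus_centralizerI[of _ "\<lambda>v. s v * r v"])
    show "\<phi> \<otimes>\<^bsub>G\<^esub> \<psi> \<in> Z" using G.m_closed[of \<phi> \<psi>] \<phi> \<psi> by simp
    show "(\<phi> \<otimes>\<^bsub>G\<^esub> \<psi>) (g v) = (s v * r v) \<odot> g v" if v: "v \<in> C" for v
      using r s v centralizerD(1)[OF \<phi>] by (simp add: G_mult_apply[OF \<phi> \<psi>] alg_end_smult smult_smult)
  qed
qed

lemma S_normalizes_H:
  assumes "\<phi> \<in> S" "\<psi> \<in> H"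
  shows "\<phi> \<otimes>\<^bsub>G\<^esub> \<psi> \<otimes>\<^bsub>G\<^esub> inv\<^bsub>G\<^esub> \<phi> \<in> H"
proof -
  interpret G: group G by (rule G_group)
  obtain \<sigma> where \<sigma>: "\<phi> = perm_aut \<sigma>" "admissible \<sigma>" using assms(1) by (auto simp: permutation_aut_eq)
  let ?\<tau> = "inv_into UNIV \<sigma>"
  note \<tau> = admissible_inv[OF \<sigma>(2)]
  have \<phi>: "\<phi> \<in> Z" unfolding \<sigma>(1) by (rule perm_aut_centralizes[OF \<sigma>(2)])
  obtain r where \<psi>: "\<psi> \<in> Z" and r: "\<forall>v\<in>C. \<psi> (g v) = r v \<odot> g v" using assms(2) by (rule quasitorus_centralizerE)
  have inv: "inv\<^bsub>G\<^esub> \<phi> = perm_aut ?\<tau>"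
    unfolding \<sigma>(1) by (intro G_inv_eqI perm_aut_centralizes perm_aut_inverse \<tau> \<sigma>(2))
  have \<phi>\<psi>: "\<phi> \<otimes>\<^bsub>G\<^esub> \<psi> \<in> Z" using G.m_closed[of \<phi> \<psi>] \<phi> \<psi> by simp
  note i = G_inv(1)[OF \<phi>]
  show ?thesis
  proof (rule quasitorus_centralizerI[of _ "\<lambda>v. r (?\<tau> v)"])
    show "\<phi> \<otimes>\<^bsub>G\<^esub> \<psi> \<otimes>\<^bsub>G\<^esub> inv\<^bsub>G\<^esub> \<phi> \<in> Z" using G.m_closed[of "\<phi> \<otimes>\<^bsub>G\<^esub> \<psi>" "inv\<^bsub>G\<^esub> \<phi>"] \<phi>\<psi> i by simp
    fix v assume v: "v \<in> C"
    note \<tau>v = admissible_simps(3)[OF \<tau> v]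
    have perm: "\<sigma> permutes W" using \<sigma>(2) by (simp add: admissible_def)
    have "(\<phi> \<otimes>\<^bsub>G\<^esub> \<psi> \<otimes>\<^bsub>G\<^esub> inv\<^bsub>G\<^esub> \<phi>) (g v) = \<phi> (\<psi> (perm_aut ?\<tau> (g v)))"
      unfolding G_mult_apply[OF \<phi>\<psi> i gen_mem[OF v]]
      unfolding inv G_mult_apply[OF \<phi> \<psi> perm_aut_mem[OF \<tau> gen_mem[OF v]]] ..
    also have "\<dots> = \<phi> (r (?\<tau> v) \<odot> g (?\<tau> v))" using r \<tau>v by (simp add: perm_aut_gen[OF \<tau> v])
    also have "\<dots> = r (?\<tau> v) \<odot> \<phi> (g (?\<tau> v))" by (rule alg_end_smult[OF centralizerD(1)[OF \<phi>] gen_mem[OF \<tau>v]])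
    also have "\<phi> (g (?\<tau> v)) = g v"
      unfolding \<sigma>(1) perm_aut_gen[OF \<sigma>(2) \<tau>v] permutes_inverses(1)[OF perm] ..
    finally show "(\<phi> \<otimes>\<^bsub>G\<^esub> \<psi> \<otimes>\<^bsub>G\<^esub> inv\<^bsub>G\<^esub> \<phi>) (g v) = r (?\<tau> v) \<odot> g v" .
  qed
qed

lemma S_Int_H: "S \<inter> H = {\<one>\<^bsub>G\<^esub>}"
proof
  show "{\<one>\<^bsub>G\<^esub>} \<subseteq> S \<inter> H"
    using subgroup.one_closed[OF S_subgroup] subgroup.one_closed[OF H_subgroup] by blast
  show "S \<inter> H \<subseteq> {\<one>\<^bsub>G\<^esub>}"
  proof
    fix \<phi> assume \<phi>SH: "\<phi> \<in> S \<inter> H"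
    then obtain \<sigma> where \<sigma>: "\<phi> = perm_aut \<sigma>" "admissible \<sigma>" by (auto simp: permutation_aut_eq)
    obtain r where r: "\<phi> \<in> Z" "\<forall>v\<in>C. \<phi> (g v) = r v \<odot> g v" using \<phi>SH quasitorus_centralizerE by blast
    have "\<sigma> v = v" for v
    proof (cases "v \<in> W")
      case True
      then have eq: "g (\<sigma> v) = r v \<odot> g v" using r(2) perm_aut_gen[OF \<sigma>(2), of v] \<sigma>(1) by simp
      note \<sigma>v = admissible_simps(4)[OF \<sigma>(2) True]
      have "p (\<sigma> v) = r v * p v" if "p \<in> \<V>" for p using fun_cong[OF eq, of p] that by simp
      then have "q (\<sigma> v) = r v * q v" for q :: "coord \<Rightarrow> 'k"
        using iota_eqD[OF polyfun_var[OF \<sigma>v] polyfun_scale[OF polyfun_var[OF True]]] by blast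
      from this[of "\<lambda>u. if u = v then 0 else 1"] show ?thesis by (auto split: if_splits)
    next
      case False
      then show ?thesis using \<sigma>(2) permutes_not_in by (metis admissible_def)
    qed
    then have "\<sigma> = id" by (simp add: fun_eq_iff)
    then show "\<phi> \<in> {\<one>\<^bsub>G\<^esub>}" using \<sigma>(1) perm_aut_id by (simp add: G_one)
  qed
qed

lemma unipotent_aut_subgroup: "subgroup UU G"
proof (rule group.subgroupI[OF G_group])
  show "UU \<subseteq> carrier G" using U_centralizes by (auto simp: unipotent_aut_eq)
  show "UU \<noteq> {}" using polyfun_const by (auto simp: unipotent_aut_eq)
next
  fix \<phi> assume "\<phi> \<in> UU"
  then obtain F where F: "\<phi> = U F" "F \<in> polyfun W" by (auto simp: unipotent_aut_eq)
  let ?F = "\<lambda>p. (- 1) * F p"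
  have F': "?F \<in> polyfun W" by (rule polyfun_scale[OF F(2)])
  have "compose (carrier B) (U ?F) (U F) = U (\<lambda>_. 0)"
    unfolding U_add[OF F' F(2)] by simp
  then have "inv\<^bsub>G\<^esub> \<phi> = U ?F" unfolding F(1) U_zero by (intro G_inv_eqI U_centralizes F F')
  then show "inv\<^bsub>G\<^esub> \<phi> \<in> UU" using F' unfolding unipotent_aut_eq by blast
next
  fix \<phi> \<psi> assume "\<phi> \<in> UU" "\<psi> \<in> UU"
  then obtain F F' where F: "\<phi> = U F" "F \<in> polyfun W" and F': "\<psi> = U F'" "F' \<in> polyfun W"
    by (auto simp: unipotent_aut_eq)
  have "\<phi> \<otimes>\<^bsub>G\<^esub> \<psi> = U (\<lambda>p. F p + F' p)"
    unfolding F(1) F'(1) G_mult[OF U_centralizes[OF F(2)] U_centralizes[OF F'(2)]] by (rule U_add[OF F(2) F'(2)])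
  then show "\<phi> \<otimes>\<^bsub>G\<^esub> \<psi> \<in> UU" using polyfun_add[OF F(2) F'(2)] unfolding unipotent_aut_eq by blast
qed

text \<open>
  Conjugating \<open>exp(F\<delta>)\<close> by \<open>\<phi>\<close> gives \<open>exp(\<phi>(F)\<delta>)\<close>. It is enough to compare them on elements \<open>f\<close> with
  \<open>\<delta>\<^sup>2 f = 0\<close>, to which \<open>z\<close> and the variables of \<open>W\<close> belong, and there \<open>exp(F\<delta>)(f) = f + F \<delta>(f)\<close>.
\<close>

lemma unipotent_aut_normal: "UU \<lhd> G"
  unfolding group.normal_inv_iff[OF G_group]
proof (intro conjI ballI unipotent_aut_subgroup)
  interpret G: group G by (rule G_group)
  fix \<phi> u assume "\<phi> \<in> carrier G" "u \<in> UU"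
  then obtain F where \<phi>: "\<phi> \<in> Z" and u: "u = U F" and F: "F \<in> polyfun W" by (auto simp: unipotent_aut_eq)
  obtain F' where F': "F' \<in> polyfun W" "\<phi> (\<iota> F) = \<iota> F'" by (rule centralizer_iota[OF \<phi> F])
  note i = G_inv[OF \<phi>] and uZ = U_centralizes[OF F]
  define \<gamma> where "\<gamma> = \<phi> \<otimes>\<^bsub>G\<^esub> u \<otimes>\<^bsub>G\<^esub> inv\<^bsub>G\<^esub> \<phi>"
  have \<phi>u: "\<phi> \<otimes>\<^bsub>G\<^esub> u \<in> Z" using G.m_closed[of \<phi> u] \<phi> uZ u by simp
  have \<gamma>: "\<gamma> \<in> Z" unfolding \<gamma>_def using G.m_closed[of "\<phi> \<otimes>\<^bsub>G\<^esub> u" "inv\<^bsub>G\<^esub> \<phi>"] \<phi>u i(1) by simp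
  have lin: "\<gamma> f = U F' f" if f: "f \<in> carrier B" and 0: "\<delta> (\<delta> f) = \<zero>" for f
  proof -
    let ?h = "(inv\<^bsub>G\<^esub> \<phi>) f"
    have h: "?h \<in> carrier B" by (rule alg_end_closed[OF centralizerD(1)[OF i(1)] f])
    have "\<delta> (\<delta> ?h) = (inv\<^bsub>G\<^esub> \<phi>) (\<delta> (\<delta> f))"
      using centralizerD(3)[OF i(1)] f by (metis \<delta>_mem)
    then have zh: "\<delta> (\<delta> ?h) = \<zero>" unfolding 0 alg_end_zero[OF centralizerD(1)[OF i(1)]] .
    have eq: "U F ?h = ?h \<oplus> \<iota> F \<otimes> \<delta> ?h"
    proof (rule elem_eqI)
      show "U F ?h \<in> carrier B" by (rule alg_end_closed[OF alg_end_U[OF F] h])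
      show "?h \<oplus> \<iota> F \<otimes> \<delta> ?h \<in> carrier B" by (intro add_mem' mult_mem' iota_mem[OF F] \<delta>_mem h)
    qed (use U_linear[OF F h zh] in simp)
    have "\<gamma> f = \<phi> (U F ?h)"
      unfolding \<gamma>_def G_mult_apply[OF \<phi>u i(1) f] unfolding u G_mult_apply[OF \<phi> uZ h] ..
    also have "\<dots> = \<phi> ?h \<oplus> \<phi> (\<iota> F) \<otimes> \<delta> (\<phi> ?h)"
      unfolding eq alg_end_add[OF centralizerD(1)[OF \<phi>] h mult_mem'[OF iota_mem[OF F] \<delta>_mem[OF h]]]
        alg_end_mult[OF centralizerD(1)[OF \<phi>] iota_mem[OF F] \<delta>_mem[OF h]] centralizerD(3)[OF \<phi> h] ..
    also have "\<dots> = f \<oplus> \<iota> F' \<otimes> \<delta> f" unfolding i(2)[OF f] F'(2) ..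
    also have "\<dots> = U F' f"
    proof (rule elem_eqI)
      show "U F' f \<in> carrier B" by (rule alg_end_closed[OF alg_end_U[OF F'(1)] f])
      show "f \<oplus> \<iota> F' \<otimes> \<delta> f \<in> carrier B" by (intro add_mem' mult_mem' iota_mem[OF F'(1)] \<delta>_mem f)
    qed (use U_linear[OF F'(1) f 0] in simp)
    finally show ?thesis .
  qed
  have "\<gamma> = U F'"
  proof (rule alg_end_chart_eqI[OF centralizerD(1)[OF \<gamma>] alg_end_U[OF F'(1)]])
    have 0: "\<delta> \<zero> = \<zero>" using der_\<delta> by simp
    have "\<gamma> (\<iota> M) = \<iota> M"
      using lin[OF iota_M_mem] U_kernel[OF F'(1) iota_M_mem \<delta>_iota[OF M_polyfun]]
      unfolding \<delta>_iota[OF M_polyfun] using 0 by argo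
    then show "\<gamma> (\<iota> M) \<noteq> \<zero>" using iota_M_nonzero by argo
    show "\<gamma> (g v) = U F' (g v)" if "v \<in> W" for v
      using that by (intro lin) (simp_all add: kills_W[OF that] 0)
    show "\<gamma> (g VZ) = U F' (g VZ)" by (rule lin[OF gen_mem[OF VZ_coords] \<delta>_\<delta>_z])
  qed
  then show "\<phi> \<otimes>\<^bsub>G\<^esub> u \<otimes>\<^bsub>G\<^esub> inv\<^bsub>G\<^esub> \<phi> \<in> UU"
    unfolding \<gamma>_def[symmetric] unipotent_aut_eq using F'(1) by blast
qed

text \<open>
  On \<open>z\<close> an element of the first group is a scaling, whereas \<open>exp(F\<delta>)\<close> adds a multiple of \<open>F M\<close>.
\<close>

lemma SH_Int_unipotent_aut: "(S <#>\<^bsub>G\<^esub> H) \<inter> UU = {\<one>\<^bsub>G\<^esub>}"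
proof
  interpret G: group G by (rule G_group)
  have "\<one>\<^bsub>G\<^esub> \<otimes>\<^bsub>G\<^esub> \<one>\<^bsub>G\<^esub> \<in> S <#>\<^bsub>G\<^esub> H"
    using subgroup.one_closed[OF S_subgroup] subgroup.one_closed[OF H_subgroup]
    unfolding set_mult_def by blast
  then have "\<one>\<^bsub>G\<^esub> \<in> S <#>\<^bsub>G\<^esub> H" unfolding G.l_one[OF G.one_closed] .
  then show "{\<one>\<^bsub>G\<^esub>} \<subseteq> (S <#>\<^bsub>G\<^esub> H) \<inter> UU" using subgroup.one_closed[OF unipotent_aut_subgroup] by simp
  show "(S <#>\<^bsub>G\<^esub> H) \<inter> UU \<subseteq> {\<one>\<^bsub>G\<^esub>}"
  proof
    fix \<phi> assume \<phi>: "\<phi> \<in> (S <#>\<^bsub>G\<^esub> H) \<inter> UU"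
    then obtain s h where sh: "s \<in> S" "h \<in> H" "\<phi> = s \<otimes>\<^bsub>G\<^esub> h" by (auto simp: set_mult_def)
    obtain F where F: "\<phi> = U F" "F \<in> polyfun W" using \<phi> by (auto simp: unipotent_aut_eq)
    obtain \<sigma> where \<sigma>: "s = perm_aut \<sigma>" "admissible \<sigma>" using sh(1) by (auto simp: permutation_aut_eq)
    have s: "s \<in> Z" unfolding \<sigma>(1) by (rule perm_aut_centralizes[OF \<sigma>(2)])
    obtain r where h: "h \<in> Z" and r: "\<forall>v\<in>C. h (g v) = r v \<odot> g v" using sh(2) by (rule quasitorus_centralizerE)
    have z: "\<phi> (g VZ) = r VZ \<odot> g VZ"
      unfolding sh(3) G_mult_apply[OF s h gen_mem[OF VZ_coords]] r[rule_format, OF VZ_coords]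
        alg_end_smult[OF centralizerD(1)[OF s] gen_mem[OF VZ_coords]]
      unfolding \<sigma>(1) perm_aut_gen[OF \<sigma>(2) VZ_coords] admissible_simps(1)[OF \<sigma>(2)] ..
    have "\<delta> (\<phi> (g VZ)) = \<delta> (g VZ)"
      unfolding F(1) U_commutes[OF F(2) gen_mem[OF VZ_coords], symmetric]
      by (rule U_kernel[OF F(2) \<delta>_mem[OF gen_mem[OF VZ_coords]] \<delta>_\<delta>_z])
    then have eq: "r VZ \<odot> \<delta> (g VZ) = \<delta> (g VZ)"
      unfolding z derivation_smult[OF der_\<delta> gen_mem[OF VZ_coords]] .
    obtain p where p: "p \<in> \<V>" "\<And>v. v \<in> C \<Longrightarrow> p v \<noteq> 0" using generic_point by blast
    then have "M p \<noteq> 0" by (simp add: monomial_def)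
    then have "r VZ = 1" using fun_cong[OF eq, of p] p(1) \<delta>_z[OF p(1)] c_nonzero by simp
    then have "F p * M p = 0 * M p" if "p \<in> \<V>" for p
      using U_z[OF F(2) that] fun_cong[OF z, of p] that c_nonzero unfolding F(1) by simp
    then have "F q = 0" for q using iota_M_cancel[OF F(2) polyfun_const[of 0]] by blast
    then have "F = (\<lambda>_. 0)" by blast
    then show "\<phi> \<in> {\<one>\<^bsub>G\<^esub>}" using F(1) U_zero G_one by simp
  qed
qed

text \<open>
  After composing with a suitable \<open>exp(F\<delta>)\<close> an automorphism rescales \<open>z\<close>; it is then a
  permutation of the variables followed by a rescaling.
\<close>

lemma centralizer_factor:
  assumes \<phi>: "\<phi> \<in> Z"
  shows "\<exists>u\<in>UU. u \<otimes>\<^bsub>G\<^esub> \<phi> \<in> S <#>\<^bsub>G\<^esub> H"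
proof -
  interpret G: group G by (rule G_group)
  note endo = centralizerD(1)[OF \<phi>]
  obtain h \<beta> where h: "h \<in> polyfun W" and \<beta>: "\<beta> ^ n = 1" "\<beta> \<noteq> 0"
    and z: "\<forall>p\<in>\<V>. \<phi> (g VZ) p = h p * M p + \<beta> * p VZ"
    and M: "\<forall>p\<in>\<V>. \<phi> (\<iota> M) p = \<beta> * M p" by (rule centralizer_z[OF \<phi>])
  \<comment> \<open>Chosen so that the translation by \<open>\<beta> F c M\<close> cancels \<open>h M\<close>.\<close>
  define F where "F = (\<lambda>p. - (1 / (\<beta> * c)) * h p)"
  have F: "F \<in> polyfun W" unfolding F_def by (rule polyfun_scale[OF h])
  let ?\<psi> = "U F \<otimes>\<^bsub>G\<^esub> \<phi>"
  note uZ = U_centralizes[OF F]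
  have \<psi>: "?\<psi> \<in> Z" using G.m_closed[of "U F" \<phi>] uZ \<phi> by simp
  have \<psi>z: "?\<psi> (g VZ) = \<beta> \<odot> g VZ"
  proof (rule elem_eqI)
    show "?\<psi> (g VZ) \<in> carrier B" by (rule alg_end_closed[OF centralizerD(1)[OF \<psi>] gen_mem[OF VZ_coords]])
    show "\<beta> \<odot> g VZ \<in> carrier B" by simp
    fix p assume p: "p \<in> \<V>"
    have hM: "(\<lambda>p. h p * M p) \<in> polyfun W" by (intro polyfun_mult h M_polyfun)
    have mem: "\<beta> \<odot> g VZ \<in> carrier B" by simp
    have eq: "\<phi> (g VZ) = \<iota> (\<lambda>p. h p * M p) \<oplus> \<beta> \<odot> g VZ"
      by (rule elem_eqI[OF alg_end_closed[OF endo gen_mem[OF VZ_coords]] add_mem'[OF iota_mem[OF hM] mem]])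
        (use z in simp)
    have "?\<psi> (g VZ) = \<iota> (\<lambda>p. h p * M p) \<oplus> \<beta> \<odot> U F (g VZ)"
      unfolding G_mult_apply[OF uZ \<phi> gen_mem[OF VZ_coords]] eq
        alg_end_add[OF alg_end_U[OF F] iota_mem[OF hM] mem]
        alg_end_smult[OF alg_end_U[OF F] gen_mem[OF VZ_coords]]
        U_kernel[OF F iota_mem[OF hM] \<delta>_iota[OF hM]] ..
    then have "?\<psi> (g VZ) p = h p * M p + \<beta> * (p VZ + F p * (c * M p))"
      using p U_z[OF F p] by simp
    also have "\<dots> = \<beta> * p VZ" using \<beta>(2) c_nonzero by (simp add: F_def field_simps)
    finally show "?\<psi> (g VZ) p = (\<beta> \<odot> g VZ) p" using p by simp
  qed
  obtain \<sigma> r where \<sigma>: "admissible \<sigma>" and r0: "\<forall>v\<in>W. r v \<noteq> 0"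
    and r: "\<forall>v\<in>W. \<forall>p\<in>\<V>. ?\<psi> (g v) p = r v * p (\<sigma> v)" by (rule centralizer_permutation[OF \<psi>])
  let ?s = "perm_aut \<sigma>" and ?s' = "perm_aut (inv_into UNIV \<sigma>)"
  have perm: "\<sigma> permutes W" using \<sigma> by (simp add: admissible_def)
  note \<tau> = admissible_inv[OF \<sigma>] and s = perm_aut_centralizes[OF \<sigma>] and s' = perm_aut_centralizes[OF admissible_inv[OF \<sigma>]]
  define t where "t = ?s' \<otimes>\<^bsub>G\<^esub> ?\<psi>"
  have t: "t \<in> Z" unfolding t_def using G.m_closed[of ?s' ?\<psi>] s' \<psi> by simp
  have tW: "t (g v) = r v \<odot> g v" if v: "v \<in> W" for v
  proof -
    note \<sigma>v = admissible_simps(4)[OF \<sigma> v]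
    have vC: "v \<in> C" "\<sigma> v \<in> C" using v \<sigma>v by auto
    have "?\<psi> (g v) = r v \<odot> g (\<sigma> v)"
      by (rule elem_eqI[OF alg_end_closed[OF centralizerD(1)[OF \<psi>] gen_mem[OF vC(1)]] smult_mem[OF gen_mem[OF vC(2)]]])
        (use r v in simp)
    then show ?thesis
      unfolding t_def G_mult_apply[OF s' \<psi> gen_mem[OF vC(1)]]
      by (simp only: alg_end_smult[OF centralizerD(1)[OF s'] gen_mem[OF vC(2)]] perm_aut_gen[OF \<tau> vC(2)]
          permutes_inverses(2)[OF perm])
  qed
  have tz: "t (g VZ) = \<beta> \<odot> g VZ"
    unfolding t_def G_mult_apply[OF s' \<psi> gen_mem[OF VZ_coords]] \<psi>z
      alg_end_smult[OF centralizerD(1)[OF s'] gen_mem[OF VZ_coords]] perm_aut_gen[OF \<tau> VZ_coords]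
      admissible_simps(1)[OF \<tau>] ..
  define \<rho> where "\<rho> = (\<Prod>v\<in>W. r v ^ \<alpha> v)"
  have \<rho>0: "\<rho> \<noteq> 0" using r0 by (simp add: \<rho>_def)
  have tM: "t (\<iota> M) p = \<rho> * M p" if p: "p \<in> \<V>" for p
  proof -
    have "t (\<iota> M) p = (\<Prod>v\<in>W. (r v * p v) ^ \<alpha> v)"
      unfolding alg_end_M[OF centralizerD(1)[OF t] p] using tW p by (intro prod.cong) auto
    then show ?thesis by (simp add: \<rho>_def monomial_def power_mult_distrib prod.distrib)
  qed
  have tx: "t (g (VX i)) = (1 / \<rho>) \<odot> g (VX i)"
  proof (rule mult_cancel[OF alg_end_closed[OF centralizerD(1)[OF t] gen_mem[OF VX_i_coords]] _ iota_M_mem iota_M_nonzero])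
    fix p assume p: "p \<in> \<V>"
    have "t (g (VX i)) p * (\<rho> * M p) = p (VX i) * M p"
      using alg_end_x[OF centralizerD(1)[OF t] p] tM[OF p] on_hypersurface[OF p] p \<beta>(1)
      unfolding tz by (simp add: power_mult_distrib)
    then show "\<iota> M p * t (g (VX i)) p = \<iota> M p * ((1 / \<rho>) \<odot> g (VX i)) p"
      using \<rho>0 p by (simp add: field_simps)
  qed simp
  have "t \<in> H"
  proof (rule quasitorus_centralizerI[OF t, of "\<lambda>v. if v = VZ then \<beta> else if v = VX i then 1 / \<rho> else r v"])
    fix v assume "v \<in> C"
    then show "t (g v) = (if v = VZ then \<beta> else if v = VX i then 1 / \<rho> else r v) \<odot> g v"
      using tW[of v] tz tx by (cases "v \<in> W") auto
  qed
  moreover have "?s \<in> S" using \<sigma> unfolding permutation_aut_eq by blast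
  moreover have "?\<psi> = ?s \<otimes>\<^bsub>G\<^esub> t"
  proof -
    have "?s \<otimes>\<^bsub>G\<^esub> ?s' = \<one>\<^bsub>G\<^esub>" unfolding G_mult[OF s s'] perm_aut_inverse(2)[OF \<sigma>] G_one ..
    then show ?thesis
      unfolding t_def using G.m_assoc[of ?s ?s' ?\<psi>] s s' \<psi> by simp
  qed
  ultimately have "?\<psi> \<in> S <#>\<^bsub>G\<^esub> H" unfolding set_mult_def by blast
  then show ?thesis using F unfolding unipotent_aut_eq by blast
qed

theorem centralizer_decomposition:
  "internal_semidirect G (S <#>\<^bsub>G\<^esub> H) UU" "internal_semidirect (G\<lparr>carrier := S <#>\<^bsub>G\<^esub> H\<rparr>) S H"
proof -
  interpret G: group G by (rule G_group)
  note sd = G.semidirect_of_normalizing[OF S_subgroup H_subgroup S_normalizes_H S_Int_H]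
  show "internal_semidirect (G\<lparr>carrier := S <#>\<^bsub>G\<^esub> H\<rparr>) S H" by (rule sd(2))
  have "carrier G \<subseteq> UU <#>\<^bsub>G\<^esub> (S <#>\<^bsub>G\<^esub> H)"
  proof
    fix \<phi> assume \<phi>: "\<phi> \<in> carrier G"
    then obtain u where u: "u \<in> UU" "u \<otimes>\<^bsub>G\<^esub> \<phi> \<in> S <#>\<^bsub>G\<^esub> H" using centralizer_factor by auto
    have uG: "u \<in> carrier G" using subgroup.mem_carrier[OF unipotent_aut_subgroup u(1)] .
    then have "\<phi> = inv\<^bsub>G\<^esub> u \<otimes>\<^bsub>G\<^esub> (u \<otimes>\<^bsub>G\<^esub> \<phi>)"
      using G.m_assoc[OF G.inv_closed[OF uG] uG \<phi>] G.l_inv[OF uG] G.l_one[OF \<phi>] by argo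
    moreover have "inv\<^bsub>G\<^esub> u \<in> UU" by (rule subgroup.m_inv_closed[OF unipotent_aut_subgroup u(1)])
    ultimately show "\<phi> \<in> UU <#>\<^bsub>G\<^esub> (S <#>\<^bsub>G\<^esub> H)" using u(2) unfolding set_mult_def by blast
  qed
  moreover have "(S <#>\<^bsub>G\<^esub> H) <#>\<^bsub>G\<^esub> UU = UU <#>\<^bsub>G\<^esub> (S <#>\<^bsub>G\<^esub> H)"
    by (rule G.commut_normal[OF sd(1) unipotent_aut_normal])
  moreover have "(S <#>\<^bsub>G\<^esub> H) <#>\<^bsub>G\<^esub> UU \<subseteq> carrier G"
    by (rule G.set_mult_closed[OF subgroup.subset[OF sd(1)] subgroup.subset[OF unipotent_aut_subgroup]])
  ultimately show "internal_semidirect G (S <#>\<^bsub>G\<^esub> H) UU"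
    unfolding internal_semidirect_def using G_group sd(1) unipotent_aut_normal SH_Int_unipotent_aut by blast
qed

end


section \<open>Homogeneous locally nilpotent derivations\<close>

text \<open>
  The generator \<open>v\<close> has weight \<open>\<tau> v\<close>; the assumptions say that both monomials of the equation have
  weight \<open>0\<close>, so that the subgroup acts on the hypersurface and its grading is coarser than the one
  by the degree group.
\<close>

locale one_parameter_subgroup = hypersurface_ring k m n a B
  for k m n :: nat and a :: "nat \<Rightarrow> nat"
    and B :: "('k::{alg_closed_field, field_char_0}, (coord \<Rightarrow> 'k) \<Rightarrow> 'k) module" (structure) +
  fixes \<tau> :: "coord \<Rightarrow> int"
  assumes \<tau>_VZ: "\<tau> VZ = 0" and \<tau>_balanced: "(\<Sum>v\<in>C. \<tau> v * int (\<alpha> v)) = 0"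
begin

definition action :: "'k \<Rightarrow> (coord \<Rightarrow> 'k) \<Rightarrow> coord \<Rightarrow> 'k" where
  "action t p = (\<lambda>v\<in>C. t powi \<tau> v * p v)"

definition exponent_weight :: "(coord \<Rightarrow> nat) \<Rightarrow> int" where
  "exponent_weight e = (\<Sum>v\<in>C. \<tau> v * int (e v))"

definition has_weight :: "((coord \<Rightarrow> 'k) \<Rightarrow> 'k) \<Rightarrow> int \<Rightarrow> bool" where
  "has_weight f d \<longleftrightarrow> (\<forall>p\<in>\<V>. \<forall>t. t \<noteq> 0 \<longrightarrow> f (action t p) = t powi d * f p)"

lemma monomial_action:
  assumes "t \<noteq> 0"
  shows "(\<Prod>v\<in>C. action t p v ^ e v) = t powi exponent_weight e * (\<Prod>v\<in>C. p v ^ e v)"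
proof -
  have powi_sum: "(\<Prod>v\<in>J. t powi w v) = t powi (\<Sum>v\<in>J. w v)" if "finite J" for w and J :: "coord set"
    using that by (induction J rule: finite_induct) (use assms in \<open>auto simp: power_int_add\<close>)
  have "(\<Prod>v\<in>C. action t p v ^ e v) = (\<Prod>v\<in>C. t powi (\<tau> v * int (e v)) * p v ^ e v)"
    by (rule prod.cong) (auto simp: action_def power_mult_distrib power_int_mult)
  then show ?thesis by (simp add: prod.distrib powi_sum exponent_weight_def)
qed

lemma action_mem: assumes t: "t \<noteq> 0" and p: "p \<in> \<V>" shows "action t p \<in> \<V>"
proof -
  have eq: "monomial (C - {VZ}) \<alpha> q = (\<Prod>v\<in>C. q v ^ \<alpha> v)" for q :: "coord \<Rightarrow> 'k"
    unfolding monomial_def using prod.remove[of C VZ "\<lambda>v. q v ^ \<alpha> v"] by simp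
  have "exponent_weight \<alpha> = 0" using \<tau>_balanced by (simp add: exponent_weight_def)
  then have "monomial (C - {VZ}) \<alpha> (action t p) = monomial (C - {VZ}) \<alpha> p"
    unfolding eq monomial_action[OF t] by simp
  moreover have "action t p VZ = p VZ" by (simp add: action_def \<tau>_VZ)
  ultimately show ?thesis using p by (simp add: hypersurface_iff) (simp add: action_def)
qed

text \<open>
  The weight is a homomorphism to the integers that vanishes on both generators of the lattice.
\<close>

lemma relation_weight:
  assumes "x \<in> R"
  shows "Poly_Mapping.keys x \<subseteq> C \<and> (\<Sum>v\<in>C. \<tau> v * poly_mapping.lookup x v) = 0"
  using assms unfolding relation_lattice_def
proof (induction rule: generate.induct)
  case one
  then show ?case by simp
next
  case (incl x)
  have "(\<Sum>v\<in>C. \<tau> v * int (z_exponent n v)) = 0"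
    by (rule sum.neutral) (simp add: z_exponent_def \<tau>_VZ)
  moreover have "Poly_Mapping.keys x \<subseteq> C" using incl relation_generators by auto
  ultimately show ?case using incl \<tau>_balanced by (auto simp: lookup_exponent_vector)
next
  case (inv x)
  have "(\<Sum>v\<in>C. \<tau> v * int (z_exponent n v)) = 0"
    by (rule sum.neutral) (simp add: z_exponent_def \<tau>_VZ)
  moreover have keys: "Poly_Mapping.keys x \<subseteq> C" using inv relation_generators by auto
  ultimately show ?case using inv \<tau>_balanced
    by (auto simp: lookup_exponent_vector sum_negf)
next
  case (eng x y)
  then show ?case using keys_add[of x y] by (auto simp: lookup_add distrib_left sum.distrib)
qed

lemma degree_class_weight:
  assumes "degree_class k m n a (exponent_vector C e) = degree_class k m n a (exponent_vector C e')"
  shows "exponent_weight e = exponent_weight e'"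
proof -
  interpret N: normal R A by (rule relation_normal)
  have mem: "exponent_vector C e \<in> carrier A" "exponent_vector C e' \<in> carrier A"
    by (simp_all add: exponent_vector_keys)
  have "exponent_vector C e \<in> R #>\<^bsub>A\<^esub> exponent_vector C e'"
    using N.rcos_self[OF mem(1) N.is_subgroup] assms by (simp add: degree_class_def)
  then obtain x where x: "x \<in> R" "exponent_vector C e = x + exponent_vector C e'"
    by (auto simp: r_coset_def)
  have w: "exponent_weight f = (\<Sum>v\<in>C. \<tau> v * poly_mapping.lookup (exponent_vector C f) v)" for f
    by (simp add: exponent_weight_def lookup_exponent_vector)
  show ?thesis unfolding w[of e] x(2) using relation_weight[OF x(1)]
    by (simp add: w[of e'] lookup_add distrib_left sum.distrib)
qed

lemma homogeneous_weightE:
  assumes "homogeneous k m n a f"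
  obtains d E c where "has_weight f d" "finite E" "f = (\<lambda>p\<in>\<V>. poly_value C E c p)"
    "\<forall>e\<in>E. exponent_weight e = d"
proof -
  obtain w E c where E: "finite E" and f: "f = (\<lambda>p\<in>\<V>. poly_value C E c p)"
    and w: "\<forall>e\<in>E. degree_class k m n a (exponent_vector C e) = w"
    using assms unfolding homogeneous_def graded_piece_def by blast
  obtain d where d: "\<forall>e\<in>E. exponent_weight e = d"
    using degree_class_weight w by (metis)
  have "f (action t p) = t powi d * f p" if p: "p \<in> \<V>" and t: "t \<noteq> 0" for p t
  proof -
    have "f (action t p) = (\<Sum>e\<in>E. c e * (\<Prod>v\<in>C. action t p v ^ e v))"
      using action_mem[OF t p] by (simp add: f poly_value_def)
    also have "\<dots> = (\<Sum>e\<in>E. t powi d * (c e * (\<Prod>v\<in>C. p v ^ e v)))"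
      by (rule sum.cong) (simp_all add: monomial_action[OF t] d)
    finally show ?thesis using p by (simp add: f poly_value_def sum_distrib_left)
  qed
  then have "has_weight f d" by (simp add: has_weight_def)
  then show thesis using that E f d by blast
qed

lemma powi_2_eq_iff: "(2 :: 'k) powi x = 2 powi y \<longleftrightarrow> x = y"
proof
  have less: False if "x < y" "(2 :: 'k) powi x = 2 powi y" for x y :: int
  proof -
    have "(2 :: 'k) powi y = 2 powi x * 2 powi (y - x)" by (simp add: power_int_add[symmetric])
    then have "(2 :: 'k) powi (y - x) = 1" using that(2) by simp
    then have "(2 :: 'k) ^ nat (y - x) = 1" using that(1) by (simp add: power_int_def)
    then have "of_nat (2 ^ nat (y - x)) = (of_nat 1 :: 'k)" by simp
    then have "(2::nat) ^ nat (y - x) = 1" by (simp only: of_nat_eq_iff)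
    then show False using that(1) by simp
  qed
  assume "(2 :: 'k) powi x = 2 powi y"
  then show "x = y" using less[of x y] less[of y x] by (cases x y rule: linorder_cases) auto
qed simp

lemma has_weight_unique:
  assumes "f \<in> carrier B" "f \<noteq> \<zero>" "has_weight f d" "has_weight f d'"
  shows "d = d'"
proof -
  obtain p where "p \<in> \<V>" "f p \<noteq> 0" using nonzeroE assms by blast
  then have "(2 :: 'k) powi d * f p = 2 powi d' * f p"
    using assms(3,4) unfolding has_weight_def by (metis zero_neq_numeral)
  then show ?thesis using \<open>f p \<noteq> 0\<close> by (simp add: powi_2_eq_iff)
qed

lemma has_weight_mult:
  "has_weight f d \<Longrightarrow> has_weight h d' \<Longrightarrow> has_weight (f \<otimes> h) (d + d')"
  by (auto simp: has_weight_def power_int_add action_mem)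

lemma has_weight_gen: "v \<in> C \<Longrightarrow> has_weight (g v) (\<tau> v)"
  using action_mem by (auto simp: has_weight_def) (simp add: action_def)

text \<open>
  A sum of two homogeneous elements can only be homogeneous if the weights agree; comparing the actions
  of \<open>2\<close> and \<open>4 = 2\<^sup>2\<close> is enough to see it.
\<close>

lemma sum_has_weight:
  assumes f: "f \<in> carrier B" "f \<noteq> \<zero>" "has_weight f d" and h: "h \<in> carrier B" "h \<noteq> \<zero>" "has_weight h d'"
    and sum: "has_weight (f \<oplus> h) s"
  shows "d = d'"
proof -
  obtain p where p: "p \<in> \<V>" "f p \<noteq> 0" "h p \<noteq> 0" using common_nonzero f h by metis
  have act: "t powi d * f p + t powi d' * h p = t powi s * (f p + h p)" if t: "t \<noteq> 0" for t
    using sum f(3) h(3) p(1) t action_mem[OF t p(1)] unfolding has_weight_def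
    by (metis eval_add)
  define x y z :: 'k where "x = 2 powi d" and "y = 2 powi d'" and "z = 2 powi s"
  have four: "(4 :: 'k) powi e = 2 powi e * 2 powi e" for e
    by (simp add: power_int_mult_distrib[symmetric])
  have 1: "(x - z) * f p + (y - z) * h p = 0"
    using act[of 2] by (simp add: x_def y_def z_def algebra_simps)
  have 2: "(x * x - z * z) * f p + (y * y - z * z) * h p = 0"
    using act[of 4] unfolding four by (simp add: x_def y_def z_def algebra_simps)
  have "(x - z) * (x - y) * f p = 0"
  proof -
    have "(x - z) * (x - y) * f p = ((x * x - z * z) * f p + (y * y - z * z) * h p)
        - (y + z) * ((x - z) * f p + (y - z) * h p)" by (simp add: algebra_simps)
    then show ?thesis using 1 2 by simp
  qed
  then consider "x = y" | "x = z" using p(2) by auto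
  then have "x = y"
  proof cases
    case 2
    then show ?thesis using 1 p(3) by simp
  qed
  then show ?thesis by (simp add: x_def y_def powi_2_eq_iff)
qed

end

context hypersurface_ring
begin

lemma homogeneous_mem: "homogeneous k m n a f \<Longrightarrow> f \<in> carrier B"
  unfolding homogeneous_def graded_piece_def using poly_value_polyfun polyfun_mem by auto

lemma degree_class_mem:
  "degree_class k m n a (exponent_vector C e) \<in> carrier (degree_group k m n a)"
  unfolding degree_group_def carrier_FactGroup degree_class_def
  by (intro imageI) (simp add: exponent_vector_keys)

lemma homogeneous_gen: assumes v: "v \<in> C" shows "homogeneous k m n a (g v)"
proof -
  define e where "e u = (if u = v then 1 else 0 :: nat)" for u
  have "(\<Prod>u\<in>C. p u ^ e u) = p v" for p :: "coord \<Rightarrow> 'k"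
  proof -
    have "(\<Prod>u\<in>C. p u ^ e u) = (\<Prod>u\<in>C. if u = v then p u else 1)"
      by (rule prod.cong) (auto simp: e_def)
    then show ?thesis using v by simp
  qed
  then have "g v = (\<lambda>p\<in>\<V>. poly_value C {e} (\<lambda>_. 1) p)" by (auto simp: gen_def poly_value_def)
  then show ?thesis unfolding homogeneous_def graded_piece_def
    by (intro bexI[OF _ degree_class_mem[of e]] CollectI exI[of _ "{e}"] exI[of _ "\<lambda>_. 1"]) auto
qed

lemma exponent_vector_shift:
  assumes "v \<in> C"
  shows "exponent_vector C (e(v := Suc (e v))) = frag_of v + exponent_vector C e"
proof (rule poly_mapping_eqI)
  fix u
  have out: "poly_mapping.lookup (exponent_vector C e) u = 0" if "u \<notin> C" for e
    using exponent_vector_keys[OF finite_coords, of e] that by (auto simp: in_keys_iff)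
  show "poly_mapping.lookup (exponent_vector C (e(v := Suc (e v)))) u
      = poly_mapping.lookup (frag_of v + exponent_vector C e) u"
    by (cases "u \<in> C") (use assms in \<open>auto simp: lookup_exponent_vector lookup_add out\<close>)
qed

lemma homogeneous_gen_mult:
  assumes v: "v \<in> C" and f: "homogeneous k m n a f"
  shows "homogeneous k m n a (g v \<otimes> f)"
proof -
  obtain w E c where wm: "w \<in> carrier (degree_group k m n a)" and E: "finite E"
    and f: "f = (\<lambda>p\<in>\<V>. poly_value C E c p)"
    and w: "\<forall>e\<in>E. degree_class k m n a (exponent_vector C e) = w"
    using f unfolding homogeneous_def graded_piece_def by blast
  interpret N: normal R A by (rule relation_normal)
  define s where "s e = e(v := Suc (e v))" for e :: "coord \<Rightarrow> nat"
  define c' where "c' e = c (e(v := e v - 1))" for e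
  have inj: "inj_on s E" by (rule inj_on_inverseI[of _ "\<lambda>e. e(v := e v - 1)"]) (simp add: s_def)
  have "g v \<otimes> f = (\<lambda>p\<in>\<V>. poly_value C (s ` E) c' p)"
  proof -
    have "p v * poly_value C E c p = poly_value C (s ` E) c' p" for p :: "coord \<Rightarrow> 'k"
    proof -
      have "poly_value C (s ` E) c' p = (\<Sum>e\<in>E. c' (s e) * monomial C (s e) p)"
        unfolding poly_value_def sum.reindex[OF inj] by (simp add: monomial_def)
      also have "\<dots> = (\<Sum>e\<in>E. p v * (c e * monomial C e p))"
        by (rule sum.cong) (simp_all add: s_def c'_def monomial_Suc[OF finite_coords v])
      finally show ?thesis by (simp add: poly_value_def monomial_def sum_distrib_left)
    qed
    then show ?thesis using v by (auto simp: mult_eq f gen_def)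
  qed
  moreover have "degree_class k m n a (exponent_vector C e)
      = degree_class k m n a (frag_of v) <#>\<^bsub>A\<^esub> w" if e: "e \<in> s ` E" for e
  proof -
    obtain e0 where e0: "e0 \<in> E" "e = s e0" using e by blast
    have "degree_class k m n a (frag_of v) <#>\<^bsub>A\<^esub> degree_class k m n a (exponent_vector C e0)
        = degree_class k m n a (frag_of v + exponent_vector C e0)"
      using N.rcos_sum[of "frag_of v" "exponent_vector C e0"] v
      by (simp add: degree_class_def exponent_vector_keys)
    then show ?thesis using w e0 v by (simp add: s_def exponent_vector_shift)
  qed
  moreover have "degree_class k m n a (frag_of v) <#>\<^bsub>A\<^esub> w \<in> carrier (degree_group k m n a)"
  proof -
    have "degree_class k m n a (frag_of v) \<in> carrier (A Mod R)"
      unfolding degree_class_def carrier_FactGroup by (intro imageI) (use v in simp)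
    then show ?thesis
      using monoid.m_closed[OF group.is_monoid[OF N.factorgroup_is_group]] wm by (simp add: degree_group_def)
  qed
  ultimately show ?thesis
    unfolding homogeneous_def graded_piece_def using E by blast
qed

lemma poly_value_divisible:
  assumes v: "v \<in> C" and pos: "\<And>e. e \<in> E \<Longrightarrow> e v > 0" and f: "f = (\<lambda>p\<in>\<V>. poly_value C E c p)"
  obtains h where "h \<in> carrier B" "f = g v \<otimes> h"
proof -
  define H where "H p = (\<Sum>e\<in>E. c e * monomial C (e(v := e v - 1)) p)" for p :: "coord \<Rightarrow> 'k"
  have H: "H \<in> polyfun C"
    unfolding H_def[abs_def] by (intro polyfun_sum polyfun_scale polyfun_monomial) simp
  have "poly_value C E c p = p v * H p" for p :: "coord \<Rightarrow> 'k"
    unfolding poly_value_def H_def sum_distrib_left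
  proof (rule sum.cong)
    fix e assume e: "e \<in> E"
    have "e = (e(v := e v - 1))(v := Suc ((e(v := e v - 1)) v))" using pos[OF e] by auto
    then have "monomial C e p = p v * monomial C (e(v := e v - 1)) p"
      using monomial_Suc[OF finite_coords v] by metis
    then show "c e * (\<Prod>v\<in>C. p v ^ e v) = p v * (c e * monomial C (e(v := e v - 1)) p)"
      by (simp add: monomial_def)
  qed simp
  then have "f = g v \<otimes> (\<lambda>p\<in>\<V>. H p)" by (auto simp: f mult_eq gen_def)
  then show thesis using that polyfun_mem[OF H] by blast
qed

lemma derivation_eq_zero_map:
  assumes D: "derivation B D" and kill: "\<And>v. v \<in> C \<Longrightarrow> D (g v) = \<zero>"
  shows "D = zero_map B"
proof (rule extensionalityI[of _ "carrier B"])
  show "D \<in> extensional (carrier B)" using D by (auto simp: derivation_def PiE_def)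
  fix f assume "f \<in> carrier B"
  then obtain F where F: "F \<in> polyfun C" "f = (\<lambda>p\<in>\<V>. F p)" by (rule carrierE)
  have "D f = \<zero>" unfolding F(2) by (rule derivation_kills_polyfun[OF D F(1) subset_refl kill])
  then show "D f = zero_map B f" using \<open>f \<in> carrier B\<close> by (simp add: zero_map_def)
qed (simp add: zero_map_def)

lemma kernel_pow:
  assumes D: "lnd B D" and f: "f \<in> carrier B" "f \<noteq> \<zero>" and j: "j > 0" and 0: "D (f [^] (j::nat)) = \<zero>"
  shows "D f = \<zero>"
proof -
  obtain d where d: "lnd_degree D f d" using lnd_degree_exists[OF D f] by blast
  note dj = lnd_degree_pow[OF D f(1) d, of j]
  then have "lnd_degree D (f [^] j) 0" using lnd_degree_nonzero[OF D dj] 0 by (simp add: lnd_degree_0_iff)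
  then have "j * d = 0" using lnd_degree_unique[OF D dj] by blast
  then show ?thesis using d j by (simp add: lnd_degree_0_iff)
qed

lemma generator_relation:
  assumes u: "u \<in> C - {VZ}"
  shows "g u [^] \<alpha> u \<otimes> (\<lambda>p\<in>\<V>. cofactor u p) = g VZ [^] n \<oplus> \<one>"
proof -
  show ?thesis
    by (rule elem_eqI) (use u on_hypersurface_cofactor[OF u] cofactor_mem[of u] in auto)
qed

text \<open>
  If \<open>z\<close> were killed, so would be \<open>z\<^sup>n + 1\<close>, and hence all variables, being factors of it.
\<close>

lemma lnd_moves_VZ:
  assumes D: "lnd B D" and nz: "D \<noteq> zero_map B"
  shows "D (g VZ) \<noteq> \<zero>"
proof
  note der = lnd_derivation[OF D]
  assume 0: "D (g VZ) = \<zero>"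
  have "D (g u) = \<zero>" if u: "u \<in> C - {VZ}" for u
  proof -
    let ?N = "\<lambda>p\<in>\<V>. cofactor u p"
    note N = cofactor_mem[of u]
    have uC: "u \<in> C" using u by simp
    have "D (g VZ [^] n) = \<zero>"
      by (rule elem_eqI) (use der 0 in \<open>auto simp: derivation_pow\<close>)
    then have D0: "D (g u [^] \<alpha> u \<otimes> ?N) = \<zero>"
      unfolding generator_relation[OF u] using der by (simp add: derivation_add)
    have "D (g u [^] \<alpha> u) = \<zero>"
      by (rule kernel_factor[OF D pow_mem[OF gen_mem[OF uC]] N D0 gen_pow_cofactor_nonzero[OF uC]])
    moreover have "\<alpha> u > 0" using exponent_pos[OF u] by linarith
    ultimately show ?thesis using kernel_pow[OF D gen_mem[OF uC] gen_nonzero[OF uC]] by blast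
  qed
  then have "D = zero_map B" using 0 by (intro derivation_eq_zero_map[OF der]) auto
  then show False using nz by simp
qed

text \<open>
  Otherwise \<open>z\<^sup>n + 1\<close> would be killed, and hence \<open>z\<close>.
\<close>

lemma lnd_moves_variable:
  assumes D: "lnd B D" and nz: "D \<noteq> zero_map B"
  shows "\<exists>u\<in>C - {VZ}. D (g u) \<noteq> \<zero>"
proof (rule ccontr)
  note der = lnd_derivation[OF D]
  assume "\<not> ?thesis"
  then have kill: "\<And>u. u \<in> C - {VZ} \<Longrightarrow> D (g u) = \<zero>" by blast
  have "monomial (C - {VZ}) \<alpha> \<in> polyfun (C - {VZ})" by (rule polyfun_monomial) simp
  from derivation_kills_polyfun[OF der this _ kill]
  have 0: "D (\<lambda>p\<in>\<V>. monomial (C - {VZ}) \<alpha> p) = \<zero>" by blast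
  have eq: "(\<lambda>p\<in>\<V>. monomial (C - {VZ}) \<alpha> p) = g VZ [^] n \<oplus> \<one>"
    by (rule elem_eqI[OF polyfun_mem[OF polyfun_monomial]]) (auto simp: hypersurface_iff)
  have "D (g VZ [^] n) = \<zero>" using 0 unfolding eq using der by (simp add: derivation_add)
  moreover have "n > 0" using n_ge by linarith
  ultimately have "D (g VZ) = \<zero>"
    using kernel_pow[OF D gen_mem[OF VZ_coords] gen_nonzero[OF VZ_coords]] by blast
  then show False using lnd_moves_VZ[OF D nz] by simp
qed

text \<open>
  If two variables \<open>u \<noteq> v\<close> were moved, take the one-parameter subgroup with weights \<open>\<alpha>(v)\<close> on \<open>u\<close> and
  \<open>-\<alpha>(u)\<close> on \<open>v\<close>. Homogeneous kernel elements have weight \<open>0\<close>, as they would otherwise be divisible by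
  \<open>u\<close> or by \<open>v\<close>. If \<open>\<epsilon>\<close> is the weight of \<open>D\<close>, iterating \<open>D\<close> on \<open>u\<close> until the kernel is reached
  shows that \<open>\<epsilon> < 0\<close>, and doing so on \<open>v\<close> that \<open>\<epsilon> > 0\<close>.
\<close>

lemma homogeneous_lnd_moves_one_variable:
  assumes D: "lnd B D" and hom: "\<And>f. homogeneous k m n a f \<Longrightarrow> homogeneous k m n a (D f)"
    and u: "u \<in> C - {VZ}" and v: "v \<in> C - {VZ}" and uv: "u \<noteq> v"
    and Du: "D (g u) \<noteq> \<zero>" and Dv: "D (g v) \<noteq> \<zero>"
  shows False
proof -
  note der = lnd_derivation[OF D]
  have uC: "u \<in> C" and vC: "v \<in> C" using u v by auto
  define \<tau> where "\<tau> w = (if w = u then int (\<alpha> v) else if w = v then - int (\<alpha> u) else 0)" for w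
  have \<tau>_sum: "(\<Sum>w\<in>C. \<tau> w * int (e w)) = int (\<alpha> v) * int (e u) - int (\<alpha> u) * int (e v)" for e
  proof -
    have "(\<Sum>w\<in>C. \<tau> w * int (e w)) = (\<Sum>w\<in>{u, v}. \<tau> w * int (e w))"
      by (rule sum.mono_neutral_right) (use uC vC in \<open>auto simp: \<tau>_def\<close>)
    then show ?thesis using uv by (simp add: \<tau>_def)
  qed
  interpret one_parameter_subgroup k m n a B \<tau>
    by unfold_locales (use u v in \<open>auto simp: \<tau>_sum\<close>, auto simp: \<tau>_def)
  have kernel_weight: "d = 0"
    if f: "homogeneous k m n a f" "f \<noteq> \<zero>" "D f = \<zero>" and d: "has_weight f d" for f d
  proof -
    obtain d' E c where E: "has_weight f d'" "finite E" "f = (\<lambda>p\<in>\<V>. poly_value C E c p)"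
      "\<forall>e\<in>E. exponent_weight e = d'" using homogeneous_weightE[OF f(1)] by metis
    have "d' = d" using has_weight_unique[OF homogeneous_mem[OF f(1)] f(2) E(1) d] .
    then have w: "int (\<alpha> v) * int (e u) - int (\<alpha> u) * int (e v) = d" if "e \<in> E" for e
      using E(4) that by (simp add: exponent_weight_def \<tau>_sum)
    show "d = 0"
    proof (cases d "0::int" rule: linorder_cases)
      case less
      have "e v > 0" if "e \<in> E" for e
      proof (rule ccontr)
        assume "\<not> e v > 0"
        then have "int (\<alpha> v) * int (e u) = d" using w[OF that] by simp
        moreover have "int (\<alpha> v) * int (e u) \<ge> 0" by simp
        ultimately show False using less by linarith
      qed
      then obtain h where h: "h \<in> carrier B" "f = g v \<otimes> h" using poly_value_divisible[OF vC _ E(3)] by blast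
      have "D (g v) = \<zero>"
        by (rule kernel_factor[OF D gen_mem[OF vC] h(1)]) (use f(2,3) h(2) in auto)
      then show ?thesis using Dv by simp
    next
      case greater
      have "e u > 0" if "e \<in> E" for e
      proof (rule ccontr)
        assume "\<not> e u > 0"
        then have "- (int (\<alpha> u) * int (e v)) = d" using w[OF that] by simp
        moreover have "int (\<alpha> u) * int (e v) \<ge> 0" by simp
        ultimately show False using greater by linarith
      qed
      then obtain h where h: "h \<in> carrier B" "f = g u \<otimes> h" using poly_value_divisible[OF uC _ E(3)] by blast
      have "D (g u) = \<zero>"
        by (rule kernel_factor[OF D gen_mem[OF uC] h(1)]) (use f(2,3) h(2) in auto)
      then show ?thesis using Du by simp
    qed simp
  qed
  obtain du where du: "has_weight (D (g u)) du" using homogeneous_weightE[OF hom[OF homogeneous_gen[OF uC]]] by metis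
  define \<epsilon> where "\<epsilon> = du - \<tau> u"
  have shift: "has_weight (D f) (d + \<epsilon>)"
    if f: "homogeneous k m n a f" and Df: "D f \<noteq> \<zero>" and d: "has_weight f d" for f d
  proof -
    note fm = homogeneous_mem[OF f]
    obtain d1 where d1: "has_weight (D f) d1" using homogeneous_weightE[OF hom[OF f]] by metis
    obtain s where s: "has_weight (D (g u \<otimes> f)) s"
      using homogeneous_weightE[OF hom[OF homogeneous_gen_mult[OF uC f]]] by metis
    have f0: "f \<noteq> \<zero>" using Df der by auto
    have nz: "D (g u) \<otimes> f \<noteq> \<zero>" "g u \<otimes> D f \<noteq> \<zero>"
      using no_zero_divisors[of "D (g u)" f] no_zero_divisors[of "g u" "D f"] der uC fm Du Df f0 gen_nonzero[OF uC]
      by auto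
    have "du + d = \<tau> u + d1"
    proof (rule sum_has_weight[OF _ nz(1) _ _ nz(2)])
      show "has_weight (D (g u) \<otimes> f) (du + d)" by (rule has_weight_mult[OF du d])
      show "has_weight (g u \<otimes> D f) (\<tau> u + d1)" by (rule has_weight_mult[OF has_weight_gen[OF uC] d1])
      show "has_weight (D (g u) \<otimes> f \<oplus> g u \<otimes> D f) s"
        using s unfolding derivation_mult[OF der gen_mem[OF uC] fm] .
    qed (use der uC fm in auto)
    then have "d1 = d + \<epsilon>" by (simp add: \<epsilon>_def)
    then show ?thesis using d1 by simp
  qed
  have chain: "d + int N * \<epsilon> = 0"
    if "homogeneous k m n a f" "lnd_degree D f N" "has_weight f d" for f N d
    using that
  proof (induction N arbitrary: f d)
    case 0
    then show ?case using kernel_weight[of f d] by (simp add: lnd_degree_0_iff)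
  next
    case (Suc N)
    have deg: "lnd_degree D (D f) N" by (rule lnd_degree_derivation[OF Suc.prems(2)])
    have "D f \<noteq> \<zero>" by (rule lnd_degree_nonzero[OF D deg])
    then have "d + \<epsilon> + int N * \<epsilon> = 0" using Suc shift[of f d] hom deg by blast
    then show ?case by (simp add: algebra_simps)
  qed
  obtain N where N: "lnd_degree D (g u) N" using lnd_degree_exists[OF D gen_mem[OF uC] gen_nonzero[OF uC]] by blast
  obtain N' where N': "lnd_degree D (g v) N'" using lnd_degree_exists[OF D gen_mem[OF vC] gen_nonzero[OF vC]] by blast
  have 1: "int (\<alpha> v) + int N * \<epsilon> = 0"
    using chain[OF homogeneous_gen[OF uC] N has_weight_gen[OF uC]] by (simp add: \<tau>_def)
  have 2: "- int (\<alpha> u) + int N' * \<epsilon> = 0"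
    using chain[OF homogeneous_gen[OF vC] N' has_weight_gen[OF vC]] uv by (simp add: \<tau>_def)
  have "\<epsilon> < 0"
  proof (rule ccontr)
    assume "\<not> \<epsilon> < 0"
    then have "int N * \<epsilon> \<ge> 0" by simp
    then show False using 1 exponent_pos[OF v] by simp
  qed
  then have "int N' * \<epsilon> \<le> 0" by (simp add: mult_nonneg_nonpos)
  then show False using 2 exponent_pos[OF u] by simp
qed

text \<open>
  The only variable moved, \<open>u\<close>, has exponent \<open>e = 1\<close>: with \<open>d\<close> the degree of \<open>z\<close>, the degree of
  \<open>D(z)\<close>, a multiple of \<open>u\<^sup>e\<^sup>-\<^sup>1\<close>, is \<open>d - 1\<close>, while the degree of \<open>u\<close> is \<open>nd/e\<close>.
\<close>

lemma moved_variable_exponent: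
  assumes D: "lnd B D" and nz: "D \<noteq> zero_map B" and u: "u \<in> C - {VZ}"
    and kill: "\<And>v. v \<in> C - {u, VZ} \<Longrightarrow> D (g v) = \<zero>"
  shows "\<alpha> u = 1"
proof (rule ccontr)
  note der = lnd_derivation[OF D]
  assume "\<alpha> u \<noteq> 1"
  then have e2: "\<alpha> u \<ge> 2" using exponent_pos[OF u] by simp
  have uC: "u \<in> C" using u by simp
  let ?N = "\<lambda>p\<in>\<V>. cofactor u p"
  note N = cofactor_mem[of u]
  have N0: "?N \<noteq> \<zero>"
    using gen_pow_cofactor_nonzero[OF uC, of 0] mult_zero(1)[OF pow_mem[OF gen_mem[OF uC]]] by metis
  have "D ?N = \<zero>" by (rule derivation_kills_polyfun[OF der cofactor_polyfun]) (use kill in auto)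
  then have Nd: "lnd_degree D ?N 0" using N0 unfolding lnd_degree_0_iff by blast
  obtain h where h: "h \<in> carrier B"
    and Dz: "\<And>p. p \<in> \<V> \<Longrightarrow> D (g VZ) p = p u ^ (\<alpha> u - 1) * cofactor u p * h p"
    using derivation_two_variables[OF der u kill] by metis
  have eq: "D (g VZ) = g u [^] (\<alpha> u - 1) \<otimes> ?N \<otimes> h"
    by (rule elem_eqI) (use der uC N h Dz in auto)
  note z0 = lnd_moves_VZ[OF D nz]
  have h0: "h \<noteq> \<zero>" using z0 uC N unfolding eq by auto
  obtain d where d: "lnd_degree D (g VZ) d"
    using lnd_degree_exists[OF D gen_mem[OF VZ_coords] gen_nonzero[OF VZ_coords]] by blast
  obtain d' where d': "d = Suc d'" using d z0 by (cases d) (auto simp: lnd_degree_0_iff)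
  obtain q where q: "lnd_degree D (g u) q"
    using lnd_degree_exists[OF D gen_mem[OF uC] gen_nonzero[OF uC]] by blast
  obtain r where r: "lnd_degree D h r" using lnd_degree_exists[OF D h h0] by blast
  have "lnd_degree D (D (g VZ)) ((\<alpha> u - 1) * q + 0 + r)"
    unfolding eq by (intro lnd_degree_mult[OF D] lnd_degree_pow[OF D] q r Nd mult_mem' pow_mem gen_mem uC N h)
  moreover have "lnd_degree D (D (g VZ)) d'" using d d' lnd_degree_derivation by simp
  ultimately have 1: "d' = (\<alpha> u - 1) * q + r" using lnd_degree_unique[OF D] by fastforce
  have "(D ^^ (n * d)) \<one> = \<zero>"
    by (rule derivation_iter_zero_mono[OF der, of 1]) (use der d' n_ge in auto)
  then have "lnd_degree D (g VZ [^] n \<oplus> \<one>) (n * d)"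
    by (intro lnd_degree_add_lower[OF D] lnd_degree_pow[OF D] d) auto
  moreover have "lnd_degree D (g VZ [^] n \<oplus> \<one>) (\<alpha> u * q + 0)"
    unfolding generator_relation[OF u, symmetric]
    by (intro lnd_degree_mult[OF D] lnd_degree_pow[OF D] q Nd pow_mem gen_mem uC N)
  ultimately have 2: "n * d = \<alpha> u * q" using lnd_degree_unique[OF D] by fastforce
  have "2 * d \<le> n * d" using n_ge by simp
  moreover obtain e where e: "\<alpha> u = e + 2" using e2 le_Suc_ex by (metis add.commute)
  ultimately show False using 1 2 d' by (simp add: algebra_simps)
qed

text \<open>
  An irreducible derivation is not a proper multiple of the standard one, so that the factor is a
  unit; being killed by the derivation, it is a unit among the polynomials in the variables of \<open>W\<close>.
\<close>

theorem homogeneous_irreducible_lnd: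
  assumes irr: "irreducible_lnd B D" and hom: "homogeneous_derivation k m n a D"
  shows "\<exists>i c. standard_lnd k m n a B i D c"
proof -
  have D: "lnd B D" and nz: "D \<noteq> zero_map B"
    and ideal: "\<And>I. principalideal I B \<Longrightarrow> D ` carrier B \<subseteq> I \<Longrightarrow> I = carrier B"
    using irr by (auto simp: irreducible_lnd_def)
  note der = lnd_derivation[OF D]
  have hom: "homogeneous k m n a f \<Longrightarrow> homogeneous k m n a (D f)" for f
    using hom by (simp add: homogeneous_derivation_def)
  obtain u where u: "u \<in> C - {VZ}" "D (g u) \<noteq> \<zero>" using lnd_moves_variable[OF D nz] by blast
  have kill: "D (g v) = \<zero>" if "v \<in> C - {u, VZ}" for v
    using homogeneous_lnd_moves_one_variable[OF D hom u(1) _ _ u(2), of v] that by blast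
  have "\<alpha> u = 1" by (rule moved_variable_exponent[OF D nz u(1) kill])
  then obtain i where i: "u = VX i" "i \<in> {1..k}" using u(1) a_ge by (force simp: coords_def)
  interpret chart k m n a B i by unfold_locales (rule i)
  have kill: "\<And>v. v \<in> W \<Longrightarrow> D (g v) = \<zero>" using kill i by simp
  obtain F where F: "F \<in> polyfun W" and Dz: "\<And>p. p \<in> \<V> \<Longrightarrow> D (g VZ) p = M p * F p"
    and Dx: "\<And>p. p \<in> \<V> \<Longrightarrow> D (g (VX i)) p = of_nat n * p VZ ^ (n - 1) * F p"
    using lnd_killing_W[OF D kill] by metis
  note Fm = iota_mem[OF F]
  have zero: "\<exists>h\<in>carrier B. \<zero> = h \<otimes> \<iota> F"
    using mult_zero(2)[OF Fm, symmetric] zero_mem by blast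
  have multiple: "\<exists>h\<in>carrier B. D f = h \<otimes> \<iota> F" if "f \<in> carrier B" for f
    using that
  proof (induction rule: carrier_induct)
    case (const r)
    show ?case unfolding derivation_const[OF der] by (rule zero)
  next
    case (gen v)
    consider "v \<in> W" | "v = VX i" | "v = VZ" using gen by blast
    then show ?case
    proof cases
      case 1
      show ?thesis unfolding kill[OF 1] by (rule zero)
    next
      case 2
      have mem: "of_nat n \<odot> g VZ [^] (n - 1) \<in> carrier B" by simp
      have "D (g v) = (of_nat n \<odot> g VZ [^] (n - 1)) \<otimes> \<iota> F"
        unfolding 2 by (rule elem_eqI[OF derivation_mem[OF der gen_mem[OF VX_i_coords]] mult_mem'[OF mem Fm]])
          (simp add: Dx)
      then show ?thesis using mem by blast
    next
      case 3
      have "D (g v) = \<iota> M \<otimes> \<iota> F"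
        unfolding 3 by (rule elem_eqI[OF derivation_mem[OF der gen_mem[OF VZ_coords]] mult_mem'[OF iota_M_mem Fm]])
          (simp add: Dz)
      then show ?thesis using iota_M_mem by blast
    qed
  next
    case (add f1 f2)
    then obtain h1 h2 where h: "h1 \<in> carrier B" "D f1 = h1 \<otimes> \<iota> F" "h2 \<in> carrier B" "D f2 = h2 \<otimes> \<iota> F" by blast
    have "D (f1 \<oplus> f2) = (h1 \<oplus> h2) \<otimes> \<iota> F"
      unfolding derivation_add[OF der add(1,2)] h(2,4)
      by (rule elem_eqI) (use h Fm in \<open>auto simp: algebra_simps intro!: add_mem' mult_mem'\<close>)
    then show ?case using h add_mem' by blast
  next
    case (mult f1 f2)
    then obtain h1 h2 where h: "h1 \<in> carrier B" "D f1 = h1 \<otimes> \<iota> F" "h2 \<in> carrier B" "D f2 = h2 \<otimes> \<iota> F" by blast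
    have "D (f1 \<otimes> f2) = (h1 \<otimes> f2 \<oplus> f1 \<otimes> h2) \<otimes> \<iota> F"
      unfolding derivation_mult[OF der mult(1,2)] h(2,4)
      by (rule elem_eqI) (use h mult Fm in \<open>auto simp: algebra_simps intro!: add_mem' mult_mem'\<close>)
    then show ?case using h mult mult_mem' add_mem' by metis
  qed
  have "principalideal (PIdl (\<iota> F)) B" by (rule cring.cgenideal_is_principalideal[OF cring_B Fm])
  moreover have "D ` carrier B \<subseteq> PIdl (\<iota> F)" using multiple by (auto simp: cgenideal_def)
  ultimately have "PIdl (\<iota> F) = carrier B" by (rule ideal)
  then have "\<one> \<in> PIdl (\<iota> F)" using one_mem by argo
  then obtain x where x: "x \<in> carrier B" "\<one> = x \<otimes> \<iota> F" by (auto simp: cgenideal_def)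
  obtain p where "p \<in> \<V>" using generic_point by blast
  then have one: "\<one> \<noteq> \<zero>" by (metis eval_one eval_zero zero_neq_one)
  have "D (x \<otimes> \<iota> F) = \<zero>" unfolding x(2)[symmetric] by (rule derivation_one[OF der])
  moreover have "x \<otimes> \<iota> F \<noteq> \<zero>" using one unfolding x(2) .
  ultimately have Dx0: "D x = \<zero>" by (rule kernel_factor[OF D x(1) Fm])
  have x0: "x \<noteq> \<zero>" using \<open>x \<otimes> \<iota> F \<noteq> \<zero>\<close> mult_zero(2)[OF Fm] by blast
  obtain b L q where b: "expansion b (Suc L) x" "b L q \<noteq> 0" using expansion_nonzeroE[OF x(1) x0] by metis
  obtain d where d: "lnd_degree D (g VZ) d"
    using lnd_degree_exists[OF D gen_mem[OF VZ_coords] gen_nonzero[OF VZ_coords]] by blast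
  then have d0: "d > 0" using lnd_moves_VZ[OF D nz] by (cases d) (auto simp: lnd_degree_0_iff)
  have "lnd_degree D x (L * d)" by (rule degree_expansion[OF D kill d d0 b(1) x(1) b(2)])
  moreover have "lnd_degree D x 0" using x0 Dx0 by (simp add: lnd_degree_0_iff)
  ultimately have "L * d = 0" using lnd_degree_unique[OF D] by blast
  then have L: "L = 0" using d0 by simp
  have b0: "b 0 \<in> polyfun W" using b by (auto simp: expansion_def)
  have xb: "x p = b 0 p" if "p \<in> \<V>" for p using b(1) that unfolding L by (simp add: expansion_def basis_def)
  have FB: "F p * b 0 p = 1" if "p \<in> \<V>" for p
    using fun_cong[OF x(2), of p] that xb[OF that] by (simp add: mult.commute)
  have FB': "F q * b 0 q = 1" for q
    by (rule iota_eqD[where F = "\<lambda>p. F p * b 0 p" and H = "\<lambda>_. 1", OF polyfun_mult[OF F b0] polyfun_const FB])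
  obtain c where c: "c \<noteq> 0" "\<And>p. F p = c" using polyfun_unit_const[OF F b0 FB'] by auto
  have "standard_lnd k m n a B i D c"
    by unfold_locales (use D c kill Dz Dx in \<open>auto simp: mult.commute\<close>)
  then show ?thesis by blast
qed

end

theorem theorem10p2:
  fixes k m n :: nat
    and a :: "nat \<Rightarrow> nat"
    and \<delta> :: "((coord \<Rightarrow> 'k::{alg_closed_field, field_char_0}) \<Rightarrow> 'k) \<Rightarrow> ((coord \<Rightarrow> 'k) \<Rightarrow> 'k)"
  defines "B \<equiv> coord_ring k m n a"
  defines "G \<equiv> aut_centralizer_group B \<delta>"
  defines "S \<equiv> permutation_aut k m n a \<delta>"
  defines "H \<equiv> quasitorus_centralizer k m n a \<delta>"
  assumes "k \<ge> 2" and "n \<ge> 2" and "\<And>s. s \<in> {1..m} \<Longrightarrow> a s > 1"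
    and "irreducible_lnd B \<delta>" and "homogeneous_derivation k m n a \<delta>"
  shows "internal_semidirect G (S <#>\<^bsub>G\<^esub> H) (unipotent_aut B \<delta>) \<and>
         internal_semidirect (G\<lparr>carrier := S <#>\<^bsub>G\<^esub> H\<rparr>) S H"
proof -
  interpret hypersurface_ring k m n a B
    by unfold_locales (use assms in auto)
  obtain i c where "standard_lnd k m n a B i \<delta> c"
    using homogeneous_irreducible_lnd assms by blast
  then interpret standard_lnd k m n a B i \<delta> c .
  show ?thesis unfolding G_def S_def H_def using centralizer_decomposition by blast
qed

end
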